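(* Let $U = n^{1+\Theta(1)}$ and let $k \le \log^* n$ be a positive integer. Any dynamic dictionary storing at most $n$ keys from $[U]$ with $O(\log^{(k)} n)$ wasted bits per key must have expected insertion, deletion, or query time at least $\Omega(k)$, in the cell-probe model with word size $w = \Theta(\log U)$.
   Context: A dynamic dictionary maintains a set $T$ of at most $n$ distinct keys from the universe $[U]=\{1,\dots,U\}$ under insertions (of a key not in $T$ when $|T|<n$), deletions (of a key in $T$), and membership queries ("is $x\in T$?"). In the cell-probe model the memory consists of cells of $w$ bits each; each read or write of a cell (a cell-probe) costs one unit and computation is free; time is measured as the number of cell-probes. If the data structure uses $\log\binom{U}{n} + R$ bits of memory, $R$ is called its redundancy and $R/n$ its number of wasted bits per key. $\log^{(k)}$ denotes the $k$-fold iterated logarithm ($\log^{(0)} n = n$) and $\log^*$ the iterated logarithm. *)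

theory Defs
  imports "HOL-Probability.Probability"
begin

text \<open>A probe action: read a cell, write a value into a cell, or halt with an answer
  (the answer is only meaningful for queries). Memory is a map from cell addresses to
  cell contents (natural numbers below 2^w).\<close>

datatype action = Read nat | Write nat nat | Halt bool

datatype dop = Ins nat | Del nat | Qry nat

type_synonym hist = "nat option list"   \<comment> \<open>Some v: value read; None: a write was done\<close>
type_synonym mem = "nat \<Rightarrow> nat"

text \<open>Executing one operation, given as an adaptive probing strategy (a function of the
  history of the probes so far), with a fuel bound; returns final memory, answer, and
  the number of cell probes (reads and writes) performed.\<close>

fun exec :: "nat \<Rightarrow> (hist \<Rightarrow> action) \<Rightarrow> mem \<Rightarrow> hist \<Rightarrow> (mem \<times> bool \<times> nat) option" where
  "exec 0 A m h = None"
| "exec (Suc f) A m h = (case A h of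
      Halt b \<Rightarrow> Some (m, b, 0)
    | Read a \<Rightarrow> map_option (\<lambda>(m', b, t). (m', b, Suc t)) (exec f A m (h @ [Some (m a)]))
    | Write a v \<Rightarrow> map_option (\<lambda>(m', b, t). (m', b, Suc t)) (exec f A (m(a := v)) (h @ [None])))"

definition run :: "(hist \<Rightarrow> action) \<Rightarrow> mem \<Rightarrow> (mem \<times> bool \<times> nat) option" where
  "run A m = (if \<exists>f. exec f A m [] \<noteq> None
              then exec (LEAST f. exec f A m [] \<noteq> None) A m [] else None)"

fun exec_seq :: "(dop \<Rightarrow> hist \<Rightarrow> action) \<Rightarrow> mem \<Rightarrow> dop list \<Rightarrow> (ennreal \<times> bool option) list" where
  "exec_seq A m [] = []"
| "exec_seq A m (q # qs) = (case run (A q) m of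
      None \<Rightarrow> (\<infinity>, None) # exec_seq A m qs
    | Some (m', b, t) \<Rightarrow> (of_nat t, Some b) # exec_seq A m' qs)"

fun apply_op :: "nat set \<Rightarrow> dop \<Rightarrow> nat set" where
  "apply_op T (Ins x) = insert x T"
| "apply_op T (Del x) = T - {x}"
| "apply_op T (Qry x) = T"

definition set_after :: "dop list \<Rightarrow> nat set" where
  "set_after qs = foldl apply_op {} qs"

fun valid_op :: "nat \<Rightarrow> nat \<Rightarrow> nat set \<Rightarrow> dop \<Rightarrow> bool" where
  "valid_op n U T (Ins x) = (x \<in> {1..U} \<and> x \<notin> T \<and> card T < n)"
| "valid_op n U T (Del x) = (x \<in> T)"
| "valid_op n U T (Qry x) = (x \<in> {1..U})"

definition valid_seq :: "nat \<Rightarrow> nat \<Rightarrow> dop list \<Rightarrow> bool" where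
  "valid_seq n U qs = (\<forall>i < length qs. valid_op n U (set_after (take i qs)) (qs ! i))"

text \<open>Public randomness: an infinite string of fair coin flips.\<close>
definition coins :: "(nat \<Rightarrow> bool) measure" where
  "coins = PiM UNIV (\<lambda>_. measure_pmf (bernoulli_pmf (1/2)))"

text \<open>A randomized data structure: initial memory init s and probing strategy alg s,
  both depending on the random string s. It uses S cells of w bits.\<close>

definition cp_wf :: "nat \<Rightarrow> nat \<Rightarrow> ((nat \<Rightarrow> bool) \<Rightarrow> mem) \<Rightarrow> ((nat \<Rightarrow> bool) \<Rightarrow> dop \<Rightarrow> hist \<Rightarrow> action) \<Rightarrow> bool" where
  "cp_wf S w init alg =
     ((\<forall>s a. a < S \<longrightarrow> init s a < 2 ^ w) \<and>
      (\<forall>s q h a. alg s q h = Read a \<longrightarrow> a < S) \<and>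
      (\<forall>s q h a v. alg s q h = Write a v \<longrightarrow> a < S \<and> v < 2 ^ w))"

definition cp_measurable :: "((nat \<Rightarrow> bool) \<Rightarrow> mem) \<Rightarrow> ((nat \<Rightarrow> bool) \<Rightarrow> dop \<Rightarrow> hist \<Rightarrow> action) \<Rightarrow> bool" where
  "cp_measurable init alg =
     ((\<forall>a. (\<lambda>s. init s a) \<in> measurable coins (count_space UNIV)) \<and>
      (\<forall>q h. (\<lambda>s. alg s q h) \<in> measurable coins (count_space UNIV)))"

definition cp_correct :: "nat \<Rightarrow> nat \<Rightarrow> ((nat \<Rightarrow> bool) \<Rightarrow> mem) \<Rightarrow> ((nat \<Rightarrow> bool) \<Rightarrow> dop \<Rightarrow> hist \<Rightarrow> action) \<Rightarrow> bool" where
  "cp_correct n U init alg =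
     (AE s in coins. \<forall>qs. valid_seq n U qs \<longrightarrow>
        (\<forall>i < length qs. \<forall>x b. qs ! i = Qry x \<longrightarrow>
            snd (exec_seq (alg s) (init s) qs ! i) = Some b \<longrightarrow> b = (x \<in> set_after (take i qs))))"

definition exp_cost :: "((nat \<Rightarrow> bool) \<Rightarrow> mem) \<Rightarrow> ((nat \<Rightarrow> bool) \<Rightarrow> dop \<Rightarrow> hist \<Rightarrow> action) \<Rightarrow> dop list \<Rightarrow> nat \<Rightarrow> ennreal" where
  "exp_cost init alg qs i = (\<integral>\<^sup>+ s. fst (exec_seq (alg s) (init s) qs ! i) \<partial>coins)"

definition ilog :: "nat \<Rightarrow> real \<Rightarrow> real" where
  "ilog k x = ((\<lambda>y. log 2 y) ^^ k) x"

definition log_star :: "real \<Rightarrow> nat" where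
  "log_star x = (LEAST k. ilog k x \<le> 1)"

end

theory Submission
  imports Defs "HOL-Combinatorics.Multiset_Permutations" "HOL-Real_Asymp.Real_Asymp"
begin

text \<open>
  By averaging we fix the random string and obtain a deterministic structure that is fast on a random
  sequence of updates, each of which queries and deletes the oldest key and inserts a fresh one.

  Cut a block of updates into \<open>q\<close> intervals of \<open>s\<close> updates. If the intervals rarely probe cells that
  are probed again later in the block, then the final memory \<open>E\<close> shows what an interval wrote. Given the
  key set, \<open>E\<close> has entropy at most the redundancy, so \<open>E\<close> hides which fresh key belongs to which
  interval, provided that \<open>q * s * log q\<close> exceeds the redundancy. Hence, resampling the keys inserted in
  one interval conditionally on the past and on \<open>E\<close> gives a second run of that interval with nearly
  independent keys and the same visible result. Take the memory after the first run and put the old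
  contents back on the cells probed by both runs. This hybrid, which has as many bits as one memory, agrees with
  the old memory on all cells of the second run, so that run can be replayed on it: the
  replay reveals the \<open>s\<close> deleted keys and also restores the memory after the interval. So \<open>n + s\<close> keys
  are stored in the space of one memory, a contradiction if \<open>s * log U\<close> exceeds the redundancy.

  Blocks of lengths about \<open>n / ilog (2 * j) n\<close> form nested levels, each of which
  contributes a constant number of probes per update.
\<close>

section \<open>Conditional entropy on a finite probability space\<close>

text \<open>The contradiction is an entropy balance. Decoding the \<open>s\<close> deleted keys from
  the hybrid needs the resampled keys as input, at a price of \<open>s * log U\<close>. It is almost
  refunded: let \<open>a\<close> be the number of keys inserted from the interval to the end of the
  block. A resampled key lies in the final key set and cheapens its description by about
  \<open>log U - log a\<close>, and its own entropy given the first run is about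
  \<open>log a\<close>. The refund fails for keys that both runs insert in the interval, hence the
  need for near independence. What remains is \<open>s * log (U / n)\<close>: a deleted key is worth
  \<open>log U\<close> bits, and \<open>log n\<close> bits single it out among the stored keys. Here
  U is required to exceed n by a power.

  Two logarithms separate the levels for this reason. With \<open>y = ilog (2 * j + 2) n\<close>, a
  block has about n / y updates and the redundancy is at most of order n * y, that is, y^2 per
  update of the block. The logarithm of the number of intervals must dominate y^2. It is about 2^y
  with two logarithms per level, but only about y with one.\<close>

locale fin_prob =
  fixes \<Omega> :: "'w set" and p :: "'w \<Rightarrow> real"
  assumes fin: "finite \<Omega>" and pos: "\<And>om. om \<in> \<Omega> \<Longrightarrow> p om > 0" and tot: "sum p \<Omega> = 1"
begin

text \<open>Laws are indexed by outcomes instead of values: this is the probability that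
  \<open>f\<close> takes the value it has at \<open>om\<close>. Entropies of maps into any type,
  memories included, thus become finite sums over \<Omega>.\<close>

definition mass :: "('w \<Rightarrow> 'a) \<Rightarrow> 'w \<Rightarrow> real" where
  "mass f om = (\<Sum>om'\<in>{om'\<in>\<Omega>. f om' = f om}. p om')"

definition cond_ent :: "('w \<Rightarrow> 'a) \<Rightarrow> ('w \<Rightarrow> 'b) \<Rightarrow> real" where
  "cond_ent f g = (\<Sum>om\<in>\<Omega>. p om * log 2 (mass g om / mass (\<lambda>x. (g x, f x)) om))"

definition ex :: "('w \<Rightarrow> real) \<Rightarrow> real" where
  "ex h = (\<Sum>om\<in>\<Omega>. p om * h om)"

lemma mass_pos: "om \<in> \<Omega> \<Longrightarrow> mass f om > 0"
  unfolding mass_def using fin pos by (intro sum_pos) auto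

lemma mass_cong:
  assumes "\<And>om'. om' \<in> \<Omega> \<Longrightarrow> f om' = f om \<longleftrightarrow> g om' = g om"
  shows "mass f om = mass g om"
  unfolding mass_def using assms by (metis (mono_tags, lifting))

text \<open>Only the partitions induced by the two maps matter, so equivalent conditions can be
  exchanged.\<close>

lemma cond_ent_cong:
  assumes "\<And>om om'. om \<in> \<Omega> \<Longrightarrow> om' \<in> \<Omega> \<Longrightarrow> g om' = g om \<longleftrightarrow> g2 om' = g2 om"
    and "\<And>om om'. om \<in> \<Omega> \<Longrightarrow> om' \<in> \<Omega> \<Longrightarrow> g om' = g om \<Longrightarrow> f om' = f om \<longleftrightarrow> f2 om' = f2 om"
  shows "cond_ent f g = cond_ent f2 g2"
  unfolding cond_ent_def
proof (rule sum.cong[OF refl])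
  fix om assume w: "om \<in> \<Omega>"
  have 1: "mass g om = mass g2 om" by (rule mass_cong) (use assms w in auto)
  have 2: "mass (\<lambda>x. (g x, f x)) om = mass (\<lambda>x. (g2 x, f2 x)) om"
    by (rule mass_cong) (use assms w in auto)
  show "p om * log 2 (mass g om / mass (\<lambda>x. (g x, f x)) om)
      = p om * log 2 (mass g2 om / mass (\<lambda>x. (g2 x, f2 x)) om)"
    using 1 2 by simp
qed

lemma cond_ent_chain: "cond_ent (\<lambda>x. (f x, h x)) g = cond_ent f g + cond_ent h (\<lambda>x. (g x, f x))"
proof -
  have m: "mass (\<lambda>x. (g x, f x, h x)) om = mass (\<lambda>x. ((g x, f x), h x)) om" for om
    by (rule mass_cong) auto
  show ?thesis
    unfolding cond_ent_def m sum.distrib[symmetric]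
  proof (rule sum.cong[OF refl])
    fix om assume w: "om \<in> \<Omega>"
    have "mass g om > 0" "mass (\<lambda>x. (g x, f x)) om > 0" "mass (\<lambda>x. ((g x, f x), h x)) om > 0"
      using w by (auto intro: mass_pos)
    then show "p om * log 2 (mass g om / mass (\<lambda>x. ((g x, f x), h x)) om)
      = p om * log 2 (mass g om / mass (\<lambda>x. (g x, f x)) om)
      + p om * log 2 (mass (\<lambda>x. (g x, f x)) om / mass (\<lambda>x. ((g x, f x), h x)) om)"
      by (simp add: log_divide algebra_simps)
  qed
qed

text \<open>The outcomes with a given value weigh \<open>mass\<close> in total, so the division
  leaves weight one per value.\<close>

lemma sum_by_fiber:
  "(\<Sum>om\<in>\<Omega>. p om * G (k om) / mass k om) = (\<Sum>y\<in>k ` \<Omega>. G y)"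
proof -
  have "(\<Sum>om\<in>\<Omega>. p om * G (k om) / mass k om)
      = (\<Sum>y\<in>k ` \<Omega>. \<Sum>om\<in>{x\<in>\<Omega>. k x = y}. p om * G (k om) / mass k om)"
    by (rule sum.image_gen[OF fin])
  also have "\<dots> = (\<Sum>y\<in>k ` \<Omega>. G y)"
  proof (rule sum.cong[OF refl])
    fix y assume "y \<in> k ` \<Omega>"
    then obtain w where w: "w \<in> \<Omega>" "y = k w" by auto
    have "(\<Sum>om\<in>{x\<in>\<Omega>. k x = y}. p om * G (k om) / mass k om)
        = (\<Sum>om\<in>{x\<in>\<Omega>. k x = y}. p om * (G y / mass k w))"
      by (rule sum.cong) (auto simp: w mass_def)
    also have "\<dots> = mass k w * (G y / mass k w)"
      unfolding sum_distrib_right[symmetric] by (simp add: mass_def w)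
    also have "\<dots> = G y" using mass_pos[OF w(1), of k] by simp
    finally show "(\<Sum>om\<in>{x\<in>\<Omega>. k x = y}. p om * G (k om) / mass k om) = G y" .
  qed
  finally show ?thesis .
qed

lemma sum_mass_image: "(\<Sum>y\<in>g ` \<Omega>. \<Sum>om\<in>{x\<in>\<Omega>. g x = y}. p om) = 1"
  using sum.image_gen[OF fin, of p g] tot by simp

text \<open>The coding bound: a sub-probability kernel \<open>\<mu>\<close> is a code for
  \<open>f\<close> given \<open>g\<close>, and its mean code length dominates the entropy, by ln x
  \<le> x - 1. The upper bounds below arise from it by choosing \<open>\<mu>\<close> to fit the
  coded object.\<close>

lemma gibbs:
  fixes f :: "'w \<Rightarrow> 'a" and g :: "'w \<Rightarrow> 'b"
  assumes mpos: "\<And>om. om \<in> \<Omega> \<Longrightarrow> \<mu> (g om) (f om) > 0"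
    and sub: "\<And>om. om \<in> \<Omega> \<Longrightarrow> (\<Sum>v\<in>f ` {om'\<in>\<Omega>. g om' = g om}. \<mu> (g om) v) \<le> 1"
  shows "cond_ent f g \<le> ex (\<lambda>om. log 2 (1 / \<mu> (g om) (f om)))"
proof -
  let ?k = "\<lambda>x. (g x, f x)"
  define Pg where "Pg u = (\<Sum>om\<in>{x\<in>\<Omega>. g x = u}. p om)" for u
  have Pg0: "Pg u \<ge> 0" for u unfolding Pg_def by (rule sum_nonneg) (auto dest: pos)
  have mg: "mass g om = Pg (g om)" for om by (simp add: mass_def Pg_def)
  have "cond_ent f g - ex (\<lambda>om. log 2 (1 / \<mu> (g om) (f om)))
      = (\<Sum>om\<in>\<Omega>. p om * log 2 (\<mu> (g om) (f om) * Pg (g om) / mass ?k om))"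
    unfolding cond_ent_def ex_def sum_subtractf[symmetric]
  proof (rule sum.cong[OF refl])
    fix om assume w: "om \<in> \<Omega>"
    have "mass g om > 0" "mass ?k om > 0" "\<mu> (g om) (f om) > 0"
      using w mpos by (auto intro: mass_pos)
    then show "p om * log 2 (mass g om / mass ?k om) - p om * log 2 (1 / \<mu> (g om) (f om))
       = p om * log 2 (\<mu> (g om) (f om) * Pg (g om) / mass ?k om)"
      unfolding mg by (simp add: log_divide log_mult algebra_simps)
  qed
  also have "\<dots> \<le> (\<Sum>om\<in>\<Omega>. p om * ((\<mu> (g om) (f om) * Pg (g om) / mass ?k om - 1) / ln 2))"
  proof (rule sum_mono)
    fix om assume w: "om \<in> \<Omega>"
    have m: "mass g om > 0" "mass ?k om > 0" "\<mu> (g om) (f om) > 0"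
      using w mpos by (auto intro: mass_pos)
    then have "log 2 (\<mu> (g om) (f om) * Pg (g om) / mass ?k om)
        \<le> (\<mu> (g om) (f om) * Pg (g om) / mass ?k om - 1) / ln 2"
      unfolding log_def mg by (intro divide_right_mono ln_le_minus_one) auto
    then show "p om * log 2 (\<mu> (g om) (f om) * Pg (g om) / mass ?k om)
      \<le> p om * ((\<mu> (g om) (f om) * Pg (g om) / mass ?k om - 1) / ln 2)"
      by (rule mult_left_mono) (use pos[OF w] in simp)
  qed
  also have "\<dots> = ((\<Sum>om\<in>\<Omega>. p om * (\<mu> (g om) (f om) * Pg (g om)) / mass ?k om) - 1) / ln 2"
    (is "?L = _")
  proof -
    have "?L = (\<Sum>om\<in>\<Omega>. (p om * (\<mu> (g om) (f om) * Pg (g om)) / mass ?k om - p om) / ln 2)"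
      by (rule sum.cong) (auto simp: algebra_simps diff_divide_distrib)
    then show ?thesis
      by (simp add: sum_divide_distrib[symmetric] sum_subtractf tot)
  qed
  also have "(\<Sum>om\<in>\<Omega>. p om * (\<mu> (g om) (f om) * Pg (g om)) / mass ?k om)
      = (\<Sum>y\<in>?k ` \<Omega>. \<mu> (fst y) (snd y) * Pg (fst y))"
    using sum_by_fiber[of "\<lambda>y. \<mu> (fst y) (snd y) * Pg (fst y)" ?k] by simp
  also have "?k ` \<Omega> = Sigma (g ` \<Omega>) (\<lambda>u. f ` {x\<in>\<Omega>. g x = u})"
  proof (intro equalityI subsetI)
    fix y assume "y \<in> Sigma (g ` \<Omega>) (\<lambda>u. f ` {x\<in>\<Omega>. g x = u})"
    then obtain b where "b \<in> \<Omega>" "y = ?k b" by auto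
    then show "y \<in> ?k ` \<Omega>" by blast
  qed auto
  also have "(\<Sum>y\<in>Sigma (g ` \<Omega>) (\<lambda>u. f ` {x\<in>\<Omega>. g x = u}). \<mu> (fst y) (snd y) * Pg (fst y))
      = (\<Sum>u\<in>g ` \<Omega>. \<Sum>v\<in>f ` {x\<in>\<Omega>. g x = u}. \<mu> u v * Pg u)"
    using fin by (subst sum.Sigma) (auto simp: case_prod_beta)
  also have "\<dots> = (\<Sum>u\<in>g ` \<Omega>. (\<Sum>v\<in>f ` {x\<in>\<Omega>. g x = u}. \<mu> u v) * Pg u)"
    by (simp add: sum_distrib_right)
  also have "(\<dots> - 1) / ln 2 \<le> ((\<Sum>u\<in>g ` \<Omega>. Pg u) - 1) / ln 2"
  proof (intro divide_right_mono diff_right_mono sum_mono)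
    fix u assume "u \<in> g ` \<Omega>"
    then obtain w where w: "w \<in> \<Omega>" "u = g w" by auto
    show "(\<Sum>v\<in>f ` {x\<in>\<Omega>. g x = u}. \<mu> u v) * Pg u \<le> Pg u"
      using mult_right_mono[OF sub[OF w(1)] Pg0[of u]] unfolding w(2) by simp
  qed simp
  also have "\<dots> = 0" using sum_mass_image[of g] by (simp add: Pg_def)
  finally show ?thesis by simp
qed

lemma ex_mono: "(\<And>om. om \<in> \<Omega> \<Longrightarrow> f om \<le> g om) \<Longrightarrow> ex f \<le> ex g"
  unfolding ex_def by (intro sum_mono mult_left_mono) (auto dest: pos)

lemma ex_const: "ex (\<lambda>_. c) = c"
  unfolding ex_def by (simp add: sum_distrib_right[symmetric] tot)

lemma ex_add: "ex (\<lambda>om. f om + g om) = ex f + ex g"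
  unfolding ex_def by (simp add: algebra_simps sum.distrib)

lemma ex_diff: "ex (\<lambda>om. f om - g om) = ex f - ex g"
  unfolding ex_def by (simp add: algebra_simps sum_subtractf)

lemma ex_cmult: "ex (\<lambda>om. c * f om) = c * ex f"
  unfolding ex_def by (simp add: algebra_simps sum_distrib_left)

lemma cond_ent_nonneg: "cond_ent f g \<ge> 0"
  unfolding cond_ent_def
proof (rule sum_nonneg)
  fix om assume w: "om \<in> \<Omega>"
  have "mass (\<lambda>x. (g x, f x)) om \<le> mass g om"
    unfolding mass_def by (rule sum_mono2) (use fin in \<open>auto dest: pos\<close>)
  moreover have "mass (\<lambda>x. (g x, f x)) om > 0" using w by (rule mass_pos)
  ultimately have "log 2 (mass g om / mass (\<lambda>x. (g x, f x)) om) \<ge> 0" by simp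
  then show "0 \<le> p om * log 2 (mass g om / mass (\<lambda>x. (g x, f x)) om)"
    using pos[OF w] by simp
qed

text \<open>The code is uniform on the values that are still possible.\<close>

lemma cond_ent_card:
  fixes f :: "'w \<Rightarrow> 'a" and g :: "'w \<Rightarrow> 'b"
  assumes "\<And>om. om \<in> \<Omega> \<Longrightarrow> real (card (f ` {om'\<in>\<Omega>. g om' = g om})) \<le> c om"
  shows "cond_ent f g \<le> ex (\<lambda>om. log 2 (c om))"
proof -
  define \<mu> where "\<mu> u v = 1 / real (card (f ` {om'\<in>\<Omega>. g om' = u}))" for u :: 'b and v :: 'a
  have c1: "real (card (f ` {om'\<in>\<Omega>. g om' = g om})) \<ge> 1" if "om \<in> \<Omega>" for om
  proof -
    have "f om \<in> f ` {om'\<in>\<Omega>. g om' = g om}" using that by auto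
    then show ?thesis using fin by (metis (no_types, lifting) One_nat_def Suc_leI card_gt_0_iff empty_iff
          finite_imageI finite_subset mem_Collect_eq of_nat_1 of_nat_le_iff subsetI)
  qed
  have "cond_ent f g \<le> ex (\<lambda>om. log 2 (1 / \<mu> (g om) (f om)))"
  proof (rule gibbs)
    fix om assume w: "om \<in> \<Omega>"
    show "\<mu> (g om) (f om) > 0" using c1[OF w] by (simp add: \<mu>_def)
    show "(\<Sum>v\<in>f ` {om'\<in>\<Omega>. g om' = g om}. \<mu> (g om) v) \<le> 1"
      using c1[OF w] by (simp add: \<mu>_def)
  qed
  also have "\<dots> \<le> ex (\<lambda>om. log 2 (c om))"
  proof (rule ex_mono)
    fix om assume w: "om \<in> \<Omega>"
    show "log 2 (1 / \<mu> (g om) (f om)) \<le> log 2 (c om)"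
      using assms[OF w] c1[OF w] by (simp add: \<mu>_def)
  qed
  finally show ?thesis .
qed

lemma cond_ent_card_const:
  assumes "\<And>om. om \<in> \<Omega> \<Longrightarrow> real (card (f ` {om'\<in>\<Omega>. g om' = g om})) \<le> c"
  shows "cond_ent f g \<le> log 2 c"
  using cond_ent_card[of f g "\<lambda>_. c"] assms by (simp add: ex_const)

text \<open>The true conditional law of \<open>f\<close> given \<open>g\<close> is an admissible
  code for \<open>f\<close> given \<open>h\<close>, because \<open>g\<close> factors through
  \<open>h\<close>; \<open>pick\<close> is the factor.\<close>

lemma cond_ent_cond_mono:
  assumes det: "\<And>om om'. om \<in> \<Omega> \<Longrightarrow> om' \<in> \<Omega> \<Longrightarrow> h om = h om' \<Longrightarrow> g om = g om'"
  shows "cond_ent f h \<le> cond_ent f g"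
proof -
  define P where "P u v = (\<Sum>om\<in>{x\<in>\<Omega>. g x = u \<and> f x = v}. p om) / (\<Sum>om\<in>{x\<in>\<Omega>. g x = u}. p om)" for u v
  define pick where "pick y = g (SOME om. om \<in> \<Omega> \<and> h om = y)" for y
  have pick: "pick (h om) = g om" if "om \<in> \<Omega>" for om
  proof -
    have "(SOME om'. om' \<in> \<Omega> \<and> h om' = h om) \<in> \<Omega> \<and> h (SOME om'. om' \<in> \<Omega> \<and> h om' = h om) = h om"
      by (rule someI[where P="\<lambda>om'. om' \<in> \<Omega> \<and> h om' = h om"]) (use that in auto)
    then show ?thesis unfolding pick_def using det that by blast
  qed
  have m1: "(\<Sum>om'\<in>{x\<in>\<Omega>. g x = g om \<and> f x = f om}. p om') = mass (\<lambda>x. (g x, f x)) om"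
    and m2: "(\<Sum>om'\<in>{x\<in>\<Omega>. g x = g om}. p om') = mass g om" for om
    by (simp_all add: mass_def)
  have "cond_ent f h \<le> ex (\<lambda>om. log 2 (1 / P (pick (h om)) (f om)))"
  proof (rule gibbs)
    fix om assume w: "om \<in> \<Omega>"
    show "P (pick (h om)) (f om) > 0"
      unfolding P_def pick[OF w] m1 m2 using mass_pos[OF w, of g] mass_pos[OF w, of "\<lambda>x. (g x, f x)"] by simp
    have "(\<Sum>v\<in>f ` {om'\<in>\<Omega>. h om' = h om}. P (pick (h om)) v) \<le> (\<Sum>v\<in>f ` {om'\<in>\<Omega>. g om' = g om}. P (g om) v)"
      unfolding pick[OF w]
    proof (rule sum_mono2)
      show "finite (f ` {om'\<in>\<Omega>. g om' = g om})" using fin by simp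
      show "f ` {om'\<in>\<Omega>. h om' = h om} \<subseteq> f ` {om'\<in>\<Omega>. g om' = g om}" using det w by blast
      show "P (g om) v \<ge> 0" for v unfolding P_def
        by (intro divide_nonneg_nonneg sum_nonneg) (auto dest: pos)
    qed
    also have "\<dots> = (\<Sum>v\<in>f ` {om'\<in>\<Omega>. g om' = g om}. (\<Sum>om'\<in>{x\<in>\<Omega>. g x = g om \<and> f x = v}. p om')) / mass g om"
      unfolding P_def m2 by (simp add: sum_divide_distrib)
    also have "(\<Sum>v\<in>f ` {om'\<in>\<Omega>. g om' = g om}. (\<Sum>om'\<in>{x\<in>\<Omega>. g x = g om \<and> f x = v}. p om')) = mass g om"
      unfolding mass_def
      by (subst sum.image_gen[where g=f]) (use fin in \<open>auto intro!: sum.cong\<close>)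
    finally show "(\<Sum>v\<in>f ` {om'\<in>\<Omega>. h om' = h om}. P (pick (h om)) v) \<le> 1"
      using mass_pos[OF w, of g] by simp
  qed
  also have "\<dots> = cond_ent f g"
    unfolding ex_def cond_ent_def
    by (rule sum.cong[OF refl]) (simp add: P_def pick m1 m2)
  finally show ?thesis .
qed

lemma cond_ent_det:
  assumes "\<And>om om'. om \<in> \<Omega> \<Longrightarrow> om' \<in> \<Omega> \<Longrightarrow> g om = g om' \<Longrightarrow> f om = f om'"
  shows "cond_ent f g = 0"
proof -
  have "cond_ent f g \<le> log 2 1"
  proof (rule cond_ent_card_const)
    fix om assume w: "om \<in> \<Omega>"
    have "f ` {om'\<in>\<Omega>. g om' = g om} \<subseteq> {f om}" using assms w by blast
    then have "card (f ` {om'\<in>\<Omega>. g om' = g om}) \<le> card {f om}" by (intro card_mono) auto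
    then show "real (card (f ` {om'\<in>\<Omega>. g om' = g om})) \<le> 1" by simp
  qed
  then show ?thesis using cond_ent_nonneg[of f g] by simp
qed

lemma cond_ent_swap: "cond_ent (\<lambda>x. (f x, h x)) g = cond_ent (\<lambda>x. (h x, f x)) g"
  by (rule cond_ent_cong) auto

lemma cond_ent_le_pair: "cond_ent f g \<le> cond_ent (\<lambda>x. (f x, h x)) g"
  unfolding cond_ent_chain using cond_ent_nonneg by simp

lemma cond_ent_fun_mono:
  assumes "\<And>om om'. om \<in> \<Omega> \<Longrightarrow> om' \<in> \<Omega> \<Longrightarrow> g om = g om' \<Longrightarrow> f2 om = f2 om' \<Longrightarrow> f om = f om'"
  shows "cond_ent f g \<le> cond_ent f2 g"
proof -
  have "cond_ent f g \<le> cond_ent (\<lambda>x. (f2 x, f x)) g" using cond_ent_le_pair cond_ent_swap by metis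
  also have "\<dots> = cond_ent f2 g + cond_ent f (\<lambda>x. (g x, f2 x))" by (rule cond_ent_chain)
  also have "cond_ent f (\<lambda>x. (g x, f2 x)) = 0" by (rule cond_ent_det) (use assms in blast)
  finally show ?thesis by simp
qed

end

section \<open>Runs, probed cells and locality\<close>

type_synonym prog = "dop \<Rightarrow> hist \<Rightarrow> action"

text \<open>A variant of \<open>exec\<close> that records the probed addresses, since the argument
  depends on which cells a run touches and not only on their number.\<close>

fun execp :: "nat \<Rightarrow> (hist \<Rightarrow> action) \<Rightarrow> mem \<Rightarrow> hist \<Rightarrow> (mem \<times> bool \<times> nat list) option" where
  "execp 0 A m h = None"
| "execp (Suc f) A m h = (case A h of
      Halt b \<Rightarrow> Some (m, b, [])
    | Read a \<Rightarrow> map_option (\<lambda>(m', b, ps). (m', b, a # ps)) (execp f A m (h @ [Some (m a)]))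
    | Write a v \<Rightarrow> map_option (\<lambda>(m', b, ps). (m', b, a # ps)) (execp f A (m(a := v)) (h @ [None])))"

lemma exec_execp: "exec f A m h = map_option (\<lambda>(m', b, ps). (m', b, length ps)) (execp f A m h)"
proof (induction f arbitrary: m h)
  case (Suc f)
  show ?case
    by (cases "A h") (simp_all add: Suc.IH option.map_comp comp_def case_prod_beta del: fun_upd_apply)
qed simp

lemma execp_Suc: "execp f A m h = Some r \<Longrightarrow> execp (Suc f) A m h = Some r"
proof (induction f arbitrary: m h r)
  case (Suc f)
  show ?case
  proof (cases "A h")
    case (Read x)
    then obtain r' where "execp f A m (h @ [Some (m x)]) = Some r'" "r = (\<lambda>(m', b, ps). (m', b, x # ps)) r'"
      using Suc.prems by auto
    with Suc.IH[OF this(1)] Read show ?thesis by (subst execp.simps) (simp del: execp.simps)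
  next
    case (Write x v)
    then obtain r' where "execp f A (m(x := v)) (h @ [None]) = Some r'" "r = (\<lambda>(m', b, ps). (m', b, x # ps)) r'"
      using Suc.prems by auto
    with Suc.IH[OF this(1)] Write show ?thesis by (subst execp.simps) (simp del: execp.simps fun_upd_apply)
  next
    case (Halt b)
    then show ?thesis using Suc.prems by simp
  qed
qed simp

lemma execp_mono: "f \<le> f' \<Longrightarrow> execp f A m h = Some r \<Longrightarrow> execp f' A m h = Some r"
  by (induction f' rule: dec_induct) (blast intro: execp_Suc)+

lemma execp_frame:
  "execp f A m h = Some (m', b, ps) \<Longrightarrow> a \<notin> set ps \<Longrightarrow> m' a = m a"
proof (induction f arbitrary: m h m' b ps)
  case (Suc f)
  show ?case
  proof (cases "A h")
    case (Read x)
    then obtain ps' where 1: "execp f A m (h @ [Some (m x)]) = Some (m', b, ps')" and ps: "ps = x # ps'"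
      using Suc.prems(1) by auto
    show ?thesis using Suc.IH[OF 1] Suc.prems(2) ps by simp
  next
    case (Write x v)
    then obtain ps' where 1: "execp f A (m(x := v)) (h @ [None]) = Some (m', b, ps')" and ps: "ps = x # ps'"
      using Suc.prems(1) by auto
    show ?thesis using Suc.IH[OF 1] Suc.prems(2) ps by simp
  next
    case (Halt c)
    then show ?thesis using Suc.prems by simp
  qed
qed simp

text \<open>Both runs see the same history, as a memory enters only through the cells that are
  probed. All other cells of \<open>m2\<close> survive, which is what permits a replay on a
  different memory.\<close>

lemma execp_local:
  "execp f A m h = Some (m', b, ps) \<Longrightarrow> (\<And>a. a \<in> set ps \<Longrightarrow> m2 a = m a) \<Longrightarrow>
   execp f A m2 h = Some (\<lambda>a. if a \<in> set ps then m' a else m2 a, b, ps)"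
proof (induction f arbitrary: m h m' b ps m2)
  case (Suc f)
  show ?case
  proof (cases "A h")
    case (Read x)
    then obtain ps' where 1: "execp f A m (h @ [Some (m x)]) = Some (m', b, ps')" and ps: "ps = x # ps'"
      using Suc.prems(1) by auto
    have x: "m2 x = m x" using Suc.prems(2) ps by auto
    have "execp f A m2 (h @ [Some (m x)]) = Some (\<lambda>a. if a \<in> set ps' then m' a else m2 a, b, ps')"
      using Suc.IH[OF 1] Suc.prems(2) ps by auto
    moreover have "(\<lambda>a. if a \<in> set ps' then m' a else m2 a) = (\<lambda>a. if a \<in> set ps then m' a else m2 a)"
      using execp_frame[OF 1] x ps by (auto intro!: ext)
    ultimately show ?thesis using Read x ps by simp
  next
    case (Write x v)
    then obtain ps' where 1: "execp f A (m(x := v)) (h @ [None]) = Some (m', b, ps')" and ps: "ps = x # ps'"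
      using Suc.prems(1) by auto
    have "execp f A (m2(x := v)) (h @ [None]) = Some (\<lambda>a. if a \<in> set ps' then m' a else (m2(x := v)) a, b, ps')"
      using Suc.IH[OF 1] Suc.prems(2) ps by auto
    moreover have "(\<lambda>a. if a \<in> set ps' then m' a else (m2(x := v)) a) = (\<lambda>a. if a \<in> set ps then m' a else m2 a)"
      using execp_frame[OF 1] ps by (auto intro!: ext)
    ultimately show ?thesis using Write ps by simp
  next
    case (Halt c)
    then show ?thesis using Suc.prems by auto
  qed
qed simp

definition runp :: "(hist \<Rightarrow> action) \<Rightarrow> mem \<Rightarrow> (mem \<times> bool \<times> nat list) option" where
  "runp A m = (if \<exists>f. execp f A m [] \<noteq> None
              then execp (LEAST f. execp f A m [] \<noteq> None) A m [] else None)"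

lemma run_runp: "run A m = map_option (\<lambda>(m', b, ps). (m', b, length ps)) (runp A m)"
  unfolding run_def runp_def by (simp add: exec_execp)

lemma runp_eq_Some: "runp A m = Some r \<longleftrightarrow> (\<exists>f. execp f A m [] = Some r)"
proof
  assume "runp A m = Some r"
  then show "\<exists>f. execp f A m [] = Some r" unfolding runp_def by (metis option.distinct(1))
next
  assume "\<exists>f. execp f A m [] = Some r"
  then obtain f where f: "execp f A m [] = Some r" by auto
  let ?l = "LEAST f. execp f A m [] \<noteq> None"
  have l: "execp ?l A m [] \<noteq> None" by (rule LeastI[of _ f]) (use f in auto)
  have "?l \<le> f" by (rule Least_le) (use f in auto)
  then have "execp ?l A m [] = Some r" using execp_mono l f by fastforce
  moreover have "\<exists>f. execp f A m [] \<noteq> None" using f by (intro exI[of _ f]) simp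
  ultimately show "runp A m = Some r" unfolding runp_def by (simp only: if_True)
qed

definition halts :: "prog \<Rightarrow> mem \<Rightarrow> dop \<Rightarrow> bool" where
  "halts A m q = (runp (A q) m \<noteq> None)"

text \<open>A diverging operation leaves the memory unchanged, the convention of
  \<open>exec_seq\<close>.\<close>

definition next_mem :: "prog \<Rightarrow> mem \<Rightarrow> dop \<Rightarrow> mem" where
  "next_mem A m q = (case runp (A q) m of None \<Rightarrow> m | Some (m', b, ps) \<Rightarrow> m')"

definition ans :: "prog \<Rightarrow> mem \<Rightarrow> dop \<Rightarrow> bool" where
  "ans A m q = (case runp (A q) m of None \<Rightarrow> False | Some (m', b, ps) \<Rightarrow> b)"

text \<open>As a set it counts repeated probes once, so its size bounds the cost from below.\<close>

definition cells :: "prog \<Rightarrow> mem \<Rightarrow> dop \<Rightarrow> nat set" where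
  "cells A m q = (case runp (A q) m of None \<Rightarrow> {} | Some (m', b, ps) \<Rightarrow> set ps)"

definition mem_after :: "prog \<Rightarrow> mem \<Rightarrow> dop list \<Rightarrow> mem" where
  "mem_after A m qs = foldl (next_mem A) m qs"

fun cells_seq :: "prog \<Rightarrow> mem \<Rightarrow> dop list \<Rightarrow> nat set" where
  "cells_seq A m [] = {}"
| "cells_seq A m (q # qs) = cells A m q \<union> cells_seq A (next_mem A m q) qs"

fun all_halt :: "prog \<Rightarrow> mem \<Rightarrow> dop list \<Rightarrow> bool" where
  "all_halt A m [] = True"
| "all_halt A m (q # qs) = (halts A m q \<and> all_halt A (next_mem A m q) qs)"

lemma mem_after_simps [simp]:
  "mem_after A m [] = m" "mem_after A m (q # qs) = mem_after A (next_mem A m q) qs"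
  "mem_after A m (qs @ rs) = mem_after A (mem_after A m qs) rs"
  by (simp_all add: mem_after_def)

lemma cells_seq_append [simp]:
  "cells_seq A m (qs @ rs) = cells_seq A m qs \<union> cells_seq A (mem_after A m qs) rs"
  by (induction qs arbitrary: m) auto

lemma all_halt_append [simp]:
  "all_halt A m (qs @ rs) \<longleftrightarrow> all_halt A m qs \<and> all_halt A (mem_after A m qs) rs"
  by (induction qs arbitrary: m) auto

lemma next_mem_frame: "a \<notin> cells A m q \<Longrightarrow> next_mem A m q a = m a"
proof (cases "runp (A q) m")
  case (Some r)
  obtain m' b ps where r: "r = (m', b, ps)" by (cases r)
  assume "a \<notin> cells A m q"
  then have a: "a \<notin> set ps" using Some r by (simp add: cells_def)
  obtain f where "execp f (A q) m [] = Some (m', b, ps)" using Some r runp_eq_Some by auto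
  from execp_frame[OF this a] show ?thesis using Some r by (simp add: next_mem_def)
qed (simp add: next_mem_def)

lemma op_local:
  assumes "halts A m q" and "\<And>a. a \<in> cells A m q \<Longrightarrow> m2 a = m a"
  shows "halts A m2 q" and "ans A m2 q = ans A m q" and "cells A m2 q = cells A m q"
    and "next_mem A m2 q = (\<lambda>a. if a \<in> cells A m q then next_mem A m q a else m2 a)"
proof -
  obtain m' b ps where r: "runp (A q) m = Some (m', b, ps)" using assms(1) unfolding halts_def by auto
  then obtain f where "execp f (A q) m [] = Some (m', b, ps)" unfolding runp_eq_Some by auto
  moreover have "m2 a = m a" if "a \<in> set ps" for a using assms(2) r that by (auto simp: cells_def)
  ultimately have "execp f (A q) m2 [] = Some (\<lambda>a. if a \<in> set ps then m' a else m2 a, b, ps)"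
    by (rule execp_local)
  then have r2: "runp (A q) m2 = Some (\<lambda>a. if a \<in> set ps then m' a else m2 a, b, ps)"
    unfolding runp_eq_Some by auto
  show "halts A m2 q" and "ans A m2 q = ans A m q" and "cells A m2 q = cells A m q"
    and "next_mem A m2 q = (\<lambda>a. if a \<in> cells A m q then next_mem A m q a else m2 a)"
    using r r2 by (auto simp add: halts_def ans_def cells_def next_mem_def intro!: ext)
qed

lemma seq_frame: "a \<notin> cells_seq A m qs \<Longrightarrow> mem_after A m qs a = m a"
  by (induction qs arbitrary: m) (auto simp: next_mem_frame)

text \<open>The replay principle for sequences. After each operation the two memories agree on the
  cells it probed by \<open>op_local\<close>, and all other cells keep their contents, so agreement
  on the cells still to be probed persists.\<close>

lemma seq_local:
  assumes "all_halt A m qs" and "\<And>a. a \<in> cells_seq A m qs \<Longrightarrow> m2 a = m a"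
  shows "all_halt A m2 qs \<and> cells_seq A m2 qs = cells_seq A m qs \<and>
    mem_after A m2 qs = (\<lambda>a. if a \<in> cells_seq A m qs then mem_after A m qs a else m2 a)"
  using assms
proof (induction qs arbitrary: m m2)
  case (Cons q qs)
  note l = op_local[of A m q m2]
  have h: "halts A m q" and al: "all_halt A (next_mem A m q) qs" using Cons.prems(1) by auto
  have ag: "a \<in> cells A m q \<Longrightarrow> m2 a = m a" for a using Cons.prems(2) by auto
  have ag2: "next_mem A m2 q a = next_mem A m q a" if "a \<in> cells_seq A (next_mem A m q) qs" for a
    using that Cons.prems(2)[of a] next_mem_frame[of a A m q] fun_cong[OF l(4)[OF h ag], of a] by auto
  note IH = Cons.IH[OF al ag2]
  have "mem_after A m2 (q # qs) = (\<lambda>a. if a \<in> cells_seq A m (q # qs) then mem_after A m (q # qs) a else m2 a)"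
  proof
    fix a
    have "mem_after A m2 (q # qs) a = (if a \<in> cells_seq A (next_mem A m q) qs then mem_after A m (q # qs) a else next_mem A m2 q a)"
      using IH by simp
    also have "\<dots> = (if a \<in> cells_seq A m (q # qs) then mem_after A m (q # qs) a else m2 a)"
      using fun_cong[OF l(4)[OF h ag], of a] seq_frame[of a A "next_mem A m q" qs] by auto
    finally show "mem_after A m2 (q # qs) a = (if a \<in> cells_seq A m (q # qs) then mem_after A m (q # qs) a else m2 a)" .
  qed
  then show ?case using IH l[OF h ag] by simp
qed simp

lemma exec_seq_nth:
  "i < length qs \<Longrightarrow> exec_seq A m qs ! i =
    (case runp (A (qs ! i)) (mem_after A m (take i qs)) of
       None \<Rightarrow> (\<infinity>, None) | Some (m', b, ps) \<Rightarrow> (of_nat (length ps), Some b))"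
proof (induction qs arbitrary: m i)
  case (Cons q qs)
  show ?case
  proof (cases i)
    case 0
    then show ?thesis by (auto simp: run_runp split: option.splits)
  next
    case (Suc j)
    have "exec_seq A m (q # qs) ! i = exec_seq A (next_mem A m q) qs ! j"
      by (auto simp: Suc run_runp next_mem_def split: option.splits)
    then show ?thesis using Cons Suc by simp
  qed
qed simp

lemma length_exec_seq [simp]: "length (exec_seq A m qs) = length qs"
  by (induction A m qs rule: exec_seq.induct) (auto split: option.splits)

lemma halts_of_cost:
  assumes "i < length qs" and "fst (exec_seq A m qs ! i) \<noteq> \<infinity>"
  shows "halts A (mem_after A m (take i qs)) (qs ! i)"
  using assms by (auto simp: exec_seq_nth halts_def split: option.splits)

lemma card_cells_le_cost:
  assumes "i < length qs"
  shows "of_nat (card (cells A (mem_after A m (take i qs)) (qs ! i))) \<le> fst (exec_seq A m qs ! i)"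
  using assms by (auto simp: exec_seq_nth cells_def card_length split: option.splits)

lemma all_halt_iff: "all_halt A m qs \<longleftrightarrow> (\<forall>i<length qs. halts A (mem_after A m (take i qs)) (qs ! i))"
  by (induction qs arbitrary: m) (auto simp: less_Suc_eq_0_disj)

section \<open>Valid sequences and the first-in first-out workload\<close>

lemma set_after_snoc [simp]: "set_after (qs @ [q]) = apply_op (set_after qs) q"
  by (simp add: set_after_def)

lemma set_after_Nil [simp]: "set_after [] = {}"
  by (simp add: set_after_def)

lemma valid_seq_Nil [simp]: "valid_seq n U []"
  by (simp add: valid_seq_def)

lemma valid_seq_snoc: "valid_seq n U (qs @ [q]) \<longleftrightarrow> valid_seq n U qs \<and> valid_op n U (set_after qs) q"
  by (auto simp: valid_seq_def nth_append less_Suc_eq)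

text \<open>The query before the deletion makes the cells probed by an update suffice to confirm its
  deleted key; this lets a replay recognize that key.\<close>

definition update_ops :: "nat list \<Rightarrow> nat list \<Rightarrow> dop list" where
  "update_ops D X = concat (map2 (\<lambda>y x. [Qry y, Del y, Ins x]) D X)"

lemma update_ops_append: "length D = length X \<Longrightarrow> update_ops (D @ D') (X @ X') = update_ops D X @ update_ops D' X'"
  by (simp add: update_ops_def)

lemma update_ops_single: "update_ops [y] [x] = [Qry y, Del y, Ins x]"
  by (simp add: update_ops_def)

lemma update_ops_Nil [simp]: "update_ops [] [] = []"
  by (simp add: update_ops_def)

definition workload :: "nat \<Rightarrow> nat list \<Rightarrow> nat \<Rightarrow> dop list" where
  "workload n ks t = map Ins (take n ks) @ update_ops (take t ks) (take t (drop n ks))"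

lemma set_after_Ins: "set_after (map Ins ks) = set ks"
  by (induction ks rule: rev_induct) auto

lemma workload_Suc:
  assumes "n + t < length ks"
  shows "workload n ks (Suc t) = workload n ks t @ [Qry (ks ! t), Del (ks ! t), Ins (ks ! (n + t))]"
proof -
  have "take (Suc t) ks = take t ks @ [ks ! t]" "take (Suc t) (drop n ks) = take t (drop n ks) @ [ks ! (n + t)]"
    using assms by (auto simp: take_Suc_conv_app_nth)
  then show ?thesis using assms by (simp add: workload_def update_ops_append update_ops_single)
qed

text \<open>A key list is in order of insertion and, since deletions are first-in first-out, of deletion; so the
  keys present after \<open>t\<close> updates are those at positions \<open>t..<n + t\<close>.\<close>

definition current :: "nat \<Rightarrow> nat list \<Rightarrow> nat \<Rightarrow> nat list" where
  "current n ks t = drop t (take (n + t) ks)"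

lemma current_Suc:
  assumes "n + t < length ks" "n > 0"
  shows "current n ks t = ks ! t # tl (current n ks t)" "current n ks (Suc t) = tl (current n ks t) @ [ks ! (n + t)]"
proof -
  have t: "take (n + Suc t) ks = take (n + t) ks @ [ks ! (n + t)]" using assms by (simp add: take_Suc_conv_app_nth)
  have "drop t (take (n + t) ks) = take (n + t) ks ! t # drop (Suc t) (take (n + t) ks)"
    using assms by (subst Cons_nth_drop_Suc) auto
  then show 1: "current n ks t = ks ! t # tl (current n ks t)" using assms unfolding current_def by simp
  show "current n ks (Suc t) = tl (current n ks t) @ [ks ! (n + t)]"
    unfolding current_def t using assms by (simp add: drop_Suc tl_drop)
qed

lemma length_cur: "n + t \<le> length ks \<Longrightarrow> length (current n ks t) = n"
  by (simp add: current_def)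

lemma distinct_cur: "distinct ks \<Longrightarrow> distinct (current n ks t)"
  by (simp add: current_def)

lemma set_after_wops:
  assumes "distinct ks" "n + t \<le> length ks" "n > 0"
  shows "set_after (workload n ks t) = set (current n ks t)"
  using assms(2)
proof (induction t)
  case 0
  then show ?case by (simp add: workload_def current_def set_after_Ins)
next
  case (Suc t)
  then have lt: "n + t < length ks" by simp
  have IH: "set_after (workload n ks t) = set (current n ks t)" using Suc by simp
  note c = current_Suc[OF lt assms(3)]
  have "set_after (workload n ks (Suc t)) = insert (ks ! (n + t)) (set (current n ks t) - {ks ! t})"
    using workload_Suc[OF lt] set_after_snoc IH by (simp add: set_after_def)
  moreover have "distinct (ks ! t # tl (current n ks t))" using c(1) distinct_cur[OF assms(1)] by metis
  moreover have "set (current n ks t) = insert (ks ! t) (set (tl (current n ks t)))" using c(1) by (metis list.simps(15))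
  ultimately show ?case unfolding c(2) by auto
qed

lemma valid_Ins_map:
  assumes "distinct ks" "length ks \<le> n" "set ks \<subseteq> {1..U}"
  shows "valid_seq n U (map Ins ks)"
  using assms
proof (induction ks rule: rev_induct)
  case (snoc x xs)
  then show ?case by (auto simp: valid_seq_snoc set_after_Ins distinct_card)
qed simp

lemma workload_prefix_valid:
  assumes ks: "distinct ks" "set ks \<subseteq> {1..U}" "n + t \<le> length ks" "n > 0"
  shows "valid_seq n U (workload n ks t)"
  using ks(3)
proof (induction t)
  case 0
  then show ?case using ks by (auto simp: workload_def intro!: valid_Ins_map dest: in_set_takeD)
next
  case (Suc t)
  then have lt: "n + t < length ks" by simp
  have V: "valid_seq n U (workload n ks t)" using Suc by simp
  have SA: "set_after (workload n ks t) = set (current n ks t)" using set_after_wops[OF ks(1) _ ks(4)] lt by simp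
  note c = current_Suc[OF lt ks(4)]
  have mem: "ks ! t \<in> set (current n ks t)" by (metis c(1) list.set_intros(1))
  have d: "distinct (current n ks t)" "length (current n ks t) = n" using ks(1) lt by (auto intro: distinct_cur length_cur)
  have "ks ! (n + t) \<notin> set (current n ks t)"
    unfolding current_def using ks(1) lt by (auto simp: in_set_conv_nth nth_eq_iff_index_eq dest!: in_set_dropD)
  moreover have "ks ! (n + t) \<in> {1..U}" "ks ! t \<in> {1..U}" using ks(2) lt by (auto simp: subset_iff)
  moreover have "card (set (current n ks t) - {ks ! t}) < n"
    using mem d ks(4) by (simp add: distinct_card)
  moreover have e: "workload n ks (Suc t) = ((workload n ks t @ [Qry (ks ! t)]) @ [Del (ks ! t)]) @ [Ins (ks ! (n + t))]"
    using workload_Suc[OF lt] by simp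
  ultimately show ?case
    unfolding e valid_seq_snoc set_after_snoc using V SA mem by auto
qed

section \<open>A deterministic dictionary and its memory along the workload\<close>

locale det_dict =
  fixes n U S w :: nat and A :: prog and m0 :: mem
  assumes n0: "n > 0"
    and init_lt: "\<And>a. a < S \<Longrightarrow> m0 a < 2 ^ w"
    and read_lt: "\<And>q h a. A q h = Read a \<Longrightarrow> a < S"
    and write_lt: "\<And>q h a v. A q h = Write a v \<Longrightarrow> a < S \<and> v < 2 ^ w"
    and halting: "\<And>qs. valid_seq n U qs \<Longrightarrow> all_halt A m0 qs"
    and correct: "\<And>qs x. valid_seq n U (qs @ [Qry x]) \<Longrightarrow> ans A (mem_after A m0 qs) (Qry x) = (x \<in> set_after qs)"
begin

lemma execp_bounds:
  "execp f (A q) m h = Some (m', b, ps) \<Longrightarrow> set ps \<subseteq> {..<S} \<and>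
    ((\<forall>a<S. m a < 2 ^ w) \<longrightarrow> (\<forall>a<S. m' a < 2 ^ w))"
proof (induction f arbitrary: m h m' b ps)
  case (Suc f)
  show ?case
  proof (cases "A q h")
    case (Read x)
    then obtain ps' where "execp f (A q) m (h @ [Some (m x)]) = Some (m', b, ps')" and ps: "ps = x # ps'"
      using Suc.prems(1) by auto
    from Suc.IH[OF this(1)] show ?thesis using ps read_lt[OF Read] by auto
  next
    case (Write x v)
    then obtain ps' where "execp f (A q) (m(x := v)) (h @ [None]) = Some (m', b, ps')" and ps: "ps = x # ps'"
      using Suc.prems(1) by auto
    from Suc.IH[OF this(1)] show ?thesis using ps write_lt[OF Write] by auto
  next
    case (Halt c)
    then show ?thesis using Suc.prems by auto
  qed
qed simp

lemma cells_bound: "cells A m q \<subseteq> {..<S}"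
proof (cases "runp (A q) m")
  case (Some r)
  obtain m' b ps where r: "r = (m', b, ps)" by (cases r)
  obtain f where "execp f (A q) m [] = Some (m', b, ps)" using Some r runp_eq_Some by auto
  from execp_bounds[OF this] show ?thesis using Some r by (simp add: cells_def)
qed (simp add: cells_def)

lemma cells_seq_bound: "cells_seq A m qs \<subseteq> {..<S}"
  using cells_bound by (induction qs arbitrary: m) auto

lemma finite_cells_seq [simp]: "finite (cells_seq A m qs)"
  using cells_seq_bound finite_subset by blast

lemma next_mem_lt: "(\<And>a. a < S \<Longrightarrow> m a < 2 ^ w) \<Longrightarrow> a < S \<Longrightarrow> next_mem A m q a < 2 ^ w"
proof (cases "runp (A q) m")
  case (Some r)
  assume *: "\<And>a. a < S \<Longrightarrow> m a < 2 ^ w" "a < S"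
  obtain m' b ps where r: "r = (m', b, ps)" by (cases r)
  obtain f where "execp f (A q) m [] = Some (m', b, ps)" using Some r runp_eq_Some by auto
  from execp_bounds[OF this] * show ?thesis using Some r by (simp add: next_mem_def)
qed (simp add: next_mem_def)

lemma mem_after_lt: "(\<And>a. a < S \<Longrightarrow> m a < 2 ^ w) \<Longrightarrow> a < S \<Longrightarrow> mem_after A m qs a < 2 ^ w"
proof (induction qs arbitrary: m)
  case (Cons q qs)
  show ?case using Cons.IH[of "next_mem A m q"] Cons.prems next_mem_lt by simp
qed simp

lemma mem_after_ge: "a \<ge> S \<Longrightarrow> mem_after A m qs a = m a"
  using seq_frame[of a A m qs] cells_seq_bound[of m qs] by force

lemma set_after_subset: "valid_seq n U qs \<Longrightarrow> set_after qs \<subseteq> {1..U}"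
proof (induction qs rule: rev_induct)
  case (snoc q qs)
  then show ?case by (cases q) (auto simp: valid_seq_snoc)
qed simp

text \<open>Querying the whole universe reads the key set off the memory. Correctness is assumed for
  all valid sequences, so these queries need not occur in the workload.\<close>

lemma same_mem_same_set:
  assumes "valid_seq n U qs" "valid_seq n U rs" "mem_after A m0 qs = mem_after A m0 rs"
  shows "set_after qs = set_after rs"
proof -
  have "x \<in> set_after qs \<longleftrightarrow> x \<in> set_after rs" if "x \<in> {1..U}" for x
    using correct[of qs x] correct[of rs x] assms that by (simp add: valid_seq_snoc)
  then show ?thesis using set_after_subset assms by blast
qed

definition mem_at :: "nat list \<Rightarrow> nat \<Rightarrow> mem" where
  "mem_at ks t = mem_after A m0 (workload n ks t)"

text \<open>The slice of positions \<open>a..<b\<close>. With offset \<open>n\<close> it gives the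
  keys inserted by the updates \<open>a..<b\<close>, without offset the keys deleted by
  them.\<close>

definition Dk :: "nat list \<Rightarrow> nat \<Rightarrow> nat \<Rightarrow> nat list" where
  "Dk ks a b = take (b - a) (drop a ks)"

definition probed :: "nat list \<Rightarrow> nat \<Rightarrow> nat \<Rightarrow> nat set" where
  "probed ks a b = cells_seq A (mem_at ks a) (update_ops (Dk ks a b) (Dk ks (n + a) (n + b)))"

lemma Dk_append: "a \<le> b \<Longrightarrow> b \<le> c \<Longrightarrow> Dk ks a c = Dk ks a b @ Dk ks b c"
  unfolding Dk_def using take_add[of "b - a" "c - b" "drop a ks"] by simp

lemma length_Dk: "b \<le> length ks \<Longrightarrow> length (Dk ks a b) = b - a"
  by (simp add: Dk_def)

lemma workload_split:
  assumes "a \<le> b" "n + b \<le> length ks"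
  shows "workload n ks b = workload n ks a @ update_ops (Dk ks a b) (Dk ks (n + a) (n + b))"
proof -
  have "take b ks = take a ks @ Dk ks a b" using Dk_append[of 0 a b ks] assms(1) by (simp add: Dk_def)
  moreover have "take b (drop n ks) = take a (drop n ks) @ Dk ks (n + a) (n + b)"
    using Dk_append[of n "n + a" "n + b" ks] assms(1) by (simp add: Dk_def)
  ultimately show ?thesis using assms by (simp add: workload_def update_ops_append)
qed

lemma mem_at_split: "a \<le> b \<Longrightarrow> n + b \<le> length ks \<Longrightarrow>
   mem_at ks b = mem_after A (mem_at ks a) (update_ops (Dk ks a b) (Dk ks (n + a) (n + b)))"
  unfolding mem_at_def by (subst workload_split[of a b]) auto

lemma probed_split: "a \<le> b \<Longrightarrow> b \<le> c \<Longrightarrow> n + c \<le> length ks \<Longrightarrow> probed ks a c = probed ks a b \<union> probed ks b c"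
  unfolding probed_def using Dk_append[of a b c] Dk_append[of "n + a" "n + b" "n + c"] mem_at_split[of a b ks]
  by (simp add: update_ops_append length_Dk)

lemma probed_bound: "probed ks a b \<subseteq> {..<S}"
  unfolding probed_def by (rule cells_seq_bound)

lemma probed_finite [simp]: "finite (probed ks a b)"
  unfolding probed_def by simp

lemma probed_frame: "a \<le> b \<Longrightarrow> n + b \<le> length ks \<Longrightarrow> c \<notin> probed ks a b \<Longrightarrow> mem_at ks b c = mem_at ks a c"
  using mem_at_split seq_frame unfolding probed_def by metis

lemma workload_take: "t \<le> t' \<Longrightarrow> workload n (take (n + t') ks) t = workload n ks t"
  by (simp add: workload_def take_drop min_def)

text \<open>Causality: future keys do not influence the memory. Hence runs with a common past share
  their memory, and blocks ending at different times can use one key list.\<close>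

lemma mem_at_take: "t \<le> t' \<Longrightarrow> mem_at (take (n + t') ks) t = mem_at ks t"
  by (simp add: mem_at_def workload_take)

lemma Dk_take: "b \<le> c \<Longrightarrow> Dk (take c ks) a b = Dk ks a b"
  by (simp add: Dk_def drop_take min_absorb1)

lemma probed_take: "a \<le> b \<Longrightarrow> b \<le> t' \<Longrightarrow> probed (take (n + t') ks) a b = probed ks a b"
  by (simp add: probed_def mem_at_take Dk_take)

lemma mem_at_lt: "a < S \<Longrightarrow> mem_at ks t a < 2 ^ w"
  unfolding mem_at_def by (rule mem_after_lt) (auto intro: init_lt)

lemma mem_at_ge: "a \<ge> S \<Longrightarrow> mem_at ks t a = m0 a"
  unfolding mem_at_def by (rule mem_after_ge)

end

section \<open>Resampling and counting\<close>

locale coupling =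
  fixes \<Omega> :: "'k set" and g :: "'k \<Rightarrow> 'c"
  assumes fin: "finite \<Omega>" and ne: "\<Omega> \<noteq> {}"
begin

definition fib :: "'k \<Rightarrow> 'k set" where "fib k = {k'\<in>\<Omega>. g k' = g k}"
definition pairs :: "('k \<times> 'k) set" where "pairs = Sigma \<Omega> fib"
text \<open>The law of a uniform first component followed by a uniform element of its fibre, that
  is, of resampling \<open>k\<close> given the value of \<open>g\<close>.\<close>

definition pw :: "'k \<times> 'k \<Rightarrow> real" where "pw om = 1 / (real (card \<Omega>) * real (card (fib (fst om))))"

lemma fib_fin: "finite (fib k)" using fin by (simp add: fib_def)

lemma fib_self: "k \<in> \<Omega> \<Longrightarrow> k \<in> fib k" by (simp add: fib_def)

lemma fib_pos: "k \<in> \<Omega> \<Longrightarrow> card (fib k) > 0"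
  using fib_fin fib_self card_gt_0_iff by blast

lemma card_pos: "card \<Omega> > 0" using fin ne by (simp add: card_gt_0_iff)

lemma in_pairs: "(k, k') \<in> pairs \<longleftrightarrow> k \<in> \<Omega> \<and> k' \<in> \<Omega> \<and> g k' = g k"
  by (auto simp: pairs_def fib_def)

lemma fin_pairs: "finite pairs" unfolding pairs_def using fin fib_fin by auto

lemma sum_pairs: "(\<Sum>om\<in>pairs. pw om * h om) = (\<Sum>k\<in>\<Omega>. (1 / card \<Omega>) * ((\<Sum>k'\<in>fib k. h (k, k')) / card (fib k)))"
proof -
  have "(\<Sum>om\<in>pairs. pw om * h om) = (\<Sum>k\<in>\<Omega>. \<Sum>k'\<in>fib k. pw (k, k') * h (k, k'))"
    unfolding pairs_def using fin fib_fin by (subst sum.Sigma) (auto simp: case_prod_beta)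
  also have "\<dots> = (\<Sum>k\<in>\<Omega>. (1 / card \<Omega>) * ((\<Sum>k'\<in>fib k. h (k, k')) / card (fib k)))"
    by (intro sum.cong refl) (simp add: pw_def sum_divide_distrib sum_distrib_left)
  finally show ?thesis .
qed

sublocale u: fin_prob \<Omega> "\<lambda>_. 1 / real (card \<Omega>)"
  using fin ne card_pos by unfold_locales auto

lemma sum_pairs_fst: "(\<Sum>om\<in>pairs. pw om * h (fst om)) = (\<Sum>k\<in>\<Omega>. (1 / card \<Omega>) * h k)"
  unfolding sum_pairs using fib_pos by (intro sum.cong refl) auto

text \<open>The weight is symmetric, as both components lie in one fibre; so the resampled component
  is uniform too.\<close>

lemma sum_pairs_snd: "(\<Sum>om\<in>pairs. pw om * h (snd om)) = (\<Sum>k\<in>\<Omega>. (1 / card \<Omega>) * h k)"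
proof -
  have "(\<Sum>om\<in>pairs. pw om * h (snd om)) = (\<Sum>om\<in>pairs. pw om * h (fst om))"
  proof (rule sum.reindex_bij_witness[of _ prod.swap prod.swap])
    fix om assume "om \<in> pairs"
    then obtain k k' where o: "om = (k, k')" "k \<in> \<Omega>" "k' \<in> \<Omega>" "g k' = g k"
      by (cases om) (auto simp: in_pairs)
    then show "prod.swap om \<in> pairs" by (simp add: in_pairs)
    have "fib k = fib k'" using o by (auto simp: fib_def)
    then show "pw (prod.swap om) * h (fst (prod.swap om)) = pw om * h (snd om)" using o by (simp add: pw_def)
  qed (auto simp: in_pairs)
  then show ?thesis using sum_pairs_fst by simp
qed

sublocale c: fin_prob pairs pw
proof
  show "finite pairs" by (rule fin_pairs)
  show "pw om > 0" if "om \<in> pairs" for om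
    using that fib_pos card_pos by (cases om) (auto simp: pw_def in_pairs)
  show "sum pw pairs = 1" using sum_pairs_fst[of "\<lambda>_. 1"] card_pos by simp
qed

lemma ex_fst: "c.ex (\<lambda>om. h (fst om)) = u.ex h"
  unfolding c.ex_def u.ex_def by (rule sum_pairs_fst)

lemma ex_snd: "c.ex (\<lambda>om. h (snd om)) = u.ex h"
  unfolding c.ex_def u.ex_def by (rule sum_pairs_snd)

lemma mass_fst:
  assumes "om \<in> pairs"
  shows "c.mass (\<lambda>om. f (fst om)) om = u.mass f (fst om)"
proof -
  have "c.mass (\<lambda>om. f (fst om)) om = (\<Sum>om'\<in>pairs. pw om' * of_bool (f (fst om') = f (fst om)))"
    unfolding c.mass_def using fin_pairs by (intro sum.mono_neutral_cong_left) auto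
  also have "\<dots> = (\<Sum>k\<in>\<Omega>. (1 / card \<Omega>) * of_bool (f k = f (fst om)))"
    by (rule sum_pairs_fst)
  also have "\<dots> = u.mass f (fst om)"
    unfolding u.mass_def using fin by (intro sum.mono_neutral_cong_right) auto
  finally show ?thesis .
qed

lemma cond_ent_fst: "c.cond_ent (\<lambda>om. f (fst om)) (\<lambda>om. h (fst om)) = u.cond_ent f h"
proof -
  have "c.cond_ent (\<lambda>om. f (fst om)) (\<lambda>om. h (fst om))
      = (\<Sum>om\<in>pairs. pw om * log 2 (u.mass h (fst om) / u.mass (\<lambda>x. (h x, f x)) (fst om)))"
    unfolding c.cond_ent_def
    by (intro sum.cong refl) (simp add: mass_fst[where f=h] mass_fst[where f="\<lambda>x. (h x, f x)"])
  also have "\<dots> = u.cond_ent f h" unfolding u.cond_ent_def by (rule sum_pairs_fst)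
  finally show ?thesis .
qed

lemma u_mass: "u.mass f k = real (card {k'\<in>\<Omega>. f k' = f k}) / card \<Omega>"
  by (simp add: u.mass_def)

text \<open>Given the first component, the second one is a fresh sample from its fibre of \<open>g\<close>.\<close>

lemma cond_ent_snd: "c.cond_ent (\<lambda>om. x (snd om)) fst = u.cond_ent x g"
proof -
  have "c.cond_ent (\<lambda>om. x (snd om)) fst = (\<Sum>om\<in>pairs. pw om *
      log 2 (u.mass g (snd om) / u.mass (\<lambda>k. (g k, x k)) (snd om)))"
    unfolding c.cond_ent_def
  proof (intro sum.cong refl)
    fix om assume w: "om \<in> pairs"
    then obtain k k' where o: "om = (k, k')" "k \<in> \<Omega>" "k' \<in> \<Omega>" "g k' = g k"
      by (cases om) (auto simp: in_pairs)
    have 1: "c.mass fst om = 1 / card \<Omega>"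
    proof -
      have "c.mass fst om = u.mass (\<lambda>x. x) k" using mass_fst[OF w, of "\<lambda>x. x"] o by simp
      moreover have "{k'\<in>\<Omega>. k' = k} = {k}" using o by auto
      ultimately show ?thesis by (simp add: u_mass)
    qed
    let ?B = "{k''\<in>fib k. x k'' = x k'}"
    have "{om'\<in>pairs. (fst om', x (snd om')) = (fst om, x (snd om))} = Pair k ` ?B"
      using o by (auto simp: in_pairs fib_def)
    then have "c.mass (\<lambda>om. (fst om, x (snd om))) om = (\<Sum>om'\<in>Pair k ` ?B. pw om')"
      unfolding c.mass_def by simp
    also have "\<dots> = real (card ?B) / (real (card \<Omega>) * card (fib k))"
      by (subst sum.reindex) (auto simp: inj_on_def pw_def)
    finally have 2: "c.mass (\<lambda>om. (fst om, x (snd om))) om = real (card ?B) / (real (card \<Omega>) * card (fib k))" .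
    have 3: "u.mass g k' = card (fib k) / card \<Omega>" using o by (simp add: u_mass fib_def)
    have B: "{k''\<in>\<Omega>. (g k'', x k'') = (g k', x k')} = ?B" using o by (auto simp: fib_def)
    have 4: "u.mass (\<lambda>k. (g k, x k)) k' = card ?B / card \<Omega>" unfolding u_mass B ..
    show "pw om * log 2 (c.mass fst om / c.mass (\<lambda>om. (fst om, x (snd om))) om)
       = pw om * log 2 (u.mass g (snd om) / u.mass (\<lambda>k. (g k, x k)) (snd om))"
      unfolding 1 2 using 3 4 o card_pos by simp
  qed
  also have "\<dots> = u.cond_ent x g" unfolding u.cond_ent_def by (rule sum_pairs_snd)
  finally show ?thesis .
qed

end

section \<open>Falling factorials and lists of distinct keys\<close>

definition ffact :: "nat \<Rightarrow> nat \<Rightarrow> nat" where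
  "ffact a k = (\<Prod>i<k. a - i)"

definition dlists :: "'a set \<Rightarrow> nat \<Rightarrow> 'a list set" where
  "dlists B k = {xs. length xs = k \<and> distinct xs \<and> set xs \<subseteq> B}"

lemma ffact_0 [simp]: "ffact a 0 = 1" by (simp add: ffact_def)

lemma ffact_Suc: "ffact a (Suc k) = ffact a k * (a - k)" by (simp add: ffact_def)

lemma ffact_add: "ffact a (j + k) = ffact a j * ffact (a - j) k"
  by (induction k) (simp_all add: ffact_Suc)

lemma ffact_pos: "k \<le> a \<Longrightarrow> ffact a k > 0"
  unfolding ffact_def by (intro prod_pos) auto

lemma finite_dlists: "finite B \<Longrightarrow> finite (dlists B k)"
  unfolding dlists_def by (rule finite_subset[OF _ finite_lists_length_eq[of B k]]) auto

lemma dlists_Suc: "dlists B (Suc k) = (\<lambda>(xs, x). xs @ [x]) ` (Sigma (dlists B k) (\<lambda>xs. B - set xs))"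
proof (intro equalityI subsetI)
  fix ys assume "ys \<in> dlists B (Suc k)"
  moreover then obtain xs x where "ys = xs @ [x]" unfolding dlists_def
    by (metis (mono_tags, lifting) length_Suc_conv_rev mem_Collect_eq)
  ultimately show "ys \<in> (\<lambda>(xs, x). xs @ [x]) ` (Sigma (dlists B k) (\<lambda>xs. B - set xs))"
    by (force simp: dlists_def)
qed (auto simp: dlists_def)

lemma sum_dlists_Suc:
  assumes "finite B"
  shows "(\<Sum>ys\<in>dlists B (Suc k). f (take k ys)) = real (card B - k) * (\<Sum>xs\<in>dlists B k. f xs :: real)"
proof -
  have inj: "inj_on (\<lambda>(xs, x). xs @ [x]) (Sigma (dlists B k) (\<lambda>xs. B - set xs))" by (auto simp: inj_on_def)
  have "(\<Sum>ys\<in>dlists B (Suc k). f (take k ys))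
      = (\<Sum>(xs, x)\<in>Sigma (dlists B k) (\<lambda>xs. B - set xs). f xs)"
    unfolding dlists_Suc sum.reindex[OF inj] by (rule sum.cong) (auto simp: dlists_def)
  also have "\<dots> = (\<Sum>xs\<in>dlists B k. \<Sum>x\<in>B - set xs. f xs)"
    using assms by (subst sum.Sigma) (auto simp: finite_dlists)
  also have "\<dots> = (\<Sum>xs\<in>dlists B k. real (card B - k) * f xs)"
  proof (rule sum.cong[OF refl])
    fix xs assume "xs \<in> dlists B k"
    then have "card (B - set xs) = card B - k"
      by (subst card_Diff_subset) (auto simp: dlists_def distinct_card)
    then show "(\<Sum>x\<in>B - set xs. f xs) = real (card B - k) * f xs" by simp
  qed
  finally show ?thesis by (simp add: sum_distrib_left)
qed

lemma card_dlists: "finite B \<Longrightarrow> card (dlists B k) = ffact (card B) k"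
proof (induction k)
  case 0
  have "dlists B 0 = {[]}" by (auto simp: dlists_def)
  then show ?case by simp
next
  case (Suc k)
  have "real (card (dlists B (Suc k))) = real (card B - k) * real (card (dlists B k))"
    using sum_dlists_Suc[OF Suc.prems, of "\<lambda>_. 1" k] by simp
  then have "card (dlists B (Suc k)) = (card B - k) * card (dlists B k)"
    by (metis of_nat_eq_iff of_nat_mult)
  then show ?case using Suc by (simp add: ffact_Suc mult.commute)
qed

text \<open>All lists of length \<open>j\<close> have the same number \<open>card B - j\<close> of
  one-step extensions, so a prefix of a uniform list is uniform. This transfers averages from the
  key list of a block to a longer common one.\<close>

lemma avg_dlists_take:
  assumes B: "finite B" "l' \<le> card B" and "l \<le> l'"
  shows "(\<Sum>ys\<in>dlists B l'. f (take l ys)) / card (dlists B l') = (\<Sum>xs\<in>dlists B l. f xs :: real) / card (dlists B l)"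
  using assms(3,2)
proof (induction l' rule: dec_induct)
  case base
  then show ?case by (intro arg_cong2[where f="(/)"] sum.cong) (auto simp: dlists_def)
next
  case (step j)
  have "(\<Sum>ys\<in>dlists B (Suc j). f (take l ys)) = (\<Sum>ys\<in>dlists B (Suc j). f (take l (take j ys)))"
    using step by (simp add: min_absorb1)
  also have "\<dots> = real (card B - j) * (\<Sum>xs\<in>dlists B j. f (take l xs))"
    by (rule sum_dlists_Suc[OF B(1)])
  finally show ?case using step B by (simp add: card_dlists ffact_Suc)
qed

lemma ffact_choose: "k \<le> a \<Longrightarrow> ffact a k = (a choose k) * fact k"
proof -
  assume "k \<le> a"
  have "ffact a k = card (\<Union>C\<in>{C. C \<subseteq> {..<a} \<and> card C = k}. permutations_of_set C)"
  proof -
    have "dlists {..<a} k = (\<Union>C\<in>{C. C \<subseteq> {..<a} \<and> card C = k}. permutations_of_set C)"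
      by (auto simp: dlists_def permutations_of_set_def distinct_card)
    then show ?thesis using card_dlists[of "{..<a}" k] by simp
  qed
  also have "\<dots> = (\<Sum>C\<in>{C. C \<subseteq> {..<a} \<and> card C = k}. card (permutations_of_set C))"
  proof (rule card_UN_disjoint)
    show "\<forall>C\<in>{C. C \<subseteq> {..<a} \<and> card C = k}. finite (permutations_of_set C)" by simp
  qed (auto simp: permutations_of_set_def)
  also have "\<dots> = (\<Sum>C\<in>{C. C \<subseteq> {..<a} \<and> card C = k}. fact k)"
    by (intro sum.cong refl) (auto simp: finite_subset[of _ "{..<a}"])
  also have "\<dots> = (a choose k) * fact k" by (simp add: n_subsets)
  finally show ?thesis .
qed

lemma ffact_ge: assumes "2 * k \<le> a" shows "(real a / 2) ^ k \<le> real (ffact a k)"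
proof -
  have "(real a / 2) ^ k = (\<Prod>i<k. real a / 2)" by simp
  also have "\<dots> \<le> (\<Prod>i<k. real (a - i))"
    using assms by (intro prod_mono) (auto simp: of_nat_diff)
  finally show ?thesis by (simp add: ffact_def)
qed

text \<open>Each prescribed element contributes a factor (m - i) / (a - i), which is at most m / a.
  This measures what knowing \<open>d\<close> elements of a set saves in describing it.\<close>

lemma choose_ratio:
  assumes "d \<le> m" "m \<le> a"
  shows "real ((a - d) choose (m - d)) * real a ^ d \<le> real (a choose m) * real m ^ d"
  using assms
proof (induction d)
  case (Suc d)
  have e: "real (m - d) * real ((a - d) choose (m - d)) = real (a - d) * real ((a - Suc d) choose (m - Suc d))"
  proof -
    have "(a - d) = Suc (a - Suc d)" "(m - d) = Suc (m - Suc d)" using Suc.prems by auto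
    then have "(m - d) * ((a - d) choose (m - d)) = (a - d) * ((a - Suc d) choose (m - Suc d))"
      using Suc_times_binomial_eq[of "a - Suc d" "m - Suc d"] by (metis mult.commute)
    then show ?thesis by (metis of_nat_mult)
  qed
  have pos: "real (a - d) > 0" using Suc.prems by simp
  have r: "real (m - d) * real a \<le> real m * real (a - d)"
    using Suc.prems mult_left_mono[of "real m" "real a" "real d"] by (simp add: of_nat_diff algebra_simps)
  have "real (a - d) * (real ((a - Suc d) choose (m - Suc d)) * real a ^ Suc d)
      = (real (m - d) * real a) * (real ((a - d) choose (m - d)) * real a ^ d)"
    using e by (simp add: algebra_simps)
  also have "\<dots> \<le> (real m * real (a - d)) * (real (a choose m) * real m ^ d)"
    by (rule mult_mono) (use r Suc in auto)
  finally have "real (a - d) * (real ((a - Suc d) choose (m - Suc d)) * real a ^ Suc d)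
      \<le> real (a - d) * (real (a choose m) * real m ^ Suc d)" by (simp only: mult_ac power_Suc)
  then show ?case using pos by (simp only: mult_le_cancel_left_pos)
qed simp

text \<open>The lists form a tree of depth \<open>s\<close> in which every node has at most
  \<open>b\<close> children. It is used to decode the deleted keys one at a time.\<close>

lemma branch_card:
  assumes fin: "finite L" and len: "\<And>l. l \<in> L \<Longrightarrow> length l = s"
    and br: "\<And>j p. j < s \<Longrightarrow> card ((\<lambda>l. l ! j) ` {l\<in>L. take j l = p}) \<le> b"
  shows "card L \<le> b ^ s"
proof -
  have "card (take j ` L) \<le> b ^ j" if "j \<le> s" for j
    using that
  proof (induction j)
    case 0
    have "take 0 ` L \<subseteq> {[]}" by auto
    then show ?case using card_mono[of "{[]::'a list}"] by fastforce
  next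
    case (Suc j)
    have "take (Suc j) ` L \<subseteq> (\<Union>p\<in>take j ` L. (\<lambda>y. p @ [y]) ` ((\<lambda>l. l ! j) ` {l\<in>L. take j l = p}))"
    proof
      fix z assume "z \<in> take (Suc j) ` L"
      then obtain l where l: "l \<in> L" "z = take (Suc j) l" by auto
      then have "z = take j l @ [l ! j]" using len Suc.prems by (simp add: take_Suc_conv_app_nth)
      then show "z \<in> (\<Union>p\<in>take j ` L. (\<lambda>y. p @ [y]) ` ((\<lambda>l. l ! j) ` {l\<in>L. take j l = p}))"
        using l by auto
    qed
    then have "card (take (Suc j) ` L) \<le> card (\<Union>p\<in>take j ` L. (\<lambda>y. p @ [y]) ` ((\<lambda>l. l ! j) ` {l\<in>L. take j l = p}))"
      using fin by (intro card_mono) auto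
    also have "\<dots> \<le> (\<Sum>p\<in>take j ` L. card ((\<lambda>y. p @ [y]) ` ((\<lambda>l. l ! j) ` {l\<in>L. take j l = p})))"
      using fin by (intro card_UN_le) auto
    also have "\<dots> \<le> (\<Sum>p\<in>take j ` L. b)"
    proof (rule sum_mono)
      fix p
      have "card ((\<lambda>y. p @ [y]) ` ((\<lambda>l. l ! j) ` {l\<in>L. take j l = p})) \<le> card ((\<lambda>l. l ! j) ` {l\<in>L. take j l = p})"
        using fin by (intro card_image_le) simp
      also have "\<dots> \<le> b" using br Suc.prems by simp
      finally show "card ((\<lambda>y. p @ [y]) ` ((\<lambda>l. l ! j) ` {l\<in>L. take j l = p})) \<le> b" .
    qed
    also have "\<dots> \<le> b ^ Suc j" using Suc by (simp add: mult.commute)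
    finally show ?case .
  qed
  from this[of s] have "card (take s ` L) \<le> b ^ s" by simp
  moreover have "take s ` L = L" using len by (force simp: image_iff)
  ultimately show ?thesis by simp
qed

section \<open>Entropy along one block of updates\<close>

locale block = det_dict n U S w A m0
  for n U S w :: nat and A :: prog and m0 :: mem +
  fixes st s q :: nat
  assumes s0: "s > 0" and q0: "q > 0" and fits: "st + q * s \<le> n" and U4: "4 * n \<le> U"
begin

definition tm :: "nat \<Rightarrow> nat" where "tm i = st + i * s"

definition Om :: "nat list set" where "Om = dlists {1..U} (n + tm q)"

definition past :: "nat \<Rightarrow> nat list \<Rightarrow> nat list" where "past i ks = take (n + tm i) ks"
definition Em :: "nat list \<Rightarrow> mem" where "Em ks = mem_at ks (tm q)"
definition Ts :: "nat list \<Rightarrow> nat set" where "Ts ks = set (current n ks (tm q))"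
definition Xi :: "nat \<Rightarrow> nat list \<Rightarrow> nat list" where "Xi i ks = Dk ks (n + tm i) (n + tm (Suc i))"
definition Di :: "nat \<Rightarrow> nat list \<Rightarrow> nat list" where "Di i ks = Dk ks (tm i) (tm (Suc i))"
definition Pi :: "nat \<Rightarrow> nat list \<Rightarrow> nat set" where "Pi i ks = probed ks (tm i) (tm (Suc i))"
text \<open>The cells of the interval on which the final memory may fail to show what the interval
  left there.\<close>

definition Fi :: "nat \<Rightarrow> nat list \<Rightarrow> nat set" where "Fi i ks = Pi i ks \<inter> probed ks (tm (Suc i)) (tm q)"

definition redund :: real where "redund = real (S * w) - log 2 (real (U choose n))"

lemma tm_mono: "i \<le> j \<Longrightarrow> tm i \<le> tm j" by (simp add: tm_def)

lemma tm_Suc: "tm (Suc i) = tm i + s" by (simp add: tm_def)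

lemma tm_le: "i \<le> q \<Longrightarrow> tm i \<le> n" using fits tm_mono[of i q] unfolding tm_def by linarith

lemma tmq: "tm q \<le> n" using tm_le by simp

lemma tm_diff: "i \<le> q \<Longrightarrow> tm q - tm i = (q - i) * s"
  by (simp add: tm_def diff_mult_distrib)

lemma fin_Om: "finite Om" by (simp add: Om_def finite_dlists)

lemma card_Om: "card Om = ffact U (n + tm q)" by (simp add: Om_def card_dlists)

lemma card_Om_pos: "card Om > 0"
  unfolding card_Om using tmq U4 by (intro ffact_pos) auto

lemma ne_Om: "Om \<noteq> {}" using card_Om_pos by auto

lemma OmD: "ks \<in> Om \<Longrightarrow> length ks = n + tm q \<and> distinct ks \<and> set ks \<subseteq> {1..U}"
  by (auto simp: Om_def dlists_def)

lemma valid_Om: "ks \<in> Om \<Longrightarrow> t \<le> tm q \<Longrightarrow> valid_seq n U (workload n ks t)"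
  using OmD[of ks] n0 by (intro workload_prefix_valid) auto

lemma set_Om: "ks \<in> Om \<Longrightarrow> t \<le> tm q \<Longrightarrow> set_after (workload n ks t) = set (current n ks t)"
  using OmD[of ks] n0 by (intro set_after_wops) auto

lemma card_cur: "ks \<in> Om \<Longrightarrow> t \<le> tm q \<Longrightarrow> card (set (current n ks t)) = n"
  using OmD[of ks] by (simp add: distinct_card distinct_cur length_cur)

lemma same_mm_same_cur:
  assumes "ks \<in> Om" "ks' \<in> Om" "t \<le> tm q" "t' \<le> tm q" "mem_at ks t = mem_at ks' t'"
  shows "set (current n ks t) = set (current n ks' t')"
  using same_mem_same_set[OF valid_Om[OF assms(1,3)] valid_Om[OF assms(2,4)]] assms set_Om
  by (simp add: mem_at_def)

lemma Em_Ts: "ks \<in> Om \<Longrightarrow> ks' \<in> Om \<Longrightarrow> Em ks = Em ks' \<Longrightarrow> Ts ks = Ts ks'"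
  unfolding Em_def Ts_def by (rule same_mm_same_cur) auto

sublocale v: fin_prob Om "\<lambda>_. 1 / real (card Om)"
  using fin_Om card_Om_pos by unfold_locales auto

lemma v_mass: "v.mass f k = real (card {k'\<in>Om. f k' = f k}) / card Om"
  by (simp add: v.mass_def)

text \<open>The key list is uniform, hence uniform in every fibre of \<open>f\<close>.\<close>

lemma cond_ent_id: "v.cond_ent (\<lambda>k. k) f = v.ex (\<lambda>k. log 2 (card {k'\<in>Om. f k' = f k}))"
  unfolding v.cond_ent_def v.ex_def
proof (intro sum.cong refl)
  fix k assume k: "k \<in> Om"
  have "{k'\<in>Om. (f k', k') = (f k, k)} = {k}" using k by auto
  then have "v.mass (\<lambda>x. (f x, x)) k = 1 / card Om" unfolding v_mass by simp
  then show "1 / real (card Om) * log 2 (v.mass f k / v.mass (\<lambda>x. (f x, x)) k) =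
      1 / real (card Om) * log 2 (card {k'\<in>Om. f k' = f k})"
    using card_Om_pos by (simp add: v_mass)
qed

lemma cond_ent_id_const: "v.cond_ent (\<lambda>k. k) (\<lambda>_. ()) = log 2 (ffact U (n + tm q))"
  using v.ex_const[of "log 2 (card Om)"] unfolding cond_ent_id by (simp add: card_Om)

lemma past_split: "ks \<in> Om \<Longrightarrow> i < q \<Longrightarrow> past (Suc i) ks = past i ks @ Xi i ks"
  using Dk_append[of 0 "n + tm i" "n + tm (Suc i)" ks] by (simp add: past_def Xi_def Dk_def tm_Suc)

lemma past_le: "i \<le> j \<Longrightarrow> past i ks = take (n + tm i) (past j ks)"
  using tm_mono[of i j] by (simp add: past_def min_absorb1)

lemma past_q: "ks \<in> Om \<Longrightarrow> past q ks = ks"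
  using OmD by (simp add: past_def)

lemma length_past: "ks \<in> Om \<Longrightarrow> i \<le> q \<Longrightarrow> length (past i ks) = n + tm i"
  using OmD[of ks] tm_mono[of i q] by (simp add: past_def)

lemma Ts_drop: "ks \<in> Om \<Longrightarrow> Ts ks = set (drop (tm q) ks)"
  using OmD[of ks] by (simp add: Ts_def current_def)

lemma Ts_split: assumes "ks \<in> Om" "i \<le> q"
  shows "Ts ks = set (drop (tm q) (past i ks)) \<union> set (drop (n + tm i) ks)"
proof -
  have "drop (tm q) ks = drop (tm q) (past i ks @ drop (n + tm i) ks)" by (simp add: past_def)
  also have "\<dots> = drop (tm q) (past i ks) @ drop (n + tm i) ks"
    using length_past[OF assms] tmq by simp
  finally show ?thesis using Ts_drop[OF assms(1)] by simp
qed

text \<open>First-in first-out deletion and \<open>tm q \<le> n\<close> keep every key inserted in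
  the block alive until its end, so the final set reveals which keys are still to come.\<close>

lemma new_keys: assumes "ks \<in> Om" "i \<le> q"
  shows "set (drop (n + tm i) ks) = Ts ks - set (past i ks)"
proof -
  have "set (past i ks) \<inter> set (drop (n + tm i) ks) = {}"
    using OmD[OF assms(1)] by (simp add: past_def set_take_disj_set_drop_if_distinct)
  moreover have "set (drop (tm q) (past i ks)) \<subseteq> set (past i ks)" by (rule set_drop_subset)
  ultimately show ?thesis using Ts_split[OF assms] by blast
qed

lemma card_new: "ks \<in> Om \<Longrightarrow> i \<le> q \<Longrightarrow> card (set (drop (n + tm i) ks)) = (q - i) * s"
  using OmD[of ks] tm_diff[of i] by (simp add: distinct_card)

text \<open>Given the past and the final set, only the order of the remaining keys is open.\<close>

lemma fiber_past_T:
  assumes "ks \<in> Om" "i \<le> q"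
  shows "card {k'\<in>Om. (past i k', Ts k') = (past i ks, Ts ks)} = fact ((q - i) * s)"
proof -
  let ?Z = "set (drop (n + tm i) ks)"
  have "{k'\<in>Om. (past i k', Ts k') = (past i ks, Ts ks)} = (\<lambda>ys. past i ks @ ys) ` permutations_of_set ?Z"
  proof (intro equalityI subsetI)
    fix k' assume "k' \<in> {k'\<in>Om. (past i k', Ts k') = (past i ks, Ts ks)}"
    then have k': "k' \<in> Om" "past i k' = past i ks" "Ts k' = Ts ks" by auto
    have "k' = past i ks @ drop (n + tm i) k'" using k'(2) by (metis append_take_drop_id past_def)
    moreover have "set (drop (n + tm i) k') = ?Z"
      using new_keys[OF k'(1) assms(2)] new_keys[OF assms] k' by simp
    moreover have "distinct (drop (n + tm i) k')" using OmD[OF k'(1)] by simp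
    ultimately show "k' \<in> (\<lambda>ys. past i ks @ ys) ` permutations_of_set ?Z"
      by (auto simp: permutations_of_set_def)
  next
    fix k' assume "k' \<in> (\<lambda>ys. past i ks @ ys) ` permutations_of_set ?Z"
    then obtain ys where ys: "k' = past i ks @ ys" "set ys = ?Z" "distinct ys"
      by (auto simp: permutations_of_set_def)
    have len: "length ys = (q - i) * s" using ys card_new[OF assms] distinct_card by metis
    have sets: "set (past i ks) \<union> ?Z = set ks" "set (past i ks) \<inter> ?Z = {}"
      using OmD[OF assms(1)] by (simp_all add: past_def set_take_disj_set_drop_if_distinct flip: set_append)
    have k'O: "k' \<in> Om"
    proof -
      have "length k' = n + tm q"
        using ys len length_past[OF assms] tm_diff[OF assms(2)] tm_mono[OF assms(2)] by simp
      moreover have "distinct k'" using ys sets OmD[OF assms(1)] by (simp add: past_def)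
      moreover have "set k' \<subseteq> {1..U}" using ys sets OmD[OF assms(1)] by auto
      ultimately show ?thesis by (simp add: Om_def dlists_def)
    qed
    have p: "past i k' = past i ks" using ys length_past[OF assms] by (simp add: past_def)
    have "drop (n + tm i) k' = ys" using ys length_past[OF assms] by simp
    then have "Ts k' = Ts ks"
      using Ts_split[OF k'O assms(2)] Ts_split[OF assms] p ys by simp
    then show "k' \<in> {k'\<in>Om. (past i k', Ts k') = (past i ks, Ts ks)}" using k'O p by simp
  qed
  then have "card {k'\<in>Om. (past i k', Ts k') = (past i ks, Ts ks)} = card (permutations_of_set ?Z)"
    by (simp add: card_image inj_on_def)
  then show ?thesis using card_new[OF assms] by simp
qed

lemma cond_ent_id_past_T: "i \<le> q \<Longrightarrow> v.cond_ent (\<lambda>k. k) (\<lambda>k. (past i k, Ts k)) = log 2 (fact ((q - i) * s))"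
proof -
  assume i: "i \<le> q"
  have "v.cond_ent (\<lambda>k. k) (\<lambda>k. (past i k, Ts k)) = v.ex (\<lambda>k. log 2 (fact ((q - i) * s)))"
    unfolding cond_ent_id v.ex_def by (intro sum.cong refl) (use fiber_past_T[OF _ i] in simp)
  then show ?thesis by (simp add: v.ex_const)
qed

text \<open>A \<open>mem\<close> has a value at every address. Freezing the addresses from
  \<open>S\<close> on at their initial contents makes this set finite.\<close>

definition mems :: "mem set" where "mems = {m. (\<forall>a<S. m a < 2 ^ w) \<and> (\<forall>a\<ge>S. m a = m0 a)}"

lemma mems_card: "finite mems \<and> card mems \<le> 2 ^ (S * w)"
proof -
  let ?r = "\<lambda>m. restrict m {..<S}"
  have inj: "inj_on ?r mems"
  proof (rule inj_onI)
    fix m m' assume *: "m \<in> mems" "m' \<in> mems" "?r m = ?r m'"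
    show "m = m'"
    proof
      fix a show "m a = m' a"
      proof (cases "a < S")
        case True
        then show ?thesis using fun_cong[OF *(3), of a] by simp
      qed (use * in \<open>simp add: mems_def\<close>)
    qed
  qed
  have sub: "?r ` mems \<subseteq> PiE {..<S} (\<lambda>_. {..<2 ^ w})" by (auto simp: mems_def PiE_def extensional_def split: if_splits)
  have finP: "finite (PiE {..<S} (\<lambda>_. {..<(2::nat) ^ w}))" by (intro finite_PiE) auto
  have f: "finite mems" using inj sub finP by (metis finite_imageD finite_subset)
  have "card mems = card (?r ` mems)" using inj by (simp add: card_image)
  also have "\<dots> \<le> card (PiE {..<S} (\<lambda>_. {..<(2::nat) ^ w}))" by (rule card_mono[OF finP sub])
  also have "\<dots> = 2 ^ (S * w)" by (simp add: card_PiE power_mult[symmetric] mult.commute)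
  finally show ?thesis using f by simp
qed

lemma mem_at_mems: "mem_at ks t \<in> mems" by (auto simp: mems_def mem_at_lt mem_at_ge)

lemma card_image_mems:
  assumes "f ` B \<subseteq> mems" shows "real (card (f ` B)) \<le> 2 ^ (S * w)"
proof -
  have "card (f ` B) \<le> card mems" using assms mems_card by (intro card_mono) auto
  then show ?thesis using mems_card by (metis (mono_tags, lifting) le_trans of_nat_le_iff of_nat_numeral of_nat_power)
qed

lemma cond_ent_id_T: "v.cond_ent (\<lambda>k. k) Ts \<le> log 2 (real (ffact (U - n) (tm q)) * fact n)"
proof -
  have "v.cond_ent (\<lambda>k. k) Ts \<le> log 2 (real (ffact (U - n) (tm q) * fact n))"
  proof (rule v.cond_ent_card_const)
    fix ks assume ks: "ks \<in> Om"
    let ?B = "dlists ({1..U} - Ts ks) (tm q) \<times> permutations_of_set (Ts ks)"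
    have cT: "card (Ts ks) = n" "Ts ks \<subseteq> {1..U}" "finite (Ts ks)"
      using card_cur[OF ks, of "tm q"] OmD[OF ks] by (auto simp: Ts_def current_def dest!: in_set_dropD in_set_takeD)
    have "(\<lambda>k. k) ` {k'\<in>Om. Ts k' = Ts ks} \<subseteq> (\<lambda>(a, b). a @ b) ` ?B"
    proof
      fix k assume "k \<in> (\<lambda>k. k) ` {k'\<in>Om. Ts k' = Ts ks}"
      then have k: "k \<in> Om" "Ts k = Ts ks" by auto
      note o = OmD[OF k(1)]
      have "take (tm q) k \<in> dlists ({1..U} - Ts ks) (tm q)"
        using o k set_take_disj_set_drop_if_distinct[of k "tm q" "tm q"]
        by (auto simp: dlists_def Ts_drop dest: in_set_takeD)
      moreover have "drop (tm q) k \<in> permutations_of_set (Ts ks)"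
        using o k by (simp add: permutations_of_set_def flip: Ts_drop)
      ultimately show "k \<in> (\<lambda>(a, b). a @ b) ` ?B"
        by (intro image_eqI[of _ _ "(take (tm q) k, drop (tm q) k)"]) auto
    qed
    then have "card ((\<lambda>k. k) ` {k'\<in>Om. Ts k' = Ts ks}) \<le> card ((\<lambda>(a, b). a @ b) ` ?B)"
      by (intro card_mono) (auto simp: finite_dlists)
    also have "\<dots> \<le> card ?B" by (rule card_image_le) (auto simp: finite_dlists)
    also have "\<dots> = ffact (U - n) (tm q) * fact n"
      using cT by (simp add: card_cartesian_product card_dlists card_Diff_subset)
    finally show "real (card ((\<lambda>k. k) ` {k'\<in>Om. Ts k' = Ts ks})) \<le> real (ffact (U - n) (tm q) * fact n)"
      using of_nat_le_iff by blast
  qed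
  then show ?thesis by simp
qed

lemma cond_ent_split:
  "v.cond_ent (\<lambda>k. k) g = v.cond_ent f g + v.cond_ent (\<lambda>k. k) (\<lambda>k. (g k, f k))"
proof -
  have "v.cond_ent (\<lambda>k. k) g = v.cond_ent (\<lambda>k. (f k, k)) g" by (rule v.cond_ent_cong) auto
  then show ?thesis by (simp add: v.cond_ent_chain)
qed

text \<open>The entropy of the set is that of the list minus that of the list given the set. For the
  latter one chooses the deleted keys outside the set and an order of the set.\<close>

lemma ent_T: "v.cond_ent Ts (\<lambda>_. ()) \<ge> log 2 (real (U choose n))"
proof -
  have "v.cond_ent (\<lambda>k. k) (\<lambda>k. ((), Ts k)) = v.cond_ent (\<lambda>k. k) Ts" by (rule v.cond_ent_cong) auto
  then have "v.cond_ent Ts (\<lambda>_. ()) \<ge> log 2 (ffact U (n + tm q)) - log 2 (real (ffact (U - n) (tm q)) * fact n)"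
    using cond_ent_split[of "\<lambda>_. ()" Ts] cond_ent_id_const cond_ent_id_T by simp
  moreover have "real (ffact U (n + tm q)) = real (U choose n) * (real (ffact (U - n) (tm q)) * fact n)"
    using U4 by (simp add: ffact_add ffact_choose)
  moreover have "U choose n > 0" "ffact (U - n) (tm q) > 0"
    using U4 tmq by (auto intro: ffact_pos)
  ultimately show ?thesis by (simp add: log_mult)
qed

text \<open>The memory determines its key set, so this is the entropy of the memory, at most
  \<open>S * w\<close>, minus the entropy of the set.\<close>

lemma ent_E_given_T: "v.cond_ent Em Ts \<le> redund"
proof -
  have "v.cond_ent Em (\<lambda>_. ()) \<le> log 2 (2 ^ (S * w))"
    by (rule v.cond_ent_card_const, rule card_image_mems) (auto simp: Em_def mem_at_mems)
  then have 1: "v.cond_ent Em (\<lambda>_. ()) \<le> real (S * w)" by (simp add: log_nat_power)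
  have "v.cond_ent Em (\<lambda>_. ()) = v.cond_ent (\<lambda>k. (Ts k, Em k)) (\<lambda>_. ())"
    by (rule v.cond_ent_cong) (auto dest: Em_Ts)
  also have "\<dots> = v.cond_ent Ts (\<lambda>_. ()) + v.cond_ent Em (\<lambda>k. ((), Ts k))" by (rule v.cond_ent_chain)
  also have "v.cond_ent Em (\<lambda>k. ((), Ts k)) = v.cond_ent Em Ts" by (rule v.cond_ent_cong) auto
  finally show ?thesis using 1 ent_T unfolding redund_def by simp
qed

text \<open>Since \<open>Em\<close> determines \<open>Ts\<close>, revealing \<open>Em\<close> on top
  of \<open>Ts\<close> leaves \<open>Em\<close> as the only condition beside the past, and it costs
  at most the redundancy.\<close>

lemma ent_keys_given_E: "v.cond_ent (\<lambda>k. k) (\<lambda>k. (past 0 k, Em k)) \<ge> log 2 (fact (q * s)) - redund"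
proof -
  have "v.cond_ent (\<lambda>k. k) (\<lambda>k. (past 0 k, Ts k))
     = v.cond_ent Em (\<lambda>k. (past 0 k, Ts k)) + v.cond_ent (\<lambda>k. k) (\<lambda>k. ((past 0 k, Ts k), Em k))"
    by (rule cond_ent_split)
  moreover have "v.cond_ent (\<lambda>k. k) (\<lambda>k. ((past 0 k, Ts k), Em k)) = v.cond_ent (\<lambda>k. k) (\<lambda>k. (past 0 k, Em k))"
    by (rule v.cond_ent_cong) (auto dest: Em_Ts)
  moreover have "v.cond_ent Em (\<lambda>k. (past 0 k, Ts k)) \<le> v.cond_ent Em Ts" by (rule v.cond_ent_cond_mono) auto
  ultimately show ?thesis using ent_E_given_T cond_ent_id_past_T[of 0] by simp
qed

text \<open>The final memory given its key set has entropy at most the redundancy, so in total these entropies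
  fall short of their maximum by at most the redundancy.\<close>

definition key_ent :: "nat \<Rightarrow> real" where "key_ent i = v.cond_ent (past (Suc i)) (\<lambda>k. (past i k, Em k))"

lemma past_det: "i \<le> j \<Longrightarrow> past j k = past j k' \<Longrightarrow> past i k = past i k'"
  using past_le by metis

lemma sum_key_ent: "(\<Sum>i<q. key_ent i) \<ge> log 2 (fact (q * s)) - redund"
proof -
  have "v.cond_ent (past j) (\<lambda>k. (past 0 k, Em k)) = (\<Sum>i<j. key_ent i)" if "j \<le> q" for j
    using that
  proof (induction j)
    case 0
    show ?case by (simp, rule v.cond_ent_det) auto
  next
    case (Suc j)
    have "v.cond_ent (past (Suc j)) (\<lambda>k. (past 0 k, Em k)) = v.cond_ent (\<lambda>k. (past j k, past (Suc j) k)) (\<lambda>k. (past 0 k, Em k))"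
      by (rule v.cond_ent_cong) (auto dest: past_det[of j "Suc j", rotated])
    also have "\<dots> = v.cond_ent (past j) (\<lambda>k. (past 0 k, Em k)) + v.cond_ent (past (Suc j)) (\<lambda>k. ((past 0 k, Em k), past j k))"
      by (rule v.cond_ent_chain)
    also have "v.cond_ent (past (Suc j)) (\<lambda>k. ((past 0 k, Em k), past j k)) = key_ent j"
      unfolding key_ent_def by (rule v.cond_ent_cong) (auto dest: past_det[of 0 j, rotated])
    finally show ?case using Suc by simp
  qed
  from this[of q] have "v.cond_ent (past q) (\<lambda>k. (past 0 k, Em k)) = (\<Sum>i<q. key_ent i)" by simp
  moreover have "v.cond_ent (past q) (\<lambda>k. (past 0 k, Em k)) = v.cond_ent (\<lambda>k. k) (\<lambda>k. (past 0 k, Em k))"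
    by (rule v.cond_ent_cong) (auto simp: past_q)
  ultimately show ?thesis using ent_keys_given_E by simp
qed

lemma set_Xi_sub: assumes "ks \<in> Om" "i < q"
  shows "set (Xi i ks) \<subseteq> Ts ks - set (past i ks)" "distinct (Xi i ks)" "length (Xi i ks) = s"
proof -
  have "set (Xi i ks) \<subseteq> set (drop (n + tm i) ks)" unfolding Xi_def Dk_def by (rule set_take_subset)
  then show "set (Xi i ks) \<subseteq> Ts ks - set (past i ks)" using new_keys[of ks i] assms by simp
  show "distinct (Xi i ks)" using OmD[OF assms(1)] by (simp add: Xi_def Dk_def)
  have "tm (Suc i) \<le> tm q" using assms(2) by (intro tm_mono) simp
  then show "length (Xi i ks) = s" using OmD[OF assms(1)] by (simp add: Xi_def length_Dk tm_Suc)
qed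

text \<open>Through \<open>Em\<close> the final set is known, so the \<open>s\<close> keys of the
  interval are drawn from the \<open>(q - i) * s\<close> keys of that set that are not in the
  past.\<close>

lemma key_ent_le: "i < q \<Longrightarrow> key_ent i \<le> log 2 (ffact ((q - i) * s) s)"
  unfolding key_ent_def
proof (rule v.cond_ent_card_const)
  fix ks assume ks: "ks \<in> Om" and i: "i < q"
  let ?B = "dlists (Ts ks - set (past i ks)) s"
  have "past (Suc i) ` {k'\<in>Om. (past i k', Em k') = (past i ks, Em ks)} \<subseteq> (\<lambda>x. past i ks @ x) ` ?B"
  proof
    fix z assume "z \<in> past (Suc i) ` {k'\<in>Om. (past i k', Em k') = (past i ks, Em ks)}"
    then obtain k where k: "k \<in> Om" "past i k = past i ks" "Em k = Em ks" "z = past (Suc i) k" by auto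
    have "Xi i k \<in> ?B" using set_Xi_sub[OF k(1) i] Em_Ts[OF k(1) ks k(3)] k(2) by (simp add: dlists_def)
    then show "z \<in> (\<lambda>x. past i ks @ x) ` ?B" using past_split[OF k(1) i] k by auto
  qed
  moreover have f: "finite (Ts ks - set (past i ks))" by (simp add: Ts_def)
  ultimately have "card (past (Suc i) ` {k'\<in>Om. (past i k', Em k') = (past i ks, Em ks)}) \<le> card ?B"
    by (meson card_image_le card_mono finite_dlists finite_imageI le_trans)
  also have "card ?B = ffact ((q - i) * s) s"
    using card_dlists[OF f, of s] card_new[OF ks, of i] new_keys[OF ks, of i] i by simp
  finally show "real (card (past (Suc i) ` {k'\<in>Om. (past i k', Em k') = (past i ks, Em ks)})) \<le> real (ffact ((q - i) * s) s)"
    by simp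
qed

text \<open>What the final memory tells about the keys of the interval beyond what its key set
  tells.\<close>

definition deficit :: "nat \<Rightarrow> real" where "deficit i = log 2 (ffact ((q - i) * s) s) - key_ent i"

lemma deficit_nonneg: "i < q \<Longrightarrow> deficit i \<ge> 0" using key_ent_le by (simp add: deficit_def)

lemma sum_deficit: "(\<Sum>i<q. deficit i) \<le> redund"
proof -
  have "(\<Sum>i<j. log 2 (ffact ((q - i) * s) s)) = log 2 (ffact (q * s) (j * s))" if "j \<le> q" for j
    using that
  proof (induction j)
    case (Suc j)
    have "ffact (q * s) (Suc j * s) = ffact (q * s) (j * s) * ffact ((q - j) * s) s"
      using ffact_add[of "q * s" "j * s" s] by (simp add: diff_mult_distrib add.commute)
    moreover have "ffact (q * s) (j * s) > 0" "ffact ((q - j) * s) s > 0"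
      using Suc.prems by (auto intro!: ffact_pos)
    ultimately show ?case using Suc by (simp add: log_mult)
  qed simp
  from this[of q] have "(\<Sum>i<q. log 2 (ffact ((q - i) * s) s)) = log 2 (fact (q * s))"
    by (simp add: ffact_choose)
  then show ?thesis using sum_key_ent by (simp add: deficit_def sum_subtractf)
qed

end

section \<open>The hybrid memory\<close>

text \<open>Appends a component to a sequential description, coded given some part \<open>c\<close>
  of what has been described.\<close>

lemma (in fin_prob) ent_pair_le:
  assumes "cond_ent f (\<lambda>_. ()) \<le> a" and "cond_ent h c \<le> b"
    and "\<And>om om'. om \<in> \<Omega> \<Longrightarrow> om' \<in> \<Omega> \<Longrightarrow> f om = f om' \<Longrightarrow> c om = c om'"
  shows "cond_ent (\<lambda>x. (f x, h x)) (\<lambda>_. ()) \<le> a + b"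
proof -
  have "cond_ent h (\<lambda>x. ((), f x)) \<le> cond_ent h c"
  proof (rule cond_ent_cond_mono)
    fix om om' assume "om \<in> \<Omega>" "om' \<in> \<Omega>" "((), f om) = ((), f om')"
    then show "c om = c om'" using assms(3)[of om om'] by blast
  qed
  then show ?thesis unfolding cond_ent_chain using assms(1,2) by simp
qed

lemma sum_lists_prod:
  fixes \<nu> :: "'a \<Rightarrow> real"
  assumes "finite Z"
  shows "(\<Sum>x\<in>{x. set x \<subseteq> Z \<and> length x = s}. prod_list (map \<nu> x)) = (\<Sum>z\<in>Z. \<nu> z) ^ s"
proof (induction s)
  case 0
  have "{x. set x \<subseteq> Z \<and> length x = 0} = {[]}" by auto
  then show ?case by simp
next
  case (Suc s)
  let ?L = "{x. set x \<subseteq> Z \<and> length x = s}"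
  have e: "{x. set x \<subseteq> Z \<and> length x = Suc s} = (\<lambda>(z, x). z # x) ` (Z \<times> ?L)"
  proof (intro equalityI subsetI)
    fix y assume "y \<in> {x. set x \<subseteq> Z \<and> length x = Suc s}"
    then obtain z x where "y = z # x" "z \<in> Z" "set x \<subseteq> Z" "length x = s" by (cases y) auto
    then show "y \<in> (\<lambda>(z, x). z # x) ` (Z \<times> ?L)" by (intro image_eqI[of _ _ "(z, x)"]) auto
  qed auto
  have "(\<Sum>x\<in>{x. set x \<subseteq> Z \<and> length x = Suc s}. prod_list (map \<nu> x)) = (\<Sum>(z, x)\<in>Z \<times> ?L. \<nu> z * prod_list (map \<nu> x))"
    unfolding e by (subst sum.reindex) (auto simp: inj_on_def case_prod_beta)
  also have "\<dots> = (\<Sum>z\<in>Z. \<Sum>x\<in>?L. \<nu> z * prod_list (map \<nu> x))" by (simp add: sum.cartesian_product)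
  also have "\<dots> = (\<Sum>z\<in>Z. \<nu> z) * (\<Sum>x\<in>?L. prod_list (map \<nu> x))" by (rule sum_product[symmetric])
  finally show ?case using Suc by simp
qed

lemma log_inv_one_minus: assumes "0 < x" "x \<le> 1 / 2" shows "log 2 (1 / (1 - x)) \<le> 3 * (x::real)"
proof -
  have "ln (1 / (1 - x)) \<le> 1 / (1 - x) - 1" using assms by (intro ln_le_minus_one) auto
  also have "\<dots> = x * (1 / (1 - x))" using assms by (simp add: field_simps)
  also have "\<dots> \<le> x * 2" using assms by (intro mult_left_mono) (auto simp: field_simps)
  finally have "ln (1 / (1 - x)) \<le> 3 * x * (2 / 3)" by simp
  also have "\<dots> \<le> 3 * x * ln 2" using ln2_ge_two_thirds assms by (intro mult_left_mono) auto
  finally show ?thesis unfolding log_def by (simp add: pos_divide_le_eq)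
qed

text \<open>A later interval must exist: resampled keys that the first run does not insert in this
  interval have to be inserted by it afterwards.\<close>

locale block_i = block n U S w A m0 st s q
  for n U S w :: nat and A :: prog and m0 :: mem and st s q :: nat +
  fixes i :: nat
  assumes i_lt: "Suc i < q"
begin

sublocale cp: coupling Om "\<lambda>k. (past i k, Em k)"
  using fin_Om ne_Om by unfold_locales

lemma take_Dk: "j \<le> b - a \<Longrightarrow> take j (Dk ks a b) = Dk ks a (a + j)"
  by (simp add: Dk_def min_absorb1)

lemma i_q: "i < q" "Suc i \<le> q" "i \<le> q" using i_lt by auto

text \<open>\<open>Xp\<close>, \<open>Pp\<close> and \<open>Dp\<close> are taken from the resampled
  run, \<open>Mn\<close>, \<open>Pa\<close> and \<open>Tp\<close> from the first one;
  \<open>Dp\<close> and \<open>Tp\<close> are common to both.\<close>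

definition Xp :: "nat list \<times> nat list \<Rightarrow> nat list" where "Xp om = Xi i (snd om)"
definition Pp :: "nat list \<times> nat list \<Rightarrow> nat set" where "Pp om = Pi i (snd om)"
definition Dp :: "nat list \<times> nat list \<Rightarrow> nat list" where "Dp om = Di i (snd om)"
definition Mn :: "nat list \<times> nat list \<Rightarrow> mem" where "Mn om = mem_at (fst om) (tm (Suc i))"
definition Pa :: "nat list \<times> nat list \<Rightarrow> nat list" where "Pa om = past (Suc i) (fst om)"
definition Tp :: "nat list \<times> nat list \<Rightarrow> nat set" where "Tp om = Ts (fst om)"

text \<open>The run with the resampled keys sees only old contents in this memory: a cell that it probes and
  that the first run does not probe has not changed during the interval.\<close>

definition hybrid :: "nat list \<times> nat list \<Rightarrow> mem" where
  "hybrid om = (\<lambda>c. if c \<in> Pi i (fst om) \<inter> Pi i (snd om) then mem_at (fst om) (tm i) c else mem_at (fst om) (tm (Suc i)) c)"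

lemma pairsD:
  assumes "om \<in> cp.pairs"
  shows "fst om \<in> Om" "snd om \<in> Om" "past i (snd om) = past i (fst om)" "Em (snd om) = Em (fst om)"
    "mem_at (snd om) (tm i) = mem_at (fst om) (tm i)" "Di i (snd om) = Di i (fst om)" "Ts (snd om) = Ts (fst om)"
proof -
  show 1: "fst om \<in> Om" "snd om \<in> Om" and 2: "past i (snd om) = past i (fst om)" "Em (snd om) = Em (fst om)"
    using assms by (cases om; simp add: cp.in_pairs)+
  show "mem_at (snd om) (tm i) = mem_at (fst om) (tm i)"
    using 2(1) mem_at_take[of "tm i" "tm i"] unfolding past_def by (metis order_refl)
  \<comment> \<open>The keys deleted in the interval were inserted before it, so the common past
    contains them.\<close>
  have "tm (Suc i) \<le> n + tm i" using tm_le[OF i_q(2)] by simp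
  then show "Di i (snd om) = Di i (fst om)"
    using 2(1) Dk_take[of "tm (Suc i)" "n + tm i"] unfolding past_def Di_def by metis
  show "Ts (snd om) = Ts (fst om)" using Em_Ts 1 2 by blast
qed

lemma len_ok: "k \<in> Om \<Longrightarrow> t \<le> tm q \<Longrightarrow> n + t \<le> length k"
  using OmD[of k] by simp

lemma tmS: "tm i \<le> tm (Suc i)" "tm (Suc i) \<le> tm q" "tm i \<le> tm q"
  using i_q by (auto intro: tm_mono)

lemma hybrid_agree:
  assumes "om \<in> cp.pairs" "c \<in> Pi i (snd om)"
  shows "hybrid om c = mem_at (snd om) (tm i) c"
proof (cases "c \<in> Pi i (fst om)")
  case False
  then have "mem_at (fst om) (tm (Suc i)) c = mem_at (fst om) (tm i) c"
    unfolding Pi_def using pairsD(1)[OF assms(1)] tmS len_ok by (intro probed_frame) auto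
  then show ?thesis using False pairsD(5)[OF assms(1)] by (simp add: hybrid_def)
qed (use assms pairsD(5)[OF assms(1)] in \<open>simp add: hybrid_def\<close>)

lemma hybrid_mems: "hybrid om \<in> mems" by (auto simp: mems_def hybrid_def mem_at_lt mem_at_ge)

lemma all_halt_wops: "k \<in> Om \<Longrightarrow> t \<le> tm q \<Longrightarrow> all_halt A m0 (workload n k t)"
  using halting[OF valid_Om] .

text \<open>The replay on the hybrid reads what the resampled run read, so it stays in step with
  that run on \<open>Pp\<close> after every update. This holds for partial replays as well, since
  the deleted keys become known only gradually.\<close>

lemma sim_agree:
  assumes "om \<in> cp.pairs" "j \<le> s" "c \<in> Pp om"
  shows "mem_after A (hybrid om) (update_ops (take j (Dp om)) (take j (Xp om))) c = mem_at (snd om) (tm i + j) c"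
proof -
  let ?k = "snd om" and ?t = "tm i + j"
  have k: "?k \<in> Om" using pairsD(2)[OF assms(1)] .
  have t: "tm i \<le> ?t" "?t \<le> tm (Suc i)" "?t \<le> tm q" using assms(2) tm_Suc[of i] tmS by auto
  have len: "n + ?t \<le> length ?k" using len_ok[OF k t(3)] .
  let ?ops = "update_ops (Dk ?k (tm i) ?t) (Dk ?k (n + tm i) (n + ?t))"
  have ops: "update_ops (take j (Dp om)) (take j (Xp om)) = ?ops"
    using assms(2) by (simp add: Dp_def Xp_def Di_def Xi_def take_Dk tm_Suc add.assoc)
  have al: "all_halt A (mem_at ?k (tm i)) ?ops"
    using all_halt_wops[OF k t(3)] workload_split[OF t(1) len] by (simp add: mem_at_def)
  have sub: "probed ?k (tm i) ?t \<subseteq> Pi i ?k"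
    unfolding Pi_def using probed_split[OF t(1,2), of ?k] len_ok[OF k tmS(2)] by auto
  have ag: "hybrid om a = mem_at ?k (tm i) a" if "a \<in> cells_seq A (mem_at ?k (tm i)) ?ops" for a
    using hybrid_agree[OF assms(1)] that sub by (auto simp: probed_def)
  have "mem_after A (hybrid om) ?ops c = (if c \<in> probed ?k (tm i) ?t then mem_at ?k ?t c else hybrid om c)"
    using seq_local[OF al ag] mem_at_split[OF t(1) len] by (simp add: probed_def)
  also have "\<dots> = mem_at ?k ?t c"
    using hybrid_agree[OF assms(1), of c] assms(3) probed_frame[OF t(1) len, of c] by (auto simp: Pp_def)
  finally show ?thesis unfolding ops .
qed

lemma length_Dp: "om \<in> cp.pairs \<Longrightarrow> length (Dp om) = s"
  using pairsD(2)[of om] OmD[of "snd om"] tmS tm_le[of "Suc i"] i_q by (simp add: Dp_def Di_def length_Dk tm_Suc)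

lemma Xp_props: "om \<in> cp.pairs \<Longrightarrow> length (Xp om) = s \<and> distinct (Xp om) \<and> set (Xp om) \<subseteq> Ts (fst om) - set (past i (fst om))"
  using set_Xi_sub[OF pairsD(2) i_q(1), of om] pairsD(3,7)[of om] unfolding Xp_def by simp

lemma Ts_sub: "k \<in> Om \<Longrightarrow> Ts k \<subseteq> {1..U}"
  using OmD[of k] set_drop_subset[of "tm q" k] by (auto simp: Ts_drop)

lemma query_key:
  assumes "om \<in> cp.pairs" "j < s"
  shows "halts A (mem_at (snd om) (tm i + j)) (Qry (Dp om ! j))" "ans A (mem_at (snd om) (tm i + j)) (Qry (Dp om ! j))"
    "cells A (mem_at (snd om) (tm i + j)) (Qry (Dp om ! j)) \<subseteq> Pp om" "Dp om ! j \<in> {1..U}"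
proof -
  let ?k = "snd om" and ?t = "tm i + j"
  have k: "?k \<in> Om" using pairsD(2)[OF assms(1)] .
  have t: "tm i \<le> ?t" "Suc ?t \<le> tm (Suc i)" "Suc ?t \<le> tm q" "?t \<le> tm q" using assms(2) tm_Suc[of i] tmS by auto
  have len: "n + Suc ?t \<le> length ?k" using len_ok[OF k t(3)] .
  have y: "Dp om ! j = ?k ! ?t" using assms(2) len by (simp add: Dp_def Di_def Dk_def tm_Suc)
  have V: "valid_seq n U (workload n ?k (Suc ?t))" using valid_Om[OF k t(3)] .
  have e: "workload n ?k (Suc ?t) = (workload n ?k ?t @ [Qry (?k ! ?t)]) @ [Del (?k ! ?t), Ins (?k ! (n + ?t))]"
    using workload_Suc[of n ?t ?k] len by simp
  have V0: "valid_seq n U (workload n ?k ?t)" using valid_Om[OF k t(4)] .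
  have "?k ! ?t \<in> set ?k" using len by (intro nth_mem) simp
  then have r: "?k ! ?t \<in> {1..U}" using OmD[OF k] by blast
  then have V1: "valid_seq n U (workload n ?k ?t @ [Qry (?k ! ?t)])" using V0 by (simp add: valid_seq_snoc)
  show "Dp om ! j \<in> {1..U}" using r y by simp
  show "halts A (mem_at ?k ?t) (Qry (Dp om ! j))" using halting[OF V1] by (simp add: y mem_at_def)
  have "current n ?k ?t = ?k ! ?t # tl (current n ?k ?t)" using current_Suc(1)[of n ?t ?k] len n0 by simp
  then have "?k ! ?t \<in> set (current n ?k ?t)" by (rule ssubst) simp
  then show "ans A (mem_at ?k ?t) (Qry (Dp om ! j))"
    using correct[OF V1] set_Om[OF k t(4)] by (simp add: y mem_at_def)
  have "Dk ?k ?t (Suc ?t) = [?k ! ?t]" "Dk ?k (n + ?t) (n + Suc ?t) = [?k ! (n + ?t)]"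
    using len by (auto simp: Dk_def take_Suc_conv_app_nth)
  then have "cells A (mem_at ?k ?t) (Qry (?k ! ?t)) \<subseteq> probed ?k ?t (Suc ?t)" by (simp add: probed_def update_ops_single)
  also have "\<dots> \<subseteq> probed ?k (tm i) (Suc ?t)" using probed_split[of "tm i" ?t "Suc ?t" ?k] len by auto
  also have "\<dots> \<subseteq> Pi i ?k" unfolding Pi_def using probed_split[of "tm i" "Suc ?t" "tm (Suc i)" ?k] t len_ok[OF k tmS(2)] by auto
  finally show "cells A (mem_at ?k ?t) (Qry (Dp om ! j)) \<subseteq> Pp om" by (simp add: y Pp_def)
qed

lemma ent_hybrid: "cp.c.cond_ent hybrid (\<lambda>_. ()) \<le> real (S * w)"
proof -
  have "cp.c.cond_ent hybrid (\<lambda>_. ()) \<le> log 2 (2 ^ (S * w))"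
    by (rule cp.c.cond_ent_card_const, rule card_image_mems) (auto simp: hybrid_mems)
  then show ?thesis by (simp add: log_nat_power)
qed

lemma ent_Xp: "cp.c.cond_ent Xp g \<le> real s * log 2 (real U)"
proof -
  have "cp.c.cond_ent Xp g \<le> log 2 (real (U ^ s))"
  proof (rule cp.c.cond_ent_card_const)
    fix om
    have "Xp ` {om' \<in> cp.pairs. g om' = g om} \<subseteq> {x. set x \<subseteq> {1..U} \<and> length x = s}"
    proof
      fix x assume "x \<in> Xp ` {om' \<in> cp.pairs. g om' = g om}"
      then obtain om' where o: "om' \<in> cp.pairs" "x = Xp om'" by blast
      show "x \<in> {x. set x \<subseteq> {1..U} \<and> length x = s}"
        using Xp_props[OF o(1)] Ts_sub[OF pairsD(1)[OF o(1)]] o(2) by blast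
    qed
    then have "card (Xp ` {om' \<in> cp.pairs. g om' = g om}) \<le> card {x. set x \<subseteq> {1..U} \<and> length x = s}"
      by (intro card_mono finite_lists_length_eq) auto
    also have "\<dots> = U ^ s" by (simp add: card_lists_length_eq)
    finally show "real (card (Xp ` {om' \<in> cp.pairs. g om' = g om})) \<le> real (U ^ s)" using of_nat_le_iff by blast
  qed
  then show ?thesis using U4 n0 by (simp add: log_nat_power)
qed

lemma Pp_bound: "Pp om \<subseteq> {..<S}" by (simp add: Pp_def Pi_def probed_bound)

text \<open>The code is the law of a random set containing each cell independently with probability
  \<open>x\<close>: a member costs \<open>log (1 / x)\<close>, a non-member at most
  \<open>3 * x\<close>.\<close>

lemma ent_Pp:
  fixes g :: "nat list \<times> nat list \<Rightarrow> 'g"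
  assumes "0 < x" "x \<le> 1 / 2"
  shows "cp.c.cond_ent Pp g \<le> cp.c.ex (\<lambda>om. real (card (Pp om)) * log 2 (1 / x)) + 3 * x * S"
proof -
  define \<mu> where "\<mu> u P = x ^ card P * (1 - x) ^ (S - card P)" for u :: 'g and P :: "nat set"
  have "cp.c.cond_ent Pp g \<le> cp.c.ex (\<lambda>om. log 2 (1 / \<mu> (g om) (Pp om)))"
  proof (rule cp.c.gibbs)
    fix om
    show "\<mu> (g om) (Pp om) > 0" using assms by (simp add: \<mu>_def)
    have "(\<Sum>P\<in>Pp ` {om' \<in> cp.pairs. g om' = g om}. \<mu> (g om) P) \<le> (\<Sum>P\<in>Pow {..<S}. \<mu> (g om) P)"
      using Pp_bound assms by (intro sum_mono2) (auto simp: \<mu>_def)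
    also have "\<dots> = (\<Sum>P\<in>Pow {..<S}. (\<Prod>c\<in>P. x) * (\<Prod>c\<in>{..<S} - P. 1 - x))"
      by (intro sum.cong refl) (auto simp: \<mu>_def card_Diff_subset finite_subset)
    also have "\<dots> = (\<Prod>c<S. x + (1 - x))" by (rule prod_add[symmetric]) simp
    also have "\<dots> = 1" by simp
    finally show "(\<Sum>P\<in>Pp ` {om' \<in> cp.pairs. g om' = g om}. \<mu> (g om) P) \<le> 1" .
  qed
  also have "\<dots> \<le> cp.c.ex (\<lambda>om. real (card (Pp om)) * log 2 (1 / x) + 3 * x * S)"
  proof (rule cp.c.ex_mono)
    fix om
    have "log 2 (1 / \<mu> (g om) (Pp om)) = real (card (Pp om)) * log 2 (1 / x) + real (S - card (Pp om)) * log 2 (1 / (1 - x))"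
      using assms by (simp add: \<mu>_def log_divide log_mult log_nat_power algebra_simps)
    also have "real (S - card (Pp om)) * log 2 (1 / (1 - x)) \<le> real S * (3 * x)"
      using log_inv_one_minus[OF assms] assms by (intro mult_mono) auto
    finally show "log 2 (1 / \<mu> (g om) (Pp om)) \<le> real (card (Pp om)) * log 2 (1 / x) + 3 * x * S"
      by (simp add: algebra_simps)
  qed
  also have "\<dots> = cp.c.ex (\<lambda>om. real (card (Pp om)) * log 2 (1 / x)) + 3 * x * S"
    by (simp add: cp.c.ex_add cp.c.ex_const)
  finally show ?thesis .
qed

text \<open>Once \<open>j\<close> deleted keys are decoded, the replay yields the contents of
  \<open>Pp\<close> at that time, the same in all outcomes still possible. The next deleted key has
  a positive query that stays in \<open>Pp\<close>, so the query is also positive in one fixed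
  possible outcome \<open>om0\<close>. There only \<open>n\<close> keys are present.\<close>

lemma ent_Dp: "cp.c.cond_ent Dp (\<lambda>om. (hybrid om, Xp om, Pp om)) \<le> real s * log 2 (real n)"
proof -
  have "cp.c.cond_ent Dp (\<lambda>om. (hybrid om, Xp om, Pp om)) \<le> log 2 (real (n ^ s))"
  proof (rule cp.c.cond_ent_card_const)
    fix om assume w: "om \<in> cp.pairs"
    let ?W = "{om' \<in> cp.pairs. (hybrid om', Xp om', Pp om') = (hybrid om, Xp om, Pp om)}"
    have "card (Dp ` ?W) \<le> n ^ s"
    proof (rule branch_card)
      show "finite (Dp ` ?W)" using cp.fin_pairs by simp
      show "length l = s" if "l \<in> Dp ` ?W" for l using that length_Dp by auto
      fix j p assume j: "j < s"
      let ?L = "{l \<in> Dp ` ?W. take j l = p}"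
      show "card ((\<lambda>l. l ! j) ` ?L) \<le> n"
      proof (cases "?L = {}")
        case False
        then obtain om0 where w0: "om0 \<in> cp.pairs" "hybrid om0 = hybrid om" "Xp om0 = Xp om" "Pp om0 = Pp om" "take j (Dp om0) = p"
          by auto
        let ?k0 = "snd om0" and ?t = "tm i + j"
        have t: "?t \<le> tm q" using j tm_Suc[of i] tmS by simp
        have k0: "?k0 \<in> Om" using pairsD(2)[OF w0(1)] .
        have "(\<lambda>l. l ! j) ` ?L \<subseteq> set (current n ?k0 ?t)"
        proof
          fix y assume "y \<in> (\<lambda>l. l ! j) ` ?L"
          then obtain om1 where w1: "om1 \<in> cp.pairs" "hybrid om1 = hybrid om" "Xp om1 = Xp om" "Pp om1 = Pp om" "take j (Dp om1) = p"
            and y: "y = Dp om1 ! j" by auto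
          note q = query_key[OF w1(1) j]
          have ag: "mem_at ?k0 ?t a = mem_at (snd om1) ?t a" if "a \<in> cells A (mem_at (snd om1) ?t) (Qry y)" for a
          proof -
            have "a \<in> Pp om" using q(3) that y w1 by auto
            then show ?thesis using sim_agree[OF w1(1), of j a] sim_agree[OF w0(1), of j a] w0 w1 j by simp
          qed
          have "ans A (mem_at ?k0 ?t) (Qry y)" using op_local(2)[OF q(1)[folded y] ag] q(2) y by simp
          moreover have "valid_seq n U (workload n ?k0 ?t @ [Qry y])"
            using valid_Om[OF k0 t] q(4) y by (simp add: valid_seq_snoc)
          ultimately show "y \<in> set (current n ?k0 ?t)"
            using correct set_Om[OF k0 t] by (simp add: mem_at_def)
        qed
        then have "card ((\<lambda>l. l ! j) ` ?L) \<le> card (set (current n ?k0 ?t))"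
          by (intro card_mono) auto
        then show ?thesis using card_cur[OF k0 t] by simp
      next
        case True
        then show ?thesis by (simp only: image_empty card.empty)
      qed
    qed
    then show "real (card (Dp ` ?W)) \<le> real (n ^ s)" using of_nat_le_iff by blast
  qed
  then show ?thesis using n0 by (simp add: log_nat_power)
qed

lemma Mn_off: "c \<notin> Pp om \<Longrightarrow> Mn om c = hybrid om c"
  by (simp add: Mn_def hybrid_def Pp_def)

text \<open>A cell probed by both runs in the interval, and by neither later in the block, shows its
  content after the interval in the common final memory. So both runs left the same content there,
  and the replay reproduces it.\<close>

lemma Mn_on:
  assumes "om \<in> cp.pairs" "c \<in> Pp om" "c \<notin> Fi i (fst om)" "c \<notin> Fi i (snd om)"
  shows "Mn om c = hybrid om c \<or> Mn om c = mem_after A (hybrid om) (update_ops (Dp om) (Xp om)) c"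
proof (cases "c \<in> Pi i (fst om)")
  case False
  then show ?thesis by (simp add: Mn_def hybrid_def)
next
  case True
  have later: "mem_at k (tm q) c = mem_at k (tm (Suc i)) c" if "k \<in> Om" "c \<in> Pi i k" "c \<notin> Fi i k" for k
    using that probed_frame[OF tmS(2) len_ok[OF that(1) order_refl], of c] by (auto simp: Fi_def)
  have "Mn om c = Em (fst om) c" using later[of "fst om"] True assms pairsD(1)[OF assms(1)] by (simp add: Mn_def Em_def)
  also have "\<dots> = mem_at (snd om) (tm (Suc i)) c"
    using later[of "snd om"] assms pairsD[OF assms(1)] by (simp add: Em_def Pp_def)
  also have "\<dots> = mem_after A (hybrid om) (update_ops (Dp om) (Xp om)) c"
    using sim_agree[OF assms(1) order_refl assms(2)] length_Dp[OF assms(1)] Xp_props[OF assms(1)] by (simp add: tm_Suc)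
  finally show ?thesis by simp
qed

lemma Fi_fin [simp]: "finite (Fi i k)" "finite (Pp om)" by (simp_all add: Fi_def Pi_def Pp_def)

text \<open>Cells outside \<open>Pp\<close> are read off the hybrid. A cell of \<open>Pp\<close>
  with one of the two contents of \<open>Mn_on\<close> takes two bits, and one in \<open>Fi\<close>
  of either run is spelled out.\<close>

lemma ent_Mn:
  "cp.c.cond_ent Mn (\<lambda>om. (hybrid om, Xp om, Pp om, Dp om))
    \<le> cp.c.ex (\<lambda>om. 2 * card (Pp om) + (w + 1) * (card (Fi i (fst om)) + card (Fi i (snd om))))"
proof -
  define sim where "sim u = mem_after A (fst u) (update_ops (snd (snd (snd u))) (fst (snd u)))"
    for u :: "mem \<times> nat list \<times> nat set \<times> nat list"
  \<comment> \<open>A quarter for each of the two guesses and one half spread evenly over the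
    \<open>2 ^ w\<close> contents.\<close>
  define \<nu> where "\<nu> u c z = (if z = fst u c then 1/4 else 0) + (if z = sim u c then 1/4 else 0) + (1 / 2 ^ (w + 1) :: real)"
    for u :: "mem \<times> nat list \<times> nat set \<times> nat list" and c and z :: nat
  define \<mu> where "\<mu> u v = (\<Prod>c\<in>fst (snd (snd u)). \<nu> u c (v c))" for u :: "mem \<times> nat list \<times> nat set \<times> nat list" and v :: mem
  have npos: "\<nu> u c z > 0" for u c z by (simp add: \<nu>_def add_nonneg_pos)
  let ?g = "\<lambda>om. (hybrid om, Xp om, Pp om, Dp om)"
  have "cp.c.cond_ent Mn ?g \<le> cp.c.ex (\<lambda>om. log 2 (1 / \<mu> (?g om) (Mn om)))"
  proof (rule cp.c.gibbs)
    fix om assume w: "om \<in> cp.pairs"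
    let ?u = "?g om" and ?P = "Pp om"
    let ?V = "Mn ` {om' \<in> cp.pairs. ?g om' = ?g om}"
    show "\<mu> ?u (Mn om) > 0" unfolding \<mu>_def using npos by (simp add: prod_pos)
    have off: "v c = hybrid om c" if "v \<in> ?V" "c \<notin> ?P" for v c
      using that Mn_off by auto
    have inj: "inj_on (\<lambda>v. restrict v ?P) ?V"
    proof (rule inj_onI)
      fix v v' assume *: "v \<in> ?V" "v' \<in> ?V" "restrict v ?P = restrict v' ?P"
      show "v = v'"
      proof
        fix c show "v c = v' c"
          using off[OF *(1), of c] off[OF *(2), of c] fun_cong[OF *(3), of c] by (cases "c \<in> ?P") auto
      qed
    qed
    have sub: "(\<lambda>v. restrict v ?P) ` ?V \<subseteq> PiE ?P (\<lambda>_. {..<2 ^ w})"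
      using Pp_bound[of om] by (auto simp: restrict_PiE_iff Mn_def intro!: mem_at_lt)
    have one: "(\<Sum>z<2 ^ w. \<nu> ?u c z) \<le> 1" for c
    proof -
      have "(\<Sum>z<(2::nat) ^ w. (if z = y then 1/4 else 0 :: real)) \<le> 1/4" for y
        by (subst sum.delta) auto
      from this[of "hybrid om c"] this[of "sim ?u c"] show ?thesis
        by (simp add: \<nu>_def sum.distrib)
    qed
    have "(\<Sum>v\<in>?V. \<mu> ?u v) = (\<Sum>f\<in>(\<lambda>v. restrict v ?P) ` ?V. \<Prod>c\<in>?P. \<nu> ?u c (f c))"
      by (subst sum.reindex[OF inj]) (simp add: \<mu>_def cong: prod.cong)
    also have "\<dots> \<le> (\<Sum>f\<in>PiE ?P (\<lambda>_. {..<2 ^ w}). \<Prod>c\<in>?P. \<nu> ?u c (f c))"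
      using sub npos by (intro sum_mono2 finite_PiE prod_nonneg) (auto intro: less_imp_le)
    also have "\<dots> = (\<Prod>c\<in>?P. \<Sum>z<2 ^ w. \<nu> ?u c z)" by (subst prod_sum_PiE) auto
    also have "\<dots> \<le> 1" by (intro prod_le_1 conjI sum_nonneg less_imp_le[OF npos] one)
    finally show "(\<Sum>v\<in>?V. \<mu> ?u v) \<le> 1" .
  qed
  also have "\<dots> \<le> cp.c.ex (\<lambda>om. 2 * card (Pp om) + (w + 1) * (card (Fi i (fst om)) + card (Fi i (snd om))))"
  proof (rule cp.c.ex_mono)
    fix om assume w: "om \<in> cp.pairs"
    let ?u = "?g om" and ?P = "Pp om" and ?X = "Fi i (fst om) \<union> Fi i (snd om)"
    have "log 2 (1 / \<mu> ?u (Mn om)) = (\<Sum>c\<in>?P. log 2 (1 / \<nu> ?u c (Mn om c)))"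
    proof -
      have "1 / \<mu> ?u (Mn om) = (\<Prod>c\<in>?P. 1 / \<nu> ?u c (Mn om c))"
        by (simp add: \<mu>_def prod_dividef)
      moreover have "ln (\<Prod>c\<in>?P. 1 / \<nu> ?u c (Mn om c)) = (\<Sum>c\<in>?P. ln (1 / \<nu> ?u c (Mn om c)))"
        by (rule ln_prod) (use npos in \<open>simp_all add: order_less_imp_not_eq2\<close>)
      ultimately show ?thesis unfolding log_def by (simp only: sum_divide_distrib)
    qed
    also have "\<dots> \<le> (\<Sum>c\<in>?P. 2 + (if c \<in> ?X then real (w + 1) else 0))"
    proof (rule sum_mono)
      fix c assume c: "c \<in> ?P"
      have lg: "log 2 (1 / \<nu> ?u c (Mn om c)) \<le> real e" if "\<nu> ?u c (Mn om c) \<ge> 1 / 2 ^ e" for e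
      proof -
        have "1 / \<nu> ?u c (Mn om c) \<le> 2 ^ e" using that npos[of ?u c "Mn om c"] by (simp add: field_simps)
        then have "log 2 (1 / \<nu> ?u c (Mn om c)) \<le> log 2 (2 ^ e)" using npos by (subst log_le_cancel_iff) auto
        then show ?thesis by (simp add: log_nat_power)
      qed
      show "log 2 (1 / \<nu> ?u c (Mn om c)) \<le> 2 + (if c \<in> ?X then real (w + 1) else 0)"
      proof (cases "c \<in> ?X")
        case True
        have "\<nu> ?u c (Mn om c) \<ge> 1 / 2 ^ (w + 1)" by (simp add: \<nu>_def)
        from lg[OF this] True show ?thesis by simp
      next
        case False
        have "\<nu> ?u c (Mn om c) \<ge> 1 / 2 ^ 2" using Mn_on[OF w c] False by (auto simp: \<nu>_def sim_def)
        from lg[OF this] False show ?thesis by simp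
      qed
    qed
    also have "\<dots> = 2 * card ?P + real (w + 1) * card (?P \<inter> ?X)"
    proof -
      have "?P \<inter> {c. c \<in> ?X} = ?P \<inter> ?X" by blast
      then show ?thesis unfolding sum.distrib sum.If_cases[OF Fi_fin(2)] by simp
    qed
    also have "\<dots> \<le> 2 * card ?P + real (w + 1) * (card (Fi i (fst om)) + card (Fi i (snd om)))"
    proof -
      have "card (?P \<inter> ?X) \<le> card ?X" by (intro card_mono) auto
      also have "\<dots> \<le> card (Fi i (fst om)) + card (Fi i (snd om))" by (rule card_Un_le)
      finally show ?thesis by (intro add_left_mono mult_left_mono) (auto simp flip: of_nat_add)
    qed
    finally show "log 2 (1 / \<mu> ?u (Mn om)) \<le> 2 * card ?P + (w + 1) * (card (Fi i (fst om)) + card (Fi i (snd om)))"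
      by (simp add: algebra_simps)
  qed
  finally show ?thesis .
qed

end

section \<open>The entropy balance of one interval\<close>

context block_i
begin

text \<open>The number of keys inserted in the block after this interval; \<open>Urest\<close> is
  the number of universe keys from which they are drawn.\<close>

definition mrest :: nat where "mrest = (q - Suc i) * s"
definition Urest :: nat where "Urest = U - (n + tm (Suc i))"
definition dd :: "nat list \<times> nat list \<Rightarrow> nat" where
  "dd om = card (set (Xp om) - set (Xi i (fst om)))"

lemma mrest_pos: "mrest > 0" using i_lt s0 by (simp add: mrest_def)

lemma Urest_ge: "2 * n \<le> Urest" "U \<le> 2 * Urest" "mrest \<le> n" "mrest \<le> Urest"
proof -
  have t: "tm (Suc i) \<le> n" using tm_le i_q by simp
  show a: "2 * n \<le> Urest" "U \<le> 2 * Urest" using t U4 by (auto simp: Urest_def)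
  have "mrest = tm q - tm (Suc i)" using tm_diff[of "Suc i"] i_q by (simp add: mrest_def)
  then show "mrest \<le> n" using tmq by simp
  then show "mrest \<le> Urest" using a by simp
qed

lemma Pa_Xi: "k \<in> Om \<Longrightarrow> drop (n + tm i) (past (Suc i) k) = Xi i k"
  using past_split[of k i] length_past[of k i] i_q by simp

text \<open>Here one memory yields \<open>n + s\<close> keys: \<open>Mn\<close> determines the set
  of \<open>n\<close> stored keys and \<open>Dp\<close> adds \<open>s\<close> deleted ones. Open are
  the order of the stored keys and the keys deleted before the interval.\<close>

lemma ent_Pa: "cp.c.cond_ent Pa (\<lambda>om. (Mn om, Dp om)) \<le> log 2 (real (ffact (U - n - s) (tm i)) * fact n)"
proof -
  have "cp.c.cond_ent Pa (\<lambda>om. (Mn om, Dp om)) \<le> log 2 (real (ffact (U - n - s) (tm i) * fact n))"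
  proof (rule cp.c.cond_ent_card_const)
    fix om assume w: "om \<in> cp.pairs"
    let ?C = "set (current n (fst om) (tm (Suc i)))" and ?D = "Dp om"
    let ?B = "dlists ({1..U} - ?C - set ?D) (tm i) \<times> permutations_of_set ?C"
    let ?W = "{om' \<in> cp.pairs. (Mn om', Dp om') = (Mn om, Dp om)}"
    have dec: "past (Suc i) k = take (tm i) k @ Di i k @ current n k (tm (Suc i))" if "k \<in> Om" for k
    proof -
      have "past (Suc i) k = take (tm (Suc i)) k @ current n k (tm (Suc i))"
      proof -
        have "take (tm (Suc i)) (past (Suc i) k) = take (tm (Suc i)) k" by (simp add: past_def min_absorb1)
        moreover have "drop (tm (Suc i)) (past (Suc i) k) = current n k (tm (Suc i))" by (simp add: past_def current_def)
        ultimately show ?thesis by (metis append_take_drop_id)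
      qed
      moreover have "take (tm (Suc i)) k = take (tm i) k @ Di i k"
        using Dk_append[of 0 "tm i" "tm (Suc i)" k] tmS by (simp add: Di_def Dk_def)
      ultimately show ?thesis by simp
    qed
    have dist: "distinct (take (tm i) k @ Di i k @ current n k (tm (Suc i)))" if "k \<in> Om" for k
      using OmD[OF that] dec[OF that, symmetric] by (simp add: past_def)
    have rng: "set (take (tm i) k @ Di i k @ current n k (tm (Suc i))) \<subseteq> {1..U}" if "k \<in> Om" for k
      using OmD[OF that] dec[OF that, symmetric] set_take_subset[of _ k] by (auto simp: past_def)
    have "Pa ` ?W \<subseteq> (\<lambda>(a, b). a @ ?D @ b) ` ?B"
    proof
      fix z assume "z \<in> Pa ` ?W"
      then obtain om' where o: "om' \<in> cp.pairs" "Mn om' = Mn om" "Dp om' = Dp om" "z = Pa om'" by auto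
      let ?k = "fst om'"
      have k: "?k \<in> Om" using pairsD(1)[OF o(1)] .
      have D: "Di i ?k = ?D" using pairsD(6)[OF o(1)] o(3) by (simp add: Dp_def)
      have C: "set (current n ?k (tm (Suc i))) = ?C"
        using same_mm_same_cur[OF k pairsD(1)[OF w] tmS(2) tmS(2)] o(2) by (simp add: Mn_def)
      have "take (tm i) ?k \<in> dlists ({1..U} - ?C - set ?D) (tm i)"
        using dist[OF k] rng[OF k] C D len_ok[OF k tmS(3)] by (auto simp: dlists_def)
      moreover have "current n ?k (tm (Suc i)) \<in> permutations_of_set ?C"
        using C dist[OF k] by (simp add: permutations_of_set_def)
      moreover have "z = take (tm i) ?k @ ?D @ current n ?k (tm (Suc i))" using o(4) dec[OF k] D by (simp add: Pa_def)
      ultimately show "z \<in> (\<lambda>(a, b). a @ ?D @ b) ` ?B"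
        by (intro image_eqI[of _ _ "(take (tm i) ?k, current n ?k (tm (Suc i)))"]) auto
    qed
    then have "card (Pa ` ?W) \<le> card ((\<lambda>(a, b). a @ ?D @ b) ` ?B)"
      by (intro card_mono) (auto simp: finite_dlists)
    also have "\<dots> \<le> card ?B" by (rule card_image_le) (auto simp: finite_dlists)
    also have "\<dots> = ffact (U - n - s) (tm i) * fact n"
    proof -
      let ?k = "fst om"
      have k: "?k \<in> Om" using pairsD(1)[OF w] .
      have D: "Di i ?k = ?D" using pairsD(6)[OF w] by (simp add: Dp_def)
      have "card ?C = n" using card_cur[OF k tmS(2)] .
      moreover have "card (set ?D) = s" using length_Dp[OF w] dist[OF k] D by (simp add: distinct_card)
      moreover have "?C \<subseteq> {1..U}" "set ?D \<subseteq> {1..U} - ?C" using rng[OF k] dist[OF k] D by auto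
      ultimately have "card ({1..U} - ?C - set ?D) = U - n - s" by (simp add: card_Diff_subset)
      then show ?thesis using \<open>card ?C = n\<close> by (simp add: card_cartesian_product card_dlists)
    qed
    finally show "real (card (Pa ` ?W)) \<le> real (ffact (U - n - s) (tm i) * fact n)"
      using of_nat_le_iff by blast
  qed
  then show ?thesis by simp
qed

text \<open>Both runs have the same past and the same final set, so a resampled key that the first
  run does not insert in this interval is inserted by it later in the block.\<close>

lemma fresh_in_rest:
  assumes "om \<in> cp.pairs"
  shows "set (Xp om) - set (Xi i (fst om)) \<subseteq> set (drop (n + tm (Suc i)) (fst om))"
proof -
  have k: "fst om \<in> Om" using pairsD(1)[OF assms] .
  have "set (past (Suc i) (fst om)) = set (past i (fst om)) \<union> set (Xi i (fst om))"
    using past_split[OF k i_q(1)] by simp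
  then show ?thesis using Xp_props[OF assms] new_keys[OF k i_q(2)] by auto
qed

lemma dd_le: "om \<in> cp.pairs \<Longrightarrow> dd om \<le> mrest"
  using card_mono[OF _ fresh_in_rest, of om] card_new[OF pairsD(1) i_q(2), of om] by (simp add: dd_def mrest_def)

lemma dd_le_s: "om \<in> cp.pairs \<Longrightarrow> dd om \<le> s"
  using Xp_props[of om] card_mono[of "set (Xp om)" "set (Xp om) - set (Xi i (fst om))"]
  by (simp add: dd_def distinct_card)

text \<open>The refund for \<open>Xp\<close>: it reveals \<open>dd om\<close> of the keys still to
  come, and by \<open>choose_ratio\<close> each of them saves
  \<open>log (Urest / mrest)\<close>.\<close>

lemma ent_Tp: "cp.c.cond_ent Tp (\<lambda>om. (Pa om, Xp om)) \<le>
   log 2 (real (Urest choose mrest)) - log 2 (real Urest / real mrest) * cp.c.ex (\<lambda>om. real (dd om))"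
proof -
  have "cp.c.cond_ent Tp (\<lambda>om. (Pa om, Xp om)) \<le> cp.c.ex (\<lambda>om. log 2 (real ((Urest - dd om) choose (mrest - dd om))))"
  proof (rule cp.c.cond_ent_card)
    fix om assume w: "om \<in> cp.pairs"
    let ?W = "{om' \<in> cp.pairs. (Pa om', Xp om') = (Pa om, Xp om)}"
    let ?Y = "set (Xp om) - set (Xi i (fst om))" and ?B = "{1..U} - set (Pa om)"
    let ?F = "{Z. Z \<subseteq> ?B - ?Y \<and> card Z = mrest - dd om}"
    have new: "set (drop (n + tm (Suc i)) k) \<subseteq> {1..U} - set (past (Suc i) k)" if "k \<in> Om" for k
      using new_keys[OF that i_q(2)] Ts_sub[OF that] by auto
    have k: "fst om \<in> Om" using pairsD(1)[OF w] .
    have cB: "card ?B = Urest"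
      using length_past[OF k i_q(2)] OmD[OF k] set_take_subset[of _ "fst om"]
      by (subst card_Diff_subset) (auto simp: Pa_def Urest_def past_def distinct_card)
    have YB: "?Y \<subseteq> ?B" using fresh_in_rest[OF w] new[OF k] by (auto simp: Pa_def)
    have "Tp ` ?W \<subseteq> (\<lambda>Z. set (drop (tm q) (Pa om)) \<union> (?Y \<union> Z)) ` ?F"
    proof
      fix z assume "z \<in> Tp ` ?W"
      then obtain om' where o: "om' \<in> cp.pairs" "Pa om' = Pa om" "Xp om' = Xp om" "z = Tp om'" by auto
      let ?k = "fst om'"
      have k': "?k \<in> Om" using pairsD(1)[OF o(1)] .
      have X: "Xi i ?k = Xi i (fst om)" using Pa_Xi[OF k'] Pa_Xi[OF k] o(2) by (simp add: Pa_def)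
      let ?V = "set (drop (n + tm (Suc i)) ?k)"
      have YV: "?Y \<subseteq> ?V" using fresh_in_rest[OF o(1)] X o(3) by simp
      have "card ?V = mrest" using card_new[OF k' i_q(2)] by (simp add: mrest_def)
      then have "card (?V - ?Y) = mrest - dd om" using YV by (simp add: card_Diff_subset dd_def)
      moreover have "?V - ?Y \<subseteq> ?B - ?Y" using new[OF k'] o(2) by (auto simp: Pa_def)
      ultimately have "?V - ?Y \<in> ?F" by simp
      moreover have "z = set (drop (tm q) (Pa om)) \<union> (?Y \<union> (?V - ?Y))"
        using Ts_split[OF k' i_q(2)] o YV by (auto simp: Tp_def Pa_def)
      ultimately show "z \<in> (\<lambda>Z. set (drop (tm q) (Pa om)) \<union> (?Y \<union> Z)) ` ?F" by blast
    qed
    then have "card (Tp ` ?W) \<le> card ((\<lambda>Z. set (drop (tm q) (Pa om)) \<union> (?Y \<union> Z)) ` ?F)"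
      by (intro card_mono) auto
    also have "\<dots> \<le> card ?F" by (rule card_image_le) auto
    also have "\<dots> = (Urest - dd om) choose (mrest - dd om)"
      using cB YB by (simp add: n_subsets card_Diff_subset dd_def)
    finally show "real (card (Tp ` ?W)) \<le> real ((Urest - dd om) choose (mrest - dd om))" by simp
  qed
  also have "\<dots> \<le> cp.c.ex (\<lambda>om. log 2 (real (Urest choose mrest)) - log 2 (real Urest / real mrest) * real (dd om))"
  proof (rule cp.c.ex_mono)
    fix om assume w: "om \<in> cp.pairs"
    let ?d = "dd om" and ?c = "(Urest - dd om) choose (mrest - dd om)"
    have c: "?c > 0" using Urest_ge dd_le[OF w] by simp
    have U0: "real Urest > 0" using Urest_ge n0 by simp
    have m0: "real mrest > 0" using mrest_pos by simp
    have "log 2 (real ?c * real Urest ^ ?d) \<le> log 2 (real (Urest choose mrest) * real mrest ^ ?d)"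
      using choose_ratio[OF dd_le[OF w] Urest_ge(4)] c U0 m0 Urest_ge(4) by (subst log_le_cancel_iff) auto
    then show "log 2 (real ?c) \<le> log 2 (real (Urest choose mrest)) - log 2 (real Urest / real mrest) * real ?d"
      using c U0 m0 Urest_ge(4) by (simp add: log_mult log_nat_power log_divide algebra_simps)
  qed
  also have "\<dots> = log 2 (real (Urest choose mrest)) - log 2 (real Urest / real mrest) * cp.c.ex (\<lambda>om. real (dd om))"
    by (simp add: cp.c.ex_diff cp.c.ex_const cp.c.ex_cmult)
  finally show ?thesis .
qed

definition EP :: real where "EP = v.ex (\<lambda>k. real (card (Pi i k)))"
definition EF :: real where "EF = v.ex (\<lambda>k. real (card (Fi i k)))"
definition Ed :: real where "Ed = cp.c.ex (\<lambda>om. real (dd om))"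

text \<open>The description consists of \<open>hybrid\<close>, \<open>Xp\<close>, \<open>Pp\<close>,
  \<open>Dp\<close>, \<open>Mn\<close>, \<open>Pa\<close> and \<open>Tp\<close> in this order. A
  component may be coded given earlier ones, and the bounds are the summands.\<close>

lemma ent_upper:
  fixes x :: real
  assumes "0 < x" "x \<le> 1 / 2"
  shows "cp.c.cond_ent (\<lambda>om. ((Pa om, Tp om), Xp om)) (\<lambda>_. ()) \<le>
     real (S * w) + real s * log 2 (real U) + (EP * log 2 (1 / x) + 3 * x * S) + real s * log 2 (real n)
     + (2 * EP + 2 * (w + 1) * EF) + log 2 (real (ffact (U - n - s) (tm i)) * fact n)
     + (log 2 (real (Urest choose mrest)) - log 2 (real Urest / real mrest) * Ed)"
proof -
  let ?b2 = "real (S * w) + real s * log 2 (real U)"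
  let ?b3 = "EP * log 2 (1 / x) + 3 * x * S"
  let ?b5 = "2 * EP + 2 * (w + 1) * EF"
  let ?b6 = "log 2 (real (ffact (U - n - s) (tm i)) * fact n)"
  let ?t2 = "\<lambda>om. (hybrid om, Xp om)"
  let ?t3 = "\<lambda>om. (?t2 om, Pp om)"
  let ?t4 = "\<lambda>om. (?t3 om, Dp om)"
  let ?t5 = "\<lambda>om. (?t4 om, Mn om)"
  let ?t6 = "\<lambda>om. (?t5 om, Pa om)"
  let ?t7 = "\<lambda>om. (?t6 om, Tp om)"
  have P: "cp.c.ex (\<lambda>om. real (card (Pp om)) * y) = EP * y" for y
    using cp.ex_snd[of "\<lambda>k. real (card (Pi i k)) * y"] cp.c.ex_cmult[of y "\<lambda>om. real (card (Pi i (snd om)))"]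
      cp.ex_snd[of "\<lambda>k. real (card (Pi i k))"]
    by (simp add: Pp_def EP_def mult.commute)
  have F: "cp.c.ex (\<lambda>om. 2 * card (Pp om) + (w + 1) * (card (Fi i (fst om)) + card (Fi i (snd om))))
      = 2 * EP + 2 * (w + 1) * EF"
  proof -
    have "cp.c.ex (\<lambda>om. 2 * card (Pp om) + (w + 1) * (card (Fi i (fst om)) + card (Fi i (snd om))))
      = cp.c.ex (\<lambda>om. real (card (Pp om)) * 2 + (real (w + 1) * real (card (Fi i (fst om))) + real (w + 1) * real (card (Fi i (snd om)))))"
      by (simp add: algebra_simps)
    also have "\<dots> = EP * 2 + (real (w + 1) * EF + real (w + 1) * EF)"
      unfolding cp.c.ex_add P cp.c.ex_cmult
      using cp.ex_fst[of "\<lambda>k. real (card (Fi i k))"] cp.ex_snd[of "\<lambda>k. real (card (Fi i k))"] by (simp add: EF_def)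
    finally show ?thesis by (simp add: algebra_simps)
  qed
  have 2: "cp.c.cond_ent ?t2 (\<lambda>_. ()) \<le> ?b2"
    by (rule cp.c.ent_pair_le[OF ent_hybrid ent_Xp[of "\<lambda>_. ()"]]) simp
  have "cp.c.cond_ent Pp (\<lambda>_. ()) \<le> EP * log 2 (1 / x) + 3 * x * S" using ent_Pp[OF assms] unfolding P .
  from cp.c.ent_pair_le[OF 2 this] have 3: "cp.c.cond_ent ?t3 (\<lambda>_. ()) \<le> ?b2 + ?b3"
    by simp
  have 4: "cp.c.cond_ent ?t4 (\<lambda>_. ()) \<le> ?b2 + ?b3 + real s * log 2 (real n)"
    by (rule cp.c.ent_pair_le[OF 3 ent_Dp]) simp
  have 5: "cp.c.cond_ent ?t5 (\<lambda>_. ()) \<le> ?b2 + ?b3 + real s * log 2 (real n)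
      + ?b5"
    by (rule cp.c.ent_pair_le[OF 4 ent_Mn[unfolded F]]) simp
  have 6: "cp.c.cond_ent ?t6 (\<lambda>_. ()) \<le> ?b2 + ?b3 + real s * log 2 (real n)
      + ?b5 + ?b6"
    by (rule cp.c.ent_pair_le[OF 5 ent_Pa]) simp
  have 7: "cp.c.cond_ent ?t7 (\<lambda>_. ()) \<le> ?b2 + ?b3 + real s * log 2 (real n)
      + ?b5 + ?b6
      + (log 2 (real (Urest choose mrest)) - log 2 (real Urest / real mrest) * Ed)"
    unfolding Ed_def by (rule cp.c.ent_pair_le[OF 6 ent_Tp]) simp
  have "cp.c.cond_ent (\<lambda>om. ((Pa om, Tp om), Xp om)) (\<lambda>_. ()) \<le> cp.c.cond_ent ?t7 (\<lambda>_. ())"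
    by (rule cp.c.cond_ent_fun_mono) auto
  then show ?thesis using 7 by linarith
qed

text \<open>Given the entire first run, the resampled keys are a fresh sample from the fibre;
  knowing only a part of that run cannot lower their entropy.\<close>

lemma ent_fresh: "cp.c.cond_ent Xp (\<lambda>om. (Pa om, Tp om)) \<ge> key_ent i"
proof -
  have "key_ent i = v.cond_ent (Xi i) (\<lambda>k. (past i k, Em k))"
    unfolding key_ent_def
  proof (rule v.cond_ent_cong)
    fix k k' assume *: "k \<in> Om" "k' \<in> Om" "(past i k', Em k') = (past i k, Em k)"
    show "past (Suc i) k' = past (Suc i) k \<longleftrightarrow> Xi i k' = Xi i k"
      using past_split[OF *(1) i_q(1)] past_split[OF *(2) i_q(1)] *(3) by simp
  qed simp
  also have "\<dots> = cp.c.cond_ent Xp fst" unfolding Xp_def by (rule cp.cond_ent_snd[symmetric])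
  also have "\<dots> \<le> cp.c.cond_ent Xp (\<lambda>om. (Pa om, Tp om))"
    by (rule cp.c.cond_ent_cond_mono) (simp add: Pa_def Tp_def)
  finally show ?thesis .
qed

text \<open>From the first key list, \<open>Pa\<close> and \<open>Tp\<close> lose only the order of
  the \<open>mrest\<close> later keys; the resampled keys then add \<open>key_ent i\<close>.\<close>

lemma ent_lower:
  "cp.c.cond_ent (\<lambda>om. ((Pa om, Tp om), Xp om)) (\<lambda>_. ()) \<ge>
    log 2 (ffact U (n + tm q)) - log 2 (fact mrest) + key_ent i"
proof -
  have "cp.c.cond_ent (\<lambda>om. ((Pa om, Tp om), Xp om)) (\<lambda>_. ())
     = cp.c.cond_ent (\<lambda>om. (Pa om, Tp om)) (\<lambda>_. ()) + cp.c.cond_ent Xp (\<lambda>om. ((), (Pa om, Tp om)))"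
    by (rule cp.c.cond_ent_chain)
  moreover have "cp.c.cond_ent Xp (\<lambda>om. ((), (Pa om, Tp om))) = cp.c.cond_ent Xp (\<lambda>om. (Pa om, Tp om))"
    by (rule cp.c.cond_ent_cong) auto
  moreover have "cp.c.cond_ent (\<lambda>om. (Pa om, Tp om)) (\<lambda>_. ()) = v.cond_ent (\<lambda>k. (past (Suc i) k, Ts k)) (\<lambda>_. ())"
    using cp.cond_ent_fst[of "\<lambda>k. (past (Suc i) k, Ts k)" "\<lambda>_. ()"] by (simp add: Pa_def Tp_def)
  moreover have "v.cond_ent (\<lambda>k. k) (\<lambda>_. ()) = v.cond_ent (\<lambda>k. (past (Suc i) k, Ts k)) (\<lambda>_. ())
     + v.cond_ent (\<lambda>k. k) (\<lambda>k. ((), (past (Suc i) k, Ts k)))"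
    by (rule cond_ent_split)
  moreover have "v.cond_ent (\<lambda>k. k) (\<lambda>k. ((), (past (Suc i) k, Ts k))) = v.cond_ent (\<lambda>k. k) (\<lambda>k. (past (Suc i) k, Ts k))"
    by (rule v.cond_ent_cong) auto
  ultimately show ?thesis
    using ent_fresh cond_ent_id_const cond_ent_id_past_T[OF i_q(2)] by (simp add: mrest_def)
qed

text \<open>Code a resampled key by a mixture, half uniform on the \<open>s\<close> keys that the
  first run inserts in the interval and half uniform on all candidates. A repeated key saves
  \<open>log (q - i)\<close>. As the entropy is nearly maximal, repetitions must be rare.\<close>

lemma collisions:
  "(real s - Ed) * log 2 (real (q - i)) \<le> 2 * real s + deficit i"
proof -
  define a where "a = (q - i) * s"
  have a: "a > 0" "2 * s \<le> a" using i_lt s0 by (auto simp: a_def intro: mult_le_mono1)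
  \<comment> \<open>The first component of \<open>u\<close> is \<open>Pa\<close>; its tail consists
    of the keys that the first run inserts in this interval.\<close>
  define \<nu> where "\<nu> u z = (if z \<in> set (drop (n + tm i) (fst u)) then 1 / (2 * real s) else 0) + 1 / (2 * real a)"
    for u :: "nat list \<times> nat set" and z :: nat
  define \<mu> where "\<mu> u x = prod_list (map (\<nu> u) x)" for u x
  have npos: "\<nu> u z > 0" for u z using a s0 by (auto simp: \<nu>_def intro!: add_nonneg_pos add_pos_pos)
  have mpos: "\<mu> u x > 0" for u x unfolding \<mu>_def using npos by (induction x) auto
  let ?g = "\<lambda>om. (Pa om, Tp om)"
  have "key_ent i \<le> cp.c.cond_ent Xp ?g" by (rule ent_fresh)
  also have "\<dots> \<le> cp.c.ex (\<lambda>om. log 2 (1 / \<mu> (?g om) (Xp om)))"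
  proof (rule cp.c.gibbs)
    fix om assume w: "om \<in> cp.pairs"
    show "\<mu> (?g om) (Xp om) > 0" by (rule mpos)
    let ?Z = "Ts (fst om) - set (past i (fst om))"
    have k: "fst om \<in> Om" using pairsD(1)[OF w] .
    have f: "finite ?Z" by (simp add: Ts_def)
    have cZ: "card ?Z = a" using card_new[OF k i_q(3)] new_keys[OF k i_q(3)] by (simp add: a_def)
    have sub: "Xp ` {om' \<in> cp.pairs. ?g om' = ?g om} \<subseteq> {x. set x \<subseteq> ?Z \<and> length x = s}"
    proof
      fix x assume "x \<in> Xp ` {om' \<in> cp.pairs. ?g om' = ?g om}"
      then obtain om' where o: "om' \<in> cp.pairs" "Pa om' = Pa om" "Tp om' = Tp om" "x = Xp om'" by auto
      have "past i (fst om') = past i (fst om)"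
        using past_det[of i "Suc i" "fst om'" "fst om"] o(2) by (simp add: Pa_def)
      then show "x \<in> {x. set x \<subseteq> ?Z \<and> length x = s}" using Xp_props[OF o(1)] o(3,4) by (simp add: Tp_def)
    qed
    have "(\<Sum>x\<in>Xp ` {om' \<in> cp.pairs. ?g om' = ?g om}. \<mu> (?g om) x) \<le> (\<Sum>x\<in>{x. set x \<subseteq> ?Z \<and> length x = s}. \<mu> (?g om) x)"
      using sub mpos f by (intro sum_mono2 finite_lists_length_eq) (auto intro: less_imp_le)
    also have "\<dots> = (\<Sum>z\<in>?Z. \<nu> (?g om) z) ^ s" unfolding \<mu>_def by (rule sum_lists_prod[OF f])
    also have "\<dots> \<le> 1"
    proof (rule power_le_one)
      show "0 \<le> (\<Sum>z\<in>?Z. \<nu> (?g om) z)" using npos by (intro sum_nonneg less_imp_le)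
      have "(\<Sum>z\<in>?Z. \<nu> (?g om) z) = real (card (?Z \<inter> set (Xi i (fst om)))) / (2 * real s) + 1 / 2"
        using cZ a f Pa_Xi[OF k] by (simp add: \<nu>_def sum.distrib sum.If_cases Pa_def)
      also have "\<dots> \<le> real s / (2 * real s) + 1 / 2"
      proof (intro add_right_mono divide_right_mono)
        have "card (?Z \<inter> set (Xi i (fst om))) \<le> card (set (Xi i (fst om)))" by (intro card_mono) auto
        also have "\<dots> = s" using set_Xi_sub[OF k i_q(1)] by (simp add: distinct_card)
        finally show "real (card (?Z \<inter> set (Xi i (fst om)))) \<le> real s" by simp
      qed simp
      also have "\<dots> = 1" using s0 by simp
      finally show "(\<Sum>z\<in>?Z. \<nu> (?g om) z) \<le> 1" .
    qed
    finally show "(\<Sum>x\<in>Xp ` {om' \<in> cp.pairs. ?g om' = ?g om}. \<mu> (?g om) x) \<le> 1" .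
  qed
  also have "\<dots> \<le> cp.c.ex (\<lambda>om. (real s * (1 + log 2 s)) + log 2 (real (q - i)) * real (dd om))"
  proof (rule cp.c.ex_mono)
    fix om assume w: "om \<in> cp.pairs"
    let ?X = "set (Xi i (fst om))"
    have k: "fst om \<in> Om" using pairsD(1)[OF w] .
    note xp = Xp_props[OF w]
    have lg: "log 2 (1 / \<mu> u x) = sum_list (map (\<lambda>z. log 2 (1 / \<nu> u z)) x)" for u x
    proof (induction x)
      case (Cons z x)
      have "1 / \<mu> u (z # x) = (1 / \<nu> u z) * (1 / \<mu> u x)" by (simp add: \<mu>_def)
      moreover have "log 2 ((1 / \<nu> u z) * (1 / \<mu> u x)) = log 2 (1 / \<nu> u z) + log 2 (1 / \<mu> u x)"
        by (rule log_mult_pos) (simp_all add: npos mpos)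
      ultimately show ?case using Cons by simp
    qed (simp add: \<mu>_def)
    have "log 2 (1 / \<mu> (?g om) (Xp om)) = (\<Sum>z\<in>set (Xp om). log 2 (1 / \<nu> (?g om) z))"
      unfolding lg using xp by (simp add: sum_list_distinct_conv_sum_set)
    also have "\<dots> \<le> (\<Sum>z\<in>set (Xp om). (1 + log 2 s) + (if z \<in> - ?X then log 2 (real (q - i)) else 0))"
    proof (rule sum_mono)
      fix z assume z: "z \<in> set (Xp om)"
      have b: "log 2 (1 / \<nu> (?g om) z) \<le> 1 + log 2 y" if "\<nu> (?g om) z \<ge> 1 / (2 * y)" "y > 0" for y
      proof -
        have "1 / \<nu> (?g om) z \<le> 2 * y" using that npos[of "?g om" z] by (simp add: field_simps)
        then have "log 2 (1 / \<nu> (?g om) z) \<le> log 2 (2 * y)" using npos that by (subst log_le_cancel_iff) auto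
        then show ?thesis using that by (simp add: log_mult)
      qed
      show "log 2 (1 / \<nu> (?g om) z) \<le> (1 + log 2 s) + (if z \<in> - ?X then log 2 (real (q - i)) else 0)"
      proof (cases "z \<in> ?X")
        case True
        have "\<nu> (?g om) z \<ge> 1 / (2 * real s)" using True Pa_Xi[OF k] by (simp add: \<nu>_def Pa_def)
        from b[OF this] True s0 show ?thesis by simp
      next
        case False
        have "\<nu> (?g om) z \<ge> 1 / (2 * real a)" by (simp add: \<nu>_def)
        from b[OF this] have "log 2 (1 / \<nu> (?g om) z) \<le> 1 + log 2 (real a)" using a by simp
        also have "log 2 (real a) = log 2 (real (q - i)) + log 2 s" using s0 i_q by (simp add: a_def log_mult)
        finally show ?thesis using False by simp
      qed
    qed
    also have "\<dots> = real s * (1 + log 2 s) + log 2 (real (q - i)) * real (dd om)"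
      using xp by (simp add: sum.distrib sum.If_cases dd_def distinct_card Diff_eq del: Compl_iff)
    finally show "log 2 (1 / \<mu> (?g om) (Xp om)) \<le> real s * (1 + log 2 s) + log 2 (real (q - i)) * real (dd om)" .
  qed
  also have "\<dots> = real s * (1 + log 2 s) + log 2 (real (q - i)) * Ed"
    unfolding cp.c.ex_add cp.c.ex_cmult cp.c.ex_const Ed_def ..
  finally have 1: "key_ent i \<le> real s * (1 + log 2 s) + log 2 (real (q - i)) * Ed" .
  have "log 2 (ffact a s) \<ge> log 2 ((real a / 2) ^ s)"
    using ffact_ge[OF a(2)] a by (subst log_le_cancel_iff) (auto intro!: ffact_pos)
  also have "log 2 ((real a / 2) ^ s) = real s * (log 2 (real (q - i)) + log 2 s - 1)"
    using a s0 i_q by (simp add: log_nat_power log_divide log_mult a_def)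
  finally have "key_ent i \<ge> real s * (log 2 (real (q - i)) + log 2 s - 1) - deficit i"
    by (simp add: deficit_def a_def)
  with 1 show ?thesis by (simp add: algebra_simps)
qed

end

section \<open>The block inequality\<close>

context block_i
begin

lemma key_ent_ge: "key_ent i \<ge> real s * (log 2 (real ((q - i) * s)) - 1) - deficit i"
proof -
  let ?a = "(q - i) * s"
  have a: "?a > 0" "2 * s \<le> ?a" using i_lt s0 by (auto intro: mult_le_mono1)
  have "real s * (log 2 (real ?a) - 1) = log 2 ((real ?a / 2) ^ s)"
    using a by (simp only: log_nat_power) (simp add: log_divide)
  also have "\<dots> \<le> log 2 (ffact ?a s)"
    using ffact_ge[OF a(2)] a by (subst log_le_cancel_iff) (auto intro!: ffact_pos)
  finally show ?thesis by (simp add: deficit_def)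
qed

lemma Ed_bounds: "0 \<le> Ed" "Ed \<le> real s"
proof -
  have "cp.c.ex (\<lambda>_. 0) \<le> Ed" unfolding Ed_def by (rule cp.c.ex_mono) simp
  then show "0 \<le> Ed" by (simp add: cp.c.ex_const)
  have "Ed \<le> cp.c.ex (\<lambda>_. real s)" unfolding Ed_def by (rule cp.c.ex_mono) (simp add: dd_le_s)
  then show "Ed \<le> real s" by (simp add: cp.c.ex_const)
qed

text \<open>The number of key lists factors into the stored keys, the \<open>s\<close> keys deleted
  in the interval, those deleted before it, and the later keys. All factors but
  \<open>ffact (U - n) s\<close> cancel against the bounds of \<open>ent_upper\<close>.\<close>

lemma interval_raw:
  fixes x :: real
  assumes "0 < x" "x \<le> 1 / 2"
  shows "log 2 (real (ffact (U - n) s)) + key_ent i + log 2 (real Urest / real mrest) * Ed \<le>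
    redund + real s * log 2 (real U) + EP * (2 + log 2 (1 / x)) + 3 * x * S + real s * log 2 (real n) + 2 * (w + 1) * EF"
proof -
  have tq: "n + tm q = n + (s + (tm i + mrest))"
  proof -
    have "mrest = tm q - tm (Suc i)" using tm_diff[of "Suc i"] i_q by (simp add: mrest_def)
    then show ?thesis using tmS tm_Suc[of i] by simp
  qed
  have Ur: "U - n - s - tm i = Urest" by (simp add: Urest_def tm_Suc)
  have t: "tm i + s \<le> n" using tm_le[OF i_q(2)] by (simp add: tm_Suc)
  have "ffact U (n + tm q) = (U choose n) * fact n * (ffact (U - n) s * (ffact (U - n - s) (tm i) * ((Urest choose mrest) * fact mrest)))"
    unfolding tq ffact_add Ur using U4 Urest_ge(4) by (simp add: ffact_choose)
  moreover have "real (U choose n) > 0" "real (ffact (U - n) s) > 0" "real (ffact (U - n - s) (tm i)) > 0" "real (Urest choose mrest) > 0"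
    using U4 Urest_ge(4) t by (auto intro!: ffact_pos)
  ultimately have "log 2 (ffact U (n + tm q)) = log 2 (real (U choose n)) + log 2 (fact n) + (log 2 (ffact (U - n) s)
      + (log 2 (ffact (U - n - s) (tm i)) + (log 2 (Urest choose mrest) + log 2 (fact mrest))))"
    and "log 2 (real (ffact (U - n - s) (tm i)) * fact n) = log 2 (ffact (U - n - s) (tm i)) + log 2 (fact n)"
    by (simp_all add: log_mult)
  then show ?thesis
    using order_trans[OF ent_lower ent_upper[OF assms]] unfolding redund_def by (simp add: algebra_simps)
qed

text \<open>The deleted keys contribute \<open>s * log U\<close>. Up to lower order,
  \<open>key_ent i\<close> and the refund add up to another \<open>s * log U\<close>, which cancels
  the cost of \<open>Xp\<close>. Repeated keys lose at most \<open>log U\<close> each, and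
  \<open>collisions\<close> bounds their number.\<close>

lemma interval_ineq:
  fixes x lam :: real
  assumes x: "0 < x" "x \<le> 1 / 2" and lam: "0 < lam" "lam \<le> log 2 (real (q - i))"
  shows "real s * (log 2 (real U) - log 2 (real n)) \<le> redund + 4 * real s + deficit i
    + (2 * real s + deficit i) * log 2 (real U) / lam + EP * (2 + log 2 (1 / x)) + 3 * x * S + 2 * (w + 1) * EF"
proof -
  define L where "L = log 2 (real U)"
  define a where "a = (q - i) * s"
  define c where "c = real s - Ed"
  have U0: "real U > 0" using U4 n0 by simp
  have U2: "real U \<ge> 2" using U4 n0 by simp
  have L0: "L \<ge> 0" using U2 by (simp add: L_def)
  have a0: "a > 0" "mrest \<le> a" using i_lt s0 by (auto simp: a_def mrest_def)
  have i0: "deficit i \<ge> 0" using deficit_nonneg i_q by simp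
  have c0: "0 \<le> c" "c \<le> real s" using Ed_bounds by (auto simp: c_def)
  have sn: "s \<le> n" using tm_le[OF i_q(2)] tm_Suc[of i] by simp
  have f: "log 2 (real (ffact (U - n) s)) \<ge> real s * (L - 2)"
  proof -
    have "log 2 (4::real) = 2" using log_pow_cancel[of "2::real" 2] by simp
    then have "real s * (L - 2) = log 2 ((real U / 4) ^ s)"
      using U0 by (simp add: log_nat_power log_divide L_def)
    also have "\<dots> \<le> log 2 ((real (U - n) / 2) ^ s)"
      using U4 n0 by (subst log_le_cancel_iff) (auto intro!: power_mono simp: of_nat_diff)
    also have "\<dots> \<le> log 2 (real (ffact (U - n) s))"
      using ffact_ge[of s "U - n"] U4 n0 sn by (subst log_le_cancel_iff) (auto intro!: ffact_pos)
    finally show ?thesis .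
  qed
  have r: "log 2 (real Urest / real mrest) \<ge> L - 1 - log 2 (real a)"
  proof -
    have "L - 1 - log 2 (real a) = log 2 (real U / 2 / real a)"
      using U0 a0 by (simp add: L_def log_divide log_mult)
    also have "\<dots> \<le> log 2 (real Urest / real mrest)"
    proof -
      have "real U / 2 / real a \<le> real Urest / real mrest"
        using Urest_ge(2) a0 mrest_pos by (intro frac_le) auto
      then show ?thesis using U0 a0 Urest_ge(4) mrest_pos by (subst log_le_cancel_iff) auto
    qed
    finally show ?thesis .
  qed
  have la: "log 2 (real a) \<ge> 0" using a0 by simp
  have "log 2 (real Urest / real mrest) * Ed \<ge> (L - 1 - log 2 (real a)) * (real s - c)"
    using r Ed_bounds by (simp add: c_def mult_right_mono)
  then have E: "log 2 (real Urest / real mrest) * Ed \<ge> real s * (L - 1 - log 2 (real a)) - c * L + c * (1 + log 2 (real a))"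
    by (simp add: algebra_simps)
  have cpos: "c * (1 + log 2 (real a)) \<ge> 0" using c0 la by simp
  have "c * lam \<le> c * log 2 (real (q - i))" using c0 lam by (intro mult_left_mono) auto
  also have "\<dots> \<le> 2 * real s + deficit i" using collisions by (simp add: c_def)
  finally have "c \<le> (2 * real s + deficit i) / lam" using lam by (simp add: field_simps)
  then have cL: "c * L \<le> (2 * real s + deficit i) * L / lam" using L0 by (simp add: mult_right_mono flip: times_divide_eq_left)
  have "real s * (L - 2) + (real s * (log 2 (real a) - 1) - deficit i) + (real s * (L - 1 - log 2 (real a)) - (2 * real s + deficit i) * L / lam)
     \<le> redund + real s * L + EP * (2 + log 2 (1 / x)) + 3 * x * S + real s * log 2 (real n) + 2 * (w + 1) * EF"
    using interval_raw[OF x] f key_ent_ge E cpos cL unfolding L_def[symmetric] a_def[symmetric] by linarith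
  then show ?thesis unfolding L_def[symmetric] by (simp add: algebra_simps)
qed

end

context block
begin

text \<open>Only the first half of the intervals is summed, where \<open>q - i \<ge> h\<close>
  permits one bound \<open>log h\<close> for all of them.\<close>

lemma block_ineq:
  fixes x :: real
  assumes x: "0 < x" "x \<le> 1 / 2" and q: "q = 2 * h" "h \<ge> 2"
  shows "real h * real s * (log 2 (real U) - log 2 (real n)) \<le> real h * redund + 4 * real h * real s + redund
    + (2 * real h * real s + redund) * log 2 (real U) / log 2 (real h)
    + (2 + log 2 (1 / x)) * (\<Sum>i<h. v.ex (\<lambda>k. real (card (Pi i k)))) + 3 * x * S * real h
    + 2 * (w + 1) * (\<Sum>i<h. v.ex (\<lambda>k. real (card (Fi i k))))"
proof -
  let ?L = "log 2 (real U)" and ?l = "log 2 (real h)"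
  have l0: "?l > 0" using q by simp
  have L0: "?L \<ge> 0" using U4 n0 by simp
  have one: "real s * (?L - log 2 (real n)) \<le> redund + 4 * real s + deficit i
    + (2 * real s + deficit i) * ?L / ?l + v.ex (\<lambda>k. real (card (Pi i k))) * (2 + log 2 (1 / x)) + 3 * x * S
    + 2 * (w + 1) * v.ex (\<lambda>k. real (card (Fi i k)))" if i: "i < h" for i
  proof -
    interpret b: block_i n U S w A m0 st s q i using i q by unfold_locales simp
    have "?l \<le> log 2 (real (q - i))" using i q by (subst log_le_cancel_iff) auto
    from b.interval_ineq[OF x l0 this] show ?thesis unfolding b.EP_def b.EF_def .
  qed
  have io: "(\<Sum>i<h. deficit i) \<le> redund"
  proof -
    have "(\<Sum>i<h. deficit i) \<le> (\<Sum>i<q. deficit i)" using q deficit_nonneg by (intro sum_mono2) auto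
    then show ?thesis using sum_deficit by simp
  qed
  define K where "K = ?L / ?l"
  have "(\<Sum>i<h. real s * (?L - log 2 (real n))) \<le> (\<Sum>i<h. redund + 4 * real s + deficit i
    + (2 * real s + deficit i) * K + v.ex (\<lambda>k. real (card (Pi i k))) * (2 + log 2 (1 / x)) + 3 * x * S
    + 2 * (w + 1) * v.ex (\<lambda>k. real (card (Fi i k))))"
    by (rule sum_mono) (use one in \<open>auto simp: K_def\<close>)
  also have "\<dots> = real h * redund + 4 * real h * real s + (\<Sum>i<h. deficit i)
    + (2 * real h * real s + (\<Sum>i<h. deficit i)) * K
    + (2 + log 2 (1 / x)) * (\<Sum>i<h. v.ex (\<lambda>k. real (card (Pi i k)))) + 3 * x * S * real h
    + 2 * (w + 1) * (\<Sum>i<h. v.ex (\<lambda>k. real (card (Fi i k))))"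
    by (simp add: sum.distrib sum_distrib_left sum_distrib_right algebra_simps)
  also have "(2 * real h * real s + (\<Sum>i<h. deficit i)) * K \<le> (2 * real h * real s + redund) * K"
    using io L0 l0 by (intro mult_right_mono) (auto simp: K_def)
  finally show ?thesis using io by (simp add: mult.assoc K_def)
qed

end

section \<open>Charging probes to levels\<close>

text \<open>An incidence between a cell and a time is charged to the unique level at which the next
  access to the cell leaves the interval but not the block.\<close>

definition next_probe :: "(nat \<Rightarrow> nat set) \<Rightarrow> nat \<Rightarrow> nat \<Rightarrow> nat" where
  "next_probe p t c = (LEAST t'. t < t' \<and> c \<in> p t')"

definition charged :: "(nat \<Rightarrow> nat set) \<Rightarrow> nat \<Rightarrow> nat \<Rightarrow> nat \<Rightarrow> (nat \<times> nat) set" where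
  "charged p N s B = {(t, c). t < N \<and> c \<in> p t \<and> next_probe p t c div B = t div B \<and> next_probe p t c div s \<noteq> t div s}"

lemma finite_charged: "(\<And>t. finite (p t)) \<Longrightarrow> finite (charged p N s B)"
  by (rule finite_subset[of _ "SIGMA t:{..<N}. p t"]) (auto simp: charged_def)

text \<open>A revisited cell is mapped to its last probe in the interval. The next probe of that
  cell then lies in a later interval of the same block, as \<open>charged\<close> demands.\<close>

lemma level_count:
  fixes p :: "nat \<Rightarrow> nat set"
  assumes fin: "\<And>t. finite (p t)" and s: "s > 0"
  shows "(\<Sum>b<nb. \<Sum>i<q. card ((\<Union>t\<in>{b * (q * s) + i * s..<b * (q * s) + Suc i * s}. p t)
       \<inter> (\<Union>t\<in>{b * (q * s) + Suc i * s..<b * (q * s) + q * s}. p t))) \<le> card (charged p (nb * (q * s)) s (q * s))"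
proof -
  let ?B = "q * s"
  define F where "F = (\<lambda>(b, i). (\<Union>t\<in>{b * ?B + i * s..<b * ?B + Suc i * s}. p t)
       \<inter> (\<Union>t\<in>{b * ?B + Suc i * s..<b * ?B + ?B}. p t))"
  define I where "I = {..<nb} \<times> {..<q}"
  define lastt where "lastt = (\<lambda>((b, i), c). Max {t \<in> {b * ?B + i * s..<b * ?B + Suc i * s}. c \<in> p t})"
  define f where "f = (\<lambda>x. (lastt x, snd x))"
  have key: "lastt ((b, i), c) \<in> {b * ?B + i * s..<b * ?B + Suc i * s} \<and> c \<in> p (lastt ((b, i), c))
      \<and> next_probe p (lastt ((b, i), c)) c \<in> {b * ?B + Suc i * s..<b * ?B + ?B}"
    if bi: "(b, i) \<in> I" and cF: "c \<in> F (b, i)" for b i c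
  proof -
    let ?T = "{t \<in> {b * ?B + i * s..<b * ?B + Suc i * s}. c \<in> p t}"
    have T: "finite ?T" "?T \<noteq> {}" using cF by (auto simp: F_def)
    have M: "Max ?T \<in> ?T" "\<And>t. t \<in> ?T \<Longrightarrow> t \<le> Max ?T"
      using Max_in[OF T] Max_ge[OF T(1)] by blast+
    obtain t' where t': "t' \<in> {b * ?B + Suc i * s..<b * ?B + ?B}" "c \<in> p t'" using cF by (auto simp: F_def)
    have ex: "Max ?T < t' \<and> c \<in> p t'" using M(1) t' by auto
    have nx1: "Max ?T < next_probe p (Max ?T) c \<and> c \<in> p (next_probe p (Max ?T) c)"
      unfolding next_probe_def by (rule LeastI[where P="\<lambda>t'. Max ?T < t' \<and> c \<in> p t'", OF ex])
    have nx2: "next_probe p (Max ?T) c \<le> t'" unfolding next_probe_def by (rule Least_le[where P="\<lambda>t'. Max ?T < t' \<and> c \<in> p t'", OF ex])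
    have "\<not> next_probe p (Max ?T) c < b * ?B + Suc i * s"
    proof
      assume "next_probe p (Max ?T) c < b * ?B + Suc i * s"
      then have "next_probe p (Max ?T) c \<in> ?T" using nx1 M(1) by auto
      from M(2)[OF this] nx1 show False by linarith
    qed
    moreover have "lastt ((b, i), c) = Max ?T" by (simp add: lastt_def)
    ultimately show ?thesis using M(1) nx2 t' by simp
  qed
  have div_int: "t div s = b * q + i" if "t \<in> {b * ?B + i * s..<b * ?B + Suc i * s}" for t b i
  proof -
    have "(b * q + i) * s \<le> t" "t < Suc (b * q + i) * s" using that by (auto simp: algebra_simps)
    then show ?thesis by (intro div_nat_eqI) (simp_all add: mult.commute)
  qed
  have div_blk: "t div ?B = b" if "t \<in> {b * ?B..<b * ?B + ?B}" for t b
    by (rule div_nat_eqI) (use that in \<open>auto simp: algebra_simps\<close>)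
  have sub: "b * ?B + Suc i * s \<le> b * ?B + ?B" if "i < q" for b i
    using that by (intro add_left_mono mult_le_mono1) simp
  have "inj_on f (Sigma I F)"
  proof (rule inj_onI)
    fix x y assume *: "x \<in> Sigma I F" "y \<in> Sigma I F" "f x = f y"
    obtain b i c where x: "x = ((b, i), c)" by (cases x) auto
    obtain b' i' c' where y: "y = ((b', i'), c')" by (cases y) auto
    note xy = x y
    have iq: "i < q" "i' < q" using * xy by (auto simp: I_def)
    have c: "c = c'" "lastt x = lastt y" using *(3) xy by (auto simp: f_def)
    have m: "(b, i) \<in> I" "c \<in> F (b, i)" "(b', i') \<in> I" "c' \<in> F (b', i')" using * xy by auto
    have "lastt x div s = b * q + i" using key[OF m(1,2)] by (intro div_int) (simp add: x)
    moreover have "lastt y div s = b' * q + i'" using key[OF m(3,4)] by (intro div_int) (simp add: y)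
    ultimately have eq: "b * q + i = b' * q + i'" using c(2) by simp
    moreover have "(b * q + i) div q = b" "(b' * q + i') div q = b'" using iq by simp_all
    ultimately have "b = b'" by simp
    with eq have "b = b' \<and> i = i'" by simp
    then show "x = y" using xy c by simp
  qed
  moreover have "f ` Sigma I F \<subseteq> charged p (nb * ?B) s ?B"
  proof
    fix z assume "z \<in> f ` Sigma I F"
    then obtain b i c where z: "(b, i) \<in> I" "c \<in> F (b, i)" "z = f ((b, i), c)" by auto
    let ?t = "lastt ((b, i), c)"
    note k = key[OF z(1,2)]
    have iq: "i < q" "b < nb" using z(1) by (auto simp: I_def)
    have tb: "?t \<in> {b * ?B..<b * ?B + ?B}" "next_probe p ?t c \<in> {b * ?B..<b * ?B + ?B}"
      using k sub[OF iq(1), of b] by auto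
    have "Suc b * ?B \<le> nb * ?B" using iq by (intro mult_le_mono1) simp
    then have "?t < nb * ?B" using tb by simp
    moreover have "next_probe p ?t c div ?B = ?t div ?B" using div_blk[OF tb(1)] div_blk[OF tb(2)] by simp
    moreover have "next_probe p ?t c div s \<noteq> ?t div s"
    proof -
      have "?t div s = b * q + i" using div_int k by blast
      moreover have "next_probe p ?t c div s \<ge> Suc (b * q + i)"
      proof -
        have "Suc (b * q + i) * s \<le> next_probe p ?t c" using k by (simp add: algebra_simps)
        then show ?thesis using s by (simp add: less_eq_div_iff_mult_less_eq)
      qed
      ultimately show ?thesis by simp
    qed
    ultimately show "z \<in> charged p (nb * ?B) s ?B" using k z(3) by (simp add: f_def charged_def)
  qed
  ultimately have "card (Sigma I F) \<le> card (charged p (nb * ?B) s ?B)"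
    using finite_charged[of p "nb * ?B" s ?B, OF fin] card_image[of f "Sigma I F"]
      card_mono[of "charged p (nb * ?B) s ?B" "f ` Sigma I F"] by simp
  moreover have "card (Sigma I F) = (\<Sum>b<nb. \<Sum>i<q. card (F (b, i)))"
  proof -
    have "card (Sigma I F) = (\<Sum>x\<in>I. card (F x))"
      by (rule card_SigmaI) (auto simp: I_def F_def fin)
    also have "\<dots> = (\<Sum>b<nb. \<Sum>i<q. card (F (b, i)))" unfolding I_def by (simp add: sum.cartesian_product)
    finally show ?thesis .
  qed
  ultimately show ?thesis by (simp add: F_def)
qed

text \<open>Lengths are powers of two, so a next probe in the same block of level \<open>j\<close>
  is also in the same interval of every coarser level. Hence the levels are disjoint, whatever value
  \<open>LEAST\<close> takes when a cell is never probed again.\<close>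

lemma levels_total:
  fixes p :: "nat \<Rightarrow> nat set" and e :: "nat \<Rightarrow> nat"
  assumes fin: "\<And>t. finite (p t)" and inc: "\<And>j. 1 \<le> j \<Longrightarrow> j < m \<Longrightarrow> e j \<le> e (Suc j)"
  shows "(\<Sum>j\<in>{1..<m}. card (charged p N (2 ^ e j) (2 ^ e (Suc j)))) \<le> (\<Sum>t<N. card (p t))"
proof -
  let ?G = "\<lambda>j. charged p N (2 ^ e j) (2 ^ e (Suc j))"
  have mono: "e j \<le> e j'" if "1 \<le> j" "j \<le> j'" "j' \<le> m" for j j'
    using that(2,3,1) by (induction j' rule: dec_induct) (use inc in \<open>force intro: order_trans\<close>)+
  have disj: "?G j \<inter> ?G j' = {}" if "1 \<le> j" "j < j'" "j' < m" for j j'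
  proof -
    have "e (Suc j) \<le> e j'" using mono[of "Suc j" j'] that by simp
    then obtain r where r: "(2::nat) ^ e j' = 2 ^ e (Suc j) * 2 ^ r" by (metis le_iff_add power_add)
    show ?thesis unfolding charged_def by (auto simp: r div_mult2_eq)
  qed
  have "(\<Sum>j\<in>{1..<m}. card (?G j)) = card (\<Union>j\<in>{1..<m}. ?G j)"
  proof (rule card_UN_disjoint[symmetric])
    show "\<forall>i\<in>{1..<m}. \<forall>j\<in>{1..<m}. i \<noteq> j \<longrightarrow> ?G i \<inter> ?G j = {}"
      using disj by (metis atLeastLessThan_iff inf_commute linorder_neqE_nat)
  qed (auto simp: finite_charged fin)
  also have "\<dots> \<le> card (SIGMA t:{..<N}. p t)"
    by (intro card_mono finite_SigmaI) (auto simp: fin charged_def)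
  also have "\<dots> = (\<Sum>t<N. card (p t))" by (rule card_SigmaI) (auto simp: fin)
  finally show ?thesis .
qed

context det_dict
begin

lemma probed_Union: "a \<le> b \<Longrightarrow> n + b \<le> length ks \<Longrightarrow> probed ks a b = (\<Union>t\<in>{a..<b}. probed ks t (Suc t))"
proof (induction b rule: dec_induct)
  case base
  have "Dk ks a a = []" "Dk ks (n + a) (n + a) = []" by (simp_all add: Dk_def)
  then show ?case by (simp add: probed_def)
next
  case (step b)
  have "probed ks a (Suc b) = probed ks a b \<union> probed ks b (Suc b)" using step by (intro probed_split) auto
  then show ?case using step by (auto simp: atLeastLessThanSuc)
qed

definition tot_avg :: "nat \<Rightarrow> real" where
  "tot_avg N = (\<Sum>ks\<in>dlists {1..U} (n + N). real (\<Sum>t<N. card (probed ks t (Suc t)))) / card (dlists {1..U} (n + N))"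

definition lev_avg :: "nat \<Rightarrow> nat \<Rightarrow> nat \<Rightarrow> real" where
  "lev_avg N s B = (\<Sum>ks\<in>dlists {1..U} (n + N). real (card (charged (\<lambda>t. if t < N then probed ks t (Suc t) else {}) N s B)))
     / card (dlists {1..U} (n + N))"

lemma sum_levels_le:
  assumes "\<And>j. 1 \<le> j \<Longrightarrow> j < m \<Longrightarrow> e j \<le> e (Suc j)"
  shows "(\<Sum>j\<in>{1..<m}. lev_avg N (2 ^ e j) (2 ^ e (Suc j))) \<le> tot_avg N"
proof -
  let ?p = "\<lambda>ks t. if t < N then probed ks t (Suc t) else {}"
  have "(\<Sum>j\<in>{1..<m}. real (card (charged (?p ks) N (2 ^ e j) (2 ^ e (Suc j))))) \<le> real (\<Sum>t<N. card (probed ks t (Suc t)))" for ks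
    using levels_total[of "?p ks" m e N] assms by (simp flip: of_nat_sum)
  then have "(\<Sum>ks\<in>dlists {1..U} (n + N). \<Sum>j\<in>{1..<m}. real (card (charged (?p ks) N (2 ^ e j) (2 ^ e (Suc j)))))
     \<le> (\<Sum>ks\<in>dlists {1..U} (n + N). real (\<Sum>t<N. card (probed ks t (Suc t))))"
    by (rule sum_mono)
  then show ?thesis unfolding lev_avg_def tot_avg_def sum_divide_distrib[symmetric]
    by (subst sum.swap) (intro divide_right_mono, auto)
qed

text \<open>The sum of \<open>block_ineq\<close> over the \<open>nb\<close> blocks that tile the
  first \<open>N\<close> updates. Each block works with key lists cut off at its end;
  \<open>avg_dlists_take\<close> passes to lists of the full length \<open>n + N\<close>.\<close>

lemma level_ineq:
  fixes x :: real
  assumes x: "0 < x" "x \<le> 1 / 2" and h: "h \<ge> 2" and s: "s > 0" and N: "N = nb * (2 * h * s)" "N \<le> n" and U4: "4 * n \<le> U"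
  shows "real nb * (real h * real s * (log 2 (real U) - log 2 (real n)))
    \<le> real nb * (real h * (real (S * w) - log 2 (real (U choose n))) + 4 * real h * real s + (real (S * w) - log 2 (real (U choose n)))
       + (2 * real h * real s + (real (S * w) - log 2 (real (U choose n)))) * log 2 (real U) / log 2 (real h) + 3 * x * S * real h)
     + (2 + log 2 (1 / x)) * tot_avg N + 2 * (w + 1) * lev_avg N s (2 * h * s)"
proof -
  let ?q = "2 * h" and ?B = "2 * h * s"
  let ?Om = "dlists {1..U} (n + N)"
  let ?c = "real (card ?Om)"
  let ?TT = "\<lambda>ks. \<Sum>t<N. card (probed ks t (Suc t))"
  let ?p = "\<lambda>ks t. if t < N then probed ks t (Suc t) else {}"
  define redund where "redund = real (S * w) - log 2 (real (U choose n))"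
  define P where "P b i ks = probed ks (b * ?B + i * s) (b * ?B + Suc i * s)" for b i ks
  define F where "F b i ks = P b i ks \<inter> probed ks (b * ?B + Suc i * s) (b * ?B + ?B)" for b i ks
  let ?SP = "\<lambda>b. \<Sum>ks\<in>?Om. \<Sum>i<h. real (card (P b i ks))"
  let ?SF = "\<lambda>b. \<Sum>ks\<in>?Om. \<Sum>i<h. real (card (F b i ks))"
  define K where "K = real h * redund + 4 * real h * real s + redund
       + (2 * real h * real s + redund) * log 2 (real U) / log 2 (real h) + 3 * x * S * real h"
  have blk: "real h * real s * (log 2 (real U) - log 2 (real n)) \<le> K
      + (2 + log 2 (1 / x)) * (?SP b / ?c)
      + 2 * (w + 1) * (?SF b / ?c)" if b: "b < nb" for b
  proof -
    have bN: "b * ?B + ?B \<le> N"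
    proof -
      have "Suc b * ?B \<le> nb * ?B" using b by (intro mult_le_mono1) simp
      then show ?thesis using N by simp
    qed
    interpret B: block n U S w A m0 "b * ?B" s ?q
      using s h bN N U4 by unfold_locales auto
    have len: "n + B.tm ?q \<le> n + N" using bN by (simp add: B.tm_def)
    have cU: "n + N \<le> card {1..U}" using N U4 by simp
    have Pt: "B.Pi i (take (n + B.tm ?q) ks) = P b i ks" if "i < h" for i ks
    proof -
      have "B.tm (Suc i) \<le> B.tm ?q" using that by (intro B.tm_mono) simp
      then show ?thesis unfolding B.Pi_def P_def by (subst probed_take) (auto simp: B.tm_def)
    qed
    have Ft: "B.Fi i (take (n + B.tm ?q) ks) = F b i ks" if "i < h" for i ks
    proof -
      have "B.tm (Suc i) \<le> B.tm ?q" using that by (intro B.tm_mono) simp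
      then have "probed (take (n + B.tm ?q) ks) (B.tm (Suc i)) (B.tm ?q) = probed ks (B.tm (Suc i)) (B.tm ?q)"
        by (intro probed_take) auto
      then show ?thesis unfolding B.Fi_def F_def Pt[OF that] by (simp add: B.tm_def)
    qed
    have ave: "(\<Sum>i<h. B.v.ex (\<lambda>k. real (card (G i k)))) = (\<Sum>ks\<in>?Om. \<Sum>i<h. real (card (G i (take (n + B.tm ?q) ks)))) / ?c" for G
    proof -
      have "(\<Sum>i<h. B.v.ex (\<lambda>k. real (card (G i k)))) = (\<Sum>i<h. (\<Sum>k\<in>B.Om. real (card (G i k))) / card B.Om)"
        by (simp add: B.v.ex_def sum_divide_distrib)
      also have "\<dots> = (\<Sum>i<h. (\<Sum>ks\<in>?Om. real (card (G i (take (n + B.tm ?q) ks)))) / ?c)"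
        unfolding B.Om_def by (intro sum.cong refl avg_dlists_take[symmetric] cU len) simp
      also have "\<dots> = (\<Sum>ks\<in>?Om. \<Sum>i<h. real (card (G i (take (n + B.tm ?q) ks)))) / ?c"
        by (subst sum.swap) (simp add: sum_divide_distrib)
      finally show ?thesis .
    qed
    have Pe: "(\<Sum>i<h. B.v.ex (\<lambda>k. real (card (B.Pi i k)))) = ?SP b / ?c"
      unfolding ave by (intro arg_cong2[where f="(/)"] sum.cong refl) (simp add: Pt)
    have Fe: "(\<Sum>i<h. B.v.ex (\<lambda>k. real (card (B.Fi i k)))) = ?SF b / ?c"
      unfolding ave by (intro arg_cong2[where f="(/)"] sum.cong refl) (simp add: Ft)
    show ?thesis
      using B.block_ineq[OF x refl h] unfolding Pe Fe B.redund_def redund_def[symmetric] K_def by simp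
  qed
  have AP: "(\<Sum>b<nb. ?SP b / ?c) \<le> tot_avg N"
  proof -
    have "(\<Sum>b<nb. \<Sum>i<h. real (card (P b i ks))) \<le> real (?TT ks)" if "ks \<in> ?Om" for ks
    proof -
      have l: "length ks = n + N" using that by (simp add: dlists_def)
      have "(\<Sum>i<h. card (P b i ks)) \<le> (\<Sum>t\<in>{b * ?B..<b * ?B + ?B}. card (probed ks t (Suc t)))" if "b < nb" for b
      proof -
        have bN: "b * ?B + ?B \<le> N"
        proof -
          have "Suc b * ?B \<le> nb * ?B" using that by (intro mult_le_mono1) simp
          then show ?thesis using N by simp
        qed
        have "(\<Sum>i<j. card (P b i ks)) \<le> (\<Sum>t\<in>{b * ?B..<b * ?B + j * s}. card (probed ks t (Suc t)))" if "j \<le> ?q" for j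
          using that
        proof (induction j)
          case (Suc j)
          have le: "b * ?B + Suc j * s \<le> b * ?B + ?B" using Suc.prems by (intro add_left_mono mult_le_mono1) simp
          have "P b j ks = (\<Union>t\<in>{b * ?B + j * s..<b * ?B + Suc j * s}. probed ks t (Suc t))"
            unfolding P_def using le bN l by (intro probed_Union) auto
          then have "card (P b j ks) \<le> (\<Sum>t\<in>{b * ?B + j * s..<b * ?B + Suc j * s}. card (probed ks t (Suc t)))"
            by (simp add: card_UN_le)
          moreover have "{b * ?B..<b * ?B + Suc j * s} = {b * ?B..<b * ?B + j * s} \<union> {b * ?B + j * s..<b * ?B + Suc j * s}"
            by (simp add: ivl_disj_un)
          moreover have "(\<Sum>t\<in>{b * ?B..<b * ?B + j * s} \<union> {b * ?B + j * s..<b * ?B + Suc j * s}. card (probed ks t (Suc t)))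
             = (\<Sum>t\<in>{b * ?B..<b * ?B + j * s}. card (probed ks t (Suc t))) + (\<Sum>t\<in>{b * ?B + j * s..<b * ?B + Suc j * s}. card (probed ks t (Suc t)))"
            by (rule sum.union_disjoint) auto
          ultimately show ?case using Suc by simp
        qed simp
        from this[of ?q] have "(\<Sum>i<?q. card (P b i ks)) \<le> (\<Sum>t\<in>{b * ?B..<b * ?B + ?B}. card (probed ks t (Suc t)))" by simp
        moreover have "(\<Sum>i<h. card (P b i ks)) \<le> (\<Sum>i<?q. card (P b i ks))" by (intro sum_mono2) auto
        ultimately show ?thesis by linarith
      qed
      then have "(\<Sum>b<nb. \<Sum>i<h. card (P b i ks)) \<le> (\<Sum>b<nb. \<Sum>t\<in>{b * ?B..<b * ?B + ?B}. card (probed ks t (Suc t)))"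
        by (intro sum_mono) auto
      also have "\<dots> = (\<Sum>t<nb * ?B. card (probed ks t (Suc t)))"
        using sum.nat_group[of "\<lambda>t. card (probed ks t (Suc t))" ?B nb] by simp
      finally have "(\<Sum>b<nb. \<Sum>i<h. card (P b i ks)) \<le> (?TT ks)" using N(1) by simp
      then show ?thesis by (simp flip: of_nat_sum)
    qed
    then have "(\<Sum>ks\<in>?Om. \<Sum>b<nb. \<Sum>i<h. real (card (P b i ks))) \<le> (\<Sum>ks\<in>?Om. real (?TT ks))"
      by (rule sum_mono)
    then show ?thesis unfolding tot_avg_def sum_divide_distrib[symmetric]
      by (subst sum.swap) (intro divide_right_mono, auto)
  qed
  have AF: "(\<Sum>b<nb. ?SF b / ?c) \<le> lev_avg N s ?B"
  proof -
    have "(\<Sum>b<nb. \<Sum>i<h. real (card (F b i ks))) \<le> real (card (charged (?p ks) N s ?B))"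
      if "ks \<in> ?Om" for ks
    proof -
      have l: "length ks = n + N" using that by (simp add: dlists_def)
            have Fe: "F b i ks = (\<Union>t\<in>{b * ?B + i * s..<b * ?B + Suc i * s}. ?p ks t)
       \<inter> (\<Union>t\<in>{b * ?B + Suc i * s..<b * ?B + ?B}. ?p ks t)" if "b < nb" "i < h" for b i
      proof -
        have "Suc b * ?B \<le> nb * ?B" using that by (intro mult_le_mono1) simp
        then have bN: "b * ?B + ?B \<le> N" using N by simp
        have le: "b * ?B + Suc i * s \<le> b * ?B + ?B" using that by (intro add_left_mono mult_le_mono1) simp
        have "F b i ks = (\<Union>t\<in>{b * ?B + i * s..<b * ?B + Suc i * s}. probed ks t (Suc t))
          \<inter> (\<Union>t\<in>{b * ?B + Suc i * s..<b * ?B + ?B}. probed ks t (Suc t))"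
          unfolding F_def P_def using le bN l probed_Union[of "b * ?B + i * s" "b * ?B + Suc i * s" ks]
            probed_Union[of "b * ?B + Suc i * s" "b * ?B + ?B" ks] by simp
        then show ?thesis using le bN by auto
      qed
      have "(\<Sum>b<nb. \<Sum>i<h. card (F b i ks)) = (\<Sum>b<nb. \<Sum>i<h. card ((\<Union>t\<in>{b * ?B + i * s..<b * ?B + Suc i * s}. ?p ks t)
       \<inter> (\<Union>t\<in>{b * ?B + Suc i * s..<b * ?B + ?B}. ?p ks t)))"
        by (intro sum.cong refl) (use Fe in auto)
      also have "\<dots> \<le> (\<Sum>b<nb. \<Sum>i<?q. card ((\<Union>t\<in>{b * ?B + i * s..<b * ?B + Suc i * s}. ?p ks t)
       \<inter> (\<Union>t\<in>{b * ?B + Suc i * s..<b * ?B + ?B}. ?p ks t)))"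
        by (intro sum_mono sum_mono2) auto
      also have "\<dots> \<le> card (charged (?p ks) N s ?B)"
        using level_count[of "?p ks" s ?q nb] s N(1) by simp
      finally show ?thesis by (simp flip: of_nat_sum)
    qed
    then have "(\<Sum>ks\<in>?Om. \<Sum>b<nb. \<Sum>i<h. real (card (F b i ks))) \<le> (\<Sum>ks\<in>?Om. real (card (charged (?p ks) N s ?B)))"
      by (rule sum_mono)
    then show ?thesis unfolding lev_avg_def sum_divide_distrib[symmetric]
      by (subst sum.swap) (intro divide_right_mono, auto)
  qed
  have lx: "log 2 (1 / x) \<ge> 0" using x by simp
  have "(\<Sum>b<nb. real h * real s * (log 2 (real U) - log 2 (real n))) \<le> (\<Sum>b<nb. K
      + (2 + log 2 (1 / x)) * (?SP b / ?c)
      + 2 * (w + 1) * (?SF b / ?c))"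
    by (rule sum_mono) (use blk in auto)
  also have "\<dots> = real nb * K + (2 + log 2 (1 / x)) * (\<Sum>b<nb. ?SP b / ?c)
     + 2 * (w + 1) * (\<Sum>b<nb. ?SF b / ?c)"
    by (simp add: sum.distrib sum_distrib_left)
  also have "\<dots> \<le> real nb * K + (2 + log 2 (1 / x)) * tot_avg N + 2 * (w + 1) * lev_avg N s ?B"
    using AP AF lx by (intro add_mono mult_left_mono) auto
  finally show ?thesis unfolding K_def redund_def by simp
qed

end

section \<open>Fixing the random string\<close>

text \<open>Countably many actions allow case distinctions in measurability proofs; countably many
  operation sequences allow one null set to be discarded for all of them.\<close>

instance action :: countable by countable_datatype
instance dop :: countable by countable_datatype

abbreviation "cmeas \<equiv> measurable coins (count_space UNIV)"

lemma cmeas_comp: "f \<in> cmeas \<Longrightarrow> (\<lambda>s. F (f s)) \<in> cmeas"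
  by (rule measurable_compose) auto

text \<open>Memories form an uncountable type, so only one cell of the result is observed; with the
  answer and the cost this is a map into a countable type.\<close>

lemma exec_meas:
  assumes "\<And>h. (\<lambda>s. a s h) \<in> cmeas" and "\<And>x. (\<lambda>s. m s x) \<in> cmeas"
  shows "(\<lambda>s. map_option (\<lambda>(m', b, t). (m' x, b, t)) (exec f (a s) (m s) h)) \<in> cmeas"
  using assms(2)
proof (induction f arbitrary: m h)
  case (Suc f)
  define G where "G act = (\<lambda>s. map_option (\<lambda>(m', b, t). (m' x, b, t)) (case act of
      Halt b \<Rightarrow> Some (m s, b, 0)
    | Read y \<Rightarrow> map_option (\<lambda>(m', b, t). (m', b, Suc t)) (exec f (a s) (m s) (h @ [Some (m s y)]))
    | Write y v \<Rightarrow> map_option (\<lambda>(m', b, t). (m', b, Suc t)) (exec f (a s) ((m s)(y := v)) (h @ [None]))))"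
    for act
  let ?F = "map_option (\<lambda>(z :: nat, b :: bool, t). (z, b, Suc t))"
  have com: "map_option (\<lambda>(m', b, t). (m' x, b, t)) (map_option (\<lambda>(m', b, t). (m', b, Suc t)) r)
     = ?F (map_option (\<lambda>(m', b, t). (m' x, b, t)) r)" for r :: "((nat \<Rightarrow> nat) \<times> bool \<times> nat) option"
    by (simp add: option.map_comp comp_def case_prod_beta)
  have "G act \<in> cmeas" for act
  proof (cases act)
    case (Halt b)
    then show ?thesis using cmeas_comp[OF Suc.prems[of x], of "\<lambda>z. Some (z, b, 0::nat)"] by (simp add: G_def)
  next
    case (Read y)
    have "(\<lambda>s. ?F (map_option (\<lambda>(m', b, t). (m' x, b, t)) (exec f (a s) (m s) (h @ [Some v])))) \<in> cmeas" for v
      by (rule cmeas_comp) (rule Suc.IH[OF Suc.prems])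
    from measurable_compose_countable[OF this Suc.prems[of y]]
    show ?thesis unfolding G_def Read action.case com .
  next
    case (Write y v)
    have "(\<lambda>s. ((m s)(y := v)) z) \<in> cmeas" for z using Suc.prems by (cases "z = y") auto
    from cmeas_comp[OF Suc.IH[OF this]]
    show ?thesis unfolding G_def Write action.case com .
  qed
  from measurable_compose_countable[OF this assms(1)[of h]]
  show ?case unfolding G_def exec.simps .
qed simp

lemma run_eq_Some: "run A m = Some r \<longleftrightarrow> (\<exists>f. exec f A m [] = Some r)"
  unfolding run_runp exec_execp by (auto simp: runp_eq_Some)

text \<open>The preimages are countable unions, or for divergence intersections, over the
  fuel.\<close>

lemma run_meas:
  assumes "\<And>h. (\<lambda>s. a s h) \<in> cmeas" and "\<And>x. (\<lambda>s. m s x) \<in> cmeas"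
  shows "(\<lambda>s. map_option (\<lambda>(m', b, t). (m' x, b, t)) (run (a s) (m s))) \<in> cmeas"
proof -
  define R where "R s = map_option (\<lambda>(m', b, t). (m' x, b, t)) (run (a s) (m s))" for s
  define E where "E f s = map_option (\<lambda>(m', b, t). (m' x, b, t)) (exec f (a s) (m s) [])" for f s
  have E: "E f \<in> cmeas" for f unfolding E_def using exec_meas[OF assms] .
  have RE: "R s = Some v \<longleftrightarrow> (\<exists>f. E f s = Some v)" for s v
    unfolding R_def E_def by (auto simp: run_eq_Some)
  have "R \<in> cmeas"
  proof (subst measurable_count_space_eq_countable)
    have s1: "R -` {Some v} \<inter> space coins \<in> sets coins" for v
    proof -
      have "\<And>s. R s = Some v \<longleftrightarrow> (\<exists>f. E f s = Some v)" by (rule RE)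
      then have "R -` {Some v} \<inter> space coins = (\<Union>f. E f -` {Some v} \<inter> space coins)" by blast
      also have "\<dots> \<in> sets coins" using E by (intro sets.countable_UN) (auto intro: measurable_sets)
      finally show ?thesis .
    qed
    have "\<And>s. R s = None \<longleftrightarrow> (\<forall>f. E f s = None)" using RE not_None_eq by metis
    then have "R -` {None} \<inter> space coins = (\<Inter>f. E f -` {None} \<inter> space coins)" by blast
    also have "\<dots> \<in> sets coins" using E by (intro sets.countable_INT) (auto intro: measurable_sets)
    finally have "R -` {None} \<inter> space coins \<in> sets coins" .
    then show "R \<in> space coins \<rightarrow> UNIV \<and> (\<forall>a\<in>UNIV. R -` {a} \<inter> space coins \<in> sets coins)"
      using s1 by (metis UNIV_I Pi_I option.exhaust)
  qed simp
  then show ?thesis unfolding R_def .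
qed

lemma cost_meas:
  assumes "\<And>q h. (\<lambda>s. a s q h) \<in> cmeas" and "\<And>x. (\<lambda>s. m s x) \<in> cmeas" and "i < length qs"
  shows "(\<lambda>s. fst (exec_seq (a s) (m s) qs ! i)) \<in> borel_measurable coins"
  using assms(2,3)
proof (induction qs arbitrary: m i)
  case (Cons q qs)
  define R where "R x s = map_option (\<lambda>(m', b, t). (m' x, b, t)) (run (a s q) (m s))" for x s
  have R: "R x \<in> cmeas" for x unfolding R_def by (rule run_meas) (use assms Cons.prems in auto)
  show ?case
  proof (cases i)
    case 0
    define F :: "(nat \<times> bool \<times> nat) option \<Rightarrow> ennreal" where
      "F r = (case r of None \<Rightarrow> \<infinity> | Some (z, b, t) \<Rightarrow> of_nat t)" for r
    have "(\<lambda>s. F (R 0 s)) \<in> borel_measurable coins"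
      by (rule measurable_compose[OF R]) simp
    moreover have "F (R 0 s) = fst (exec_seq (a s) (m s) (q # qs) ! i)" for s
      by (auto simp: F_def R_def 0 split: option.splits)
    ultimately show ?thesis by simp
  next
    case (Suc j)
    define m2 where "m2 s = (case run (a s q) (m s) of None \<Rightarrow> m s | Some (m', b, t) \<Rightarrow> m')" for s
    have e: "exec_seq (a s) (m s) (q # qs) ! i = exec_seq (a s) (m2 s) qs ! j" for s
      by (auto simp: Suc m2_def split: option.splits)
    have "(\<lambda>s. m2 s x) \<in> cmeas" for x
    proof -
      have "(\<lambda>s. case r of None \<Rightarrow> m s x | Some (z, b, t) \<Rightarrow> z) \<in> cmeas" for r :: "(nat \<times> bool \<times> nat) option"
        using Cons.prems(1)[of x] by (cases r) auto
      from measurable_compose_countable[OF this R[of x]]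
      have "(\<lambda>s. case R x s of None \<Rightarrow> m s x | Some (z, b, t) \<Rightarrow> z) \<in> cmeas" .
      moreover have "(case R x s of None \<Rightarrow> m s x | Some (z, b, t) \<Rightarrow> z) = m2 s x" for s
        by (auto simp: R_def m2_def split: option.splits)
      ultimately show ?thesis by simp
    qed
    from Cons.IH[OF this] show ?thesis unfolding e using Cons.prems(2) Suc by simp
  qed
qed simp

fun total_probes :: "prog \<Rightarrow> mem \<Rightarrow> dop list \<Rightarrow> nat" where
  "total_probes A m [] = 0"
| "total_probes A m (q # qs) = card (cells A m q) + total_probes A (next_mem A m q) qs"

lemma total_probes_append: "total_probes A m (qs @ rs) = total_probes A m qs + total_probes A (mem_after A m qs) rs"
  by (induction qs arbitrary: m) auto

lemma card_cells_seq_le: "card (cells_seq A m qs) \<le> total_probes A m qs"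
proof (induction qs arbitrary: m)
  case (Cons q qs)
  have "card (cells_seq A m (q # qs)) \<le> card (cells A m q) + card (cells_seq A (next_mem A m q) qs)"
    by (simp add: card_Un_le)
  then show ?case using Cons[of "next_mem A m q"] by simp
qed simp

lemma total_probes_le_cost: "of_nat (total_probes A m qs) \<le> (\<Sum>i<length qs. fst (exec_seq A m qs ! i))"
proof -
  have "total_probes A m qs = (\<Sum>i<length qs. card (cells A (mem_after A m (take i qs)) (qs ! i)))"
    by (induction qs arbitrary: m) (simp_all add: sum.lessThan_Suc_shift del: sum.lessThan_Suc)
  then have "of_nat (total_probes A m qs) = (\<Sum>i<length qs. of_nat (card (cells A (mem_after A m (take i qs)) (qs ! i))) :: ennreal)"
    by simp
  also have "\<dots> \<le> (\<Sum>i<length qs. fst (exec_seq A m qs ! i))"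
    by (intro sum_mono card_cells_le_cost) simp
  finally show ?thesis .
qed

lemma length_wops: "n + N \<le> length ks \<Longrightarrow> length (workload n ks N) = n + 3 * N"
proof (induction N)
  case 0
  then show ?case by (simp add: workload_def)
next
  case (Suc N)
  then show ?case using workload_Suc[of n N ks] by simp
qed

lemma (in det_dict) sum_pc_le: "n + N \<le> length ks \<Longrightarrow> (\<Sum>t<N. card (probed ks t (Suc t))) \<le> total_probes A m0 (workload n ks N)"
proof (induction N)
  case (Suc N)
  have "card (probed ks N (Suc N)) \<le> total_probes A (mem_at ks N) (update_ops (Dk ks N (Suc N)) (Dk ks (n + N) (n + Suc N)))"
    unfolding probed_def by (rule card_cells_seq_le)
  moreover have "total_probes A m0 (workload n ks (Suc N)) = total_probes A m0 (workload n ks N) + total_probes A (mem_at ks N) (update_ops (Dk ks N (Suc N)) (Dk ks (n + N) (n + Suc N)))"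
    by (subst workload_split[of N "Suc N"]) (use Suc.prems in \<open>auto simp: total_probes_append mem_at_def\<close>)
  ultimately show ?case using Suc by simp
qed simp

lemma prob_coins: "prob_space coins"
  unfolding coins_def by (intro prob_space_PiM measure_pmf.prob_space_axioms)

text \<open>The total cost over all workloads has mean at most \<open>K\<close>, so it is not almost
  surely at least \<open>2 * K\<close>; a string below this value exists among those for which
  halting and correctness hold. The factor 2 comes from here, and \<open>n + 3 * N\<close> is the
  length of a workload.\<close>

lemma derandomize:
  assumes wf: "cp_wf S w init alg" and meas: "cp_measurable init alg" and corr: "cp_correct n U init alg"
    and n: "n > 0" and N: "N \<le> n" and U4: "4 * n \<le> U" and c: "c > 0"
    and cost: "\<And>qs i. valid_seq n U qs \<Longrightarrow> i < length qs \<Longrightarrow> exp_cost init alg qs i \<le> ennreal c"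
  shows "\<exists>A m0. det_dict n U S w A m0 \<and> det_dict.tot_avg n U A m0 N \<le> 2 * real (n + 3 * N) * c"
proof -
  interpret C: prob_space coins by (rule prob_coins)
  define Om where "Om = dlists {1..U} (n + N)"
  define L where "L = n + 3 * N"
  define f where "f s qs i = fst (exec_seq (alg s) (init s) qs ! i)" for s qs i
  have fm: "(\<lambda>s. f s qs i) \<in> borel_measurable coins" if "i < length qs" for qs i
    unfolding f_def by (rule cost_meas) (use meas that in \<open>auto simp: cp_measurable_def\<close>)
  have fi: "(\<integral>\<^sup>+s. f s qs i \<partial>coins) \<le> ennreal c" if "valid_seq n U qs" "i < length qs" for qs i
    using cost[OF that] by (simp add: exp_cost_def f_def)
  have finOm: "finite Om" by (simp add: Om_def finite_dlists)
  have cardOm: "card Om > 0" unfolding Om_def using N U4 by (simp add: card_dlists ffact_pos)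
  have L0: "L > 0" using n by (simp add: L_def)
  have OmD: "length ks = n + N" "distinct ks" "set ks \<subseteq> {1..U}" if "ks \<in> Om" for ks
    using that by (auto simp: Om_def dlists_def)
  have vw: "valid_seq n U (workload n ks N)" "length (workload n ks N) = L" if "ks \<in> Om" for ks
    using OmD[OF that] n by (auto intro!: workload_prefix_valid length_wops simp: L_def)
  have hlt: "AE s in coins. \<forall>qs. valid_seq n U qs \<longrightarrow> (\<forall>i<length qs. f s qs i \<noteq> \<infinity>)"
  proof -
    have "AE s in coins. valid_seq n U qs \<longrightarrow> (i < length qs \<longrightarrow> f s qs i \<noteq> \<infinity>)" for qs i
    proof (cases "valid_seq n U qs \<and> i < length qs")
      case True
      then have "(\<integral>\<^sup>+s. f s qs i \<partial>coins) < \<infinity>" using fi[of qs i] le_less_trans[OF _ ennreal_less_top] by auto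
      then have "(\<integral>\<^sup>+s. f s qs i \<partial>coins) \<noteq> \<infinity>" by simp
      then have "AE s in coins. f s qs i \<noteq> \<infinity>" using nn_integral_PInf_AE[OF fm] True by blast
      then show ?thesis by (rule eventually_mono) blast
    qed auto
    then have "\<forall>qs i. AE s in coins. valid_seq n U qs \<longrightarrow> (i < length qs \<longrightarrow> f s qs i \<noteq> \<infinity>)" by blast
    then have "AE s in coins. \<forall>qs i. valid_seq n U qs \<longrightarrow> (i < length qs \<longrightarrow> f s qs i \<noteq> \<infinity>)"
      unfolding AE_all_countable .
    then show ?thesis by (rule eventually_mono) blast
  qed
  define g where "g s = (\<Sum>ks\<in>Om. \<Sum>i<L. f s (workload n ks N) i)" for s
  define K where "K = real (card Om) * real L * c"
  have K0: "K > 0" using cardOm L0 c by (simp add: K_def)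
  have "(\<integral>\<^sup>+s. g s \<partial>coins) = (\<Sum>ks\<in>Om. \<Sum>i<L. \<integral>\<^sup>+s. f s (workload n ks N) i \<partial>coins)"
  proof -
    have "(\<integral>\<^sup>+s. g s \<partial>coins) = (\<Sum>ks\<in>Om. \<integral>\<^sup>+s. (\<Sum>i<L. f s (workload n ks N) i) \<partial>coins)"
      unfolding g_def by (intro nn_integral_sum borel_measurable_sum fm) (simp add: vw)
    also have "\<dots> = (\<Sum>ks\<in>Om. \<Sum>i<L. \<integral>\<^sup>+s. f s (workload n ks N) i \<partial>coins)"
      by (intro sum.cong refl nn_integral_sum fm) (simp add: vw)
    finally show ?thesis .
  qed
  also have "\<dots> \<le> (\<Sum>ks\<in>Om. \<Sum>i<L. ennreal c)"
    by (intro sum_mono fi) (use vw in auto)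
  also have "\<dots> = ennreal K"
    using c by (simp add: K_def ennreal_mult ennreal_of_nat_eq_real_of_nat mult.assoc)
  finally have gK: "(\<integral>\<^sup>+s. g s \<partial>coins) \<le> ennreal K" .
  have "\<not> (AE s in coins. ennreal (2 * K) \<le> g s)"
  proof
    assume "AE s in coins. ennreal (2 * K) \<le> g s"
    then have "(\<integral>\<^sup>+s. ennreal (2 * K) \<partial>coins) \<le> (\<integral>\<^sup>+s. g s \<partial>coins)" by (rule nn_integral_mono_AE)
    also have "\<dots> \<le> ennreal K" by (rule gK)
    finally have "ennreal (2 * K) \<le> ennreal K" by (simp add: C.emeasure_space_1)
    then show False using K0 by (simp add: ennreal_le_iff)
  qed
  moreover define good where "good s \<longleftrightarrow> (\<forall>qs. valid_seq n U qs \<longrightarrow> (\<forall>i<length qs. f s qs i \<noteq> \<infinity>)) \<and>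
      (\<forall>qs. valid_seq n U qs \<longrightarrow> (\<forall>i < length qs. \<forall>x b. qs ! i = Qry x \<longrightarrow>
            snd (exec_seq (alg s) (init s) qs ! i) = Some b \<longrightarrow> b = (x \<in> set_after (take i qs))))" for s
  have "AE s in coins. good s"
    using AE_conjI[OF hlt corr[unfolded cp_correct_def]] unfolding good_def .
  then have "AE s in coins. ennreal (2 * K) \<le> g s" if "\<And>s. good s \<Longrightarrow> ennreal (2 * K) \<le> g s"
    by (rule eventually_mono) (rule that)
  ultimately obtain s where good: "good s" and gs: "g s < ennreal (2 * K)" by (meson not_less)
  have h: "f s qs i \<noteq> \<infinity>" if "valid_seq n U qs" "i < length qs" for qs i
    using good that unfolding good_def by blast
  have co: "b = (x \<in> set_after (take i qs))" if "valid_seq n U qs" "i < length qs" "qs ! i = Qry x"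
            "snd (exec_seq (alg s) (init s) qs ! i) = Some b" for qs i x b
    using good that unfolding good_def by blast
  interpret D: det_dict n U S w "alg s" "init s"
  proof
    show "n > 0" by (rule n)
    show "init s a < 2 ^ w" if "a < S" for a using wf that by (simp add: cp_wf_def)
    show "a < S" if "alg s q h = Read a" for q h a using wf that unfolding cp_wf_def by blast
    show "a < S \<and> v < 2 ^ w" if "alg s q h = Write a v" for q h a v using wf that unfolding cp_wf_def by blast
    show al: "all_halt (alg s) (init s) qs" if "valid_seq n U qs" for qs
      unfolding all_halt_iff
    proof (intro allI impI)
      fix i assume "i < length qs"
      then show "halts (alg s) (mem_after (alg s) (init s) (take i qs)) (qs ! i)"
        using h[OF that] by (intro halts_of_cost) (simp_all add: f_def)
    qed
    show "ans (alg s) (mem_after (alg s) (init s) qs) (Qry x) = (x \<in> set_after qs)" if v: "valid_seq n U (qs @ [Qry x])" for qs x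
    proof -
      have "halts (alg s) (mem_after (alg s) (init s) qs) (Qry x)" using al[OF v] by simp
      then obtain m' b ps where r: "runp (alg s (Qry x)) (mem_after (alg s) (init s) qs) = Some (m', b, ps)"
        by (auto simp: halts_def)
      have "exec_seq (alg s) (init s) (qs @ [Qry x]) ! length qs = (of_nat (length ps), Some b)"
        by (subst exec_seq_nth) (simp_all add: r)
      then have "b = (x \<in> set_after (take (length qs) (qs @ [Qry x])))"
        using co[OF v, of "length qs" x b] by simp
      then show ?thesis using r by (simp add: ans_def)
    qed
  qed
  have "ennreal (\<Sum>ks\<in>Om. real (\<Sum>t<N. card (D.probed ks t (Suc t)))) \<le> g s"
  proof -
    have "ennreal (\<Sum>ks\<in>Om. real (\<Sum>t<N. card (D.probed ks t (Suc t)))) = (\<Sum>ks\<in>Om. of_nat (\<Sum>t<N. card (D.probed ks t (Suc t))))"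
      unfolding ennreal_of_nat_eq_real_of_nat by (rule sum_ennreal[symmetric]) (simp add: sum_nonneg)
    also have "\<dots> \<le> g s"
      unfolding g_def
    proof (rule sum_mono)
      fix ks assume ks: "ks \<in> Om"
      have "of_nat (\<Sum>t<N. card (D.probed ks t (Suc t))) \<le> (of_nat (total_probes (alg s) (init s) (workload n ks N)) :: ennreal)"
        using D.sum_pc_le[of N ks] OmD(1)[OF ks] by (simp del: of_nat_sum)
      also have "\<dots> \<le> (\<Sum>i<L. f s (workload n ks N) i)"
        using total_probes_le_cost[of "alg s" "init s" "workload n ks N"] vw(2)[OF ks] by (simp add: f_def)
      finally show "of_nat (\<Sum>t<N. card (D.probed ks t (Suc t))) \<le> (\<Sum>i<L. f s (workload n ks N) i)" .
    qed
    finally show ?thesis .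
  qed
  then have "ennreal (\<Sum>ks\<in>Om. real (\<Sum>t<N. card (D.probed ks t (Suc t)))) \<le> ennreal (2 * K)" using gs by simp
  then have "(\<Sum>ks\<in>Om. real (\<Sum>t<N. card (D.probed ks t (Suc t)))) \<le> 2 * K" using K0 by (subst (asm) ennreal_le_iff) auto
  then have "D.tot_avg N \<le> 2 * real L * c"
    unfolding D.tot_avg_def Om_def[symmetric] using cardOm by (simp add: K_def field_simps del: of_nat_sum)
  then show ?thesis using D.det_dict_axioms unfolding L_def by blast
qed

section \<open>Iterated logarithms and levels\<close>

context det_dict
begin

text \<open>An update changes the key set, hence the memory, and so must probe a cell. This settles
  bounded \<open>k\<close>.\<close>

lemma tot_avg_ge:
  assumes "N \<le> n" "4 * n \<le> U"
  shows "real N \<le> tot_avg N"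
proof -
  let ?Om = "dlists {1..U} (n + N)"
  have "N \<le> (\<Sum>t<N. card (probed ks t (Suc t)))" if ks: "ks \<in> ?Om" for ks
  proof -
    have k: "length ks = n + N" "distinct ks" "set ks \<subseteq> {1..U}" using ks by (auto simp: dlists_def)
    have "card (probed ks t (Suc t)) \<ge> 1" if t: "t < N" for t
    proof (rule ccontr)
      assume "\<not> card (probed ks t (Suc t)) \<ge> 1"
      then have "probed ks t (Suc t) = {}" by (simp add: not_le card_eq_0_iff)
      then have "mem_at ks (Suc t) = mem_at ks t" using t k by (intro ext probed_frame) auto
      moreover have "valid_seq n U (workload n ks t)" "valid_seq n U (workload n ks (Suc t))"
        using k t n0 by (auto intro!: workload_prefix_valid)
      ultimately have "set_after (workload n ks (Suc t)) = set_after (workload n ks t)"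
        by (intro same_mem_same_set) (simp_all add: mem_at_def)
      moreover have "set_after (workload n ks t) = set (current n ks t)" "set_after (workload n ks (Suc t)) = set (current n ks (Suc t))"
        using t k(1) by (simp_all add: set_after_wops[OF k(2) _ n0])
      ultimately have e: "set (current n ks (Suc t)) = set (current n ks t)" by metis
      have "n + t < length ks" using t k by simp
      note c = current_Suc[OF this n0]
      have "ks ! t \<in> set (current n ks t)" by (subst c(1)) simp
      moreover have "distinct (ks ! t # tl (current n ks t))"
        by (subst c(1)[symmetric]) (rule distinct_cur[OF k(2)])
      moreover have "ks ! t \<noteq> ks ! (n + t)" using k t n0 by (simp add: nth_eq_iff_index_eq)
      ultimately have "ks ! t \<in> set (tl (current n ks t) @ [ks ! (n + t)])" "ks ! t \<notin> set (tl (current n ks t) @ [ks ! (n + t)])"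
        using e unfolding c(2) by auto
      then show False by blast
    qed
    then have "(\<Sum>t<N. 1) \<le> (\<Sum>t<N. card (probed ks t (Suc t)))" by (intro sum_mono) auto
    then show ?thesis by simp
  qed
  then have "(\<Sum>ks\<in>?Om. real N) \<le> (\<Sum>ks\<in>?Om. real (\<Sum>t<N. card (probed ks t (Suc t))))"
    by (intro sum_mono of_nat_mono)
  moreover have "card ?Om > 0" using assms by (simp add: card_dlists ffact_pos)
  ultimately show ?thesis unfolding tot_avg_def by (simp add: pos_le_divide_eq mult.commute)
qed

text \<open>\<open>\<alpha>\<close> and \<open>\<beta>\<close> bound the redundancy per update of an
  interval and of a block. In units of \<open>Q\<close>, half of \<open>N\<close>, the gap supplies
  \<open>\<kappa> * log U\<close>. By \<open>add\<close> the redundancy, the probed sets and the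
  constants consume a quarter, and by \<open>lam\<close> the repeated keys another. The remaining
  half must come from the probes charged to the level, which explains
  \<open>\<kappa> / (8 * Wb)\<close>.\<close>

lemma level_lower:
  fixes x \<alpha> \<beta> \<kappa> Wb c :: real
  assumes x: "0 < x" "x \<le> 1 / 2" and h: "h \<ge> 2" and s: "s > 0" and N: "N = nb * (2 * h * s)" "N \<le> n" and U4: "4 * n \<le> U"
    and red1: "real (S * w) - log 2 (real (U choose n)) \<le> real s * \<alpha>"
    and red2: "real (S * w) - log 2 (real (U choose n)) \<le> real (2 * h * s) * \<beta>"
    and lam: "2 + 2 * \<beta> \<le> \<kappa> / 4 * log 2 (real h)"
    and S: "3 * x * S \<le> 3 / 2 * real s"
    and tot: "tot_avg N \<le> 10 * real N * c" and c: "0 \<le> c" and al: "0 \<le> \<alpha>"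
    and add: "2 * \<alpha> + 6 + 20 * c * (2 + log 2 (1 / x)) \<le> \<kappa> / 4 * log 2 (real U)"
    and gap: "\<kappa> * log 2 (real U) \<le> log 2 (real U) - log 2 (real n)"
    and W: "real (w + 1) \<le> Wb * log 2 (real U)" "Wb > 0"
  shows "\<kappa> / (8 * Wb) * real N \<le> lev_avg N s (2 * h * s)"
proof -
  define L where "L = log 2 (real U)"
  define R where "R = real (S * w) - log 2 (real (U choose n))"
  define lg where "lg = log 2 (real h)"
  define Q where "Q = real nb * (real h * real s)"
  have L0: "L > 0" using U4 n0 by (simp add: L_def)
  have lg0: "lg > 0" using h by (simp add: lg_def)
  have Q0: "Q \<ge> 0" by (simp add: Q_def)
  have NQ: "real N = 2 * Q" using N by (simp add: Q_def)
  have lx: "log 2 (1 / x) \<ge> 0" using x by simp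
  have lev0: "lev_avg N s (2 * h * s) \<ge> 0" unfolding lev_avg_def by (intro divide_nonneg_nonneg sum_nonneg) auto
  have t1: "real nb * (real h * R) \<le> Q * \<alpha>"
    using mult_left_mono[OF red1, of "real nb * real h"] by (simp add: Q_def R_def mult_ac)
  have t3: "real nb * R \<le> Q * \<alpha>"
  proof -
    have "real nb * R \<le> real nb * (real s * \<alpha>)" using red1 by (intro mult_left_mono) (auto simp: R_def)
    also have "\<dots> \<le> real h * (real nb * (real s * \<alpha>))"
      using h al mult_right_mono[of 1 "real h" "real nb * (real s * \<alpha>)"] by simp
    finally show ?thesis by (simp add: Q_def mult_ac)
  qed
  have t4: "real nb * ((2 * real h * real s + R) * L / lg) \<le> Q * (\<kappa> / 4 * L)"
  proof -
    have "(2 * real h * real s + R) \<le> real h * real s * (2 + 2 * \<beta>)"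
      using red2 by (simp add: R_def algebra_simps)
    also have "\<dots> \<le> real h * real s * (\<kappa> / 4 * lg)" using lam by (intro mult_left_mono) (auto simp: lg_def)
    finally have "(2 * real h * real s + R) * L / lg \<le> real h * real s * (\<kappa> / 4 * lg) * L / lg"
      using L0 lg0 by (intro divide_right_mono mult_right_mono) auto
    also have "\<dots> = real h * real s * (\<kappa> / 4 * L)" using lg0 by simp
    finally have "real nb * ((2 * real h * real s + R) * L / lg) \<le> real nb * (real h * real s * (\<kappa> / 4 * L))"
      by (intro mult_left_mono) auto
    then show ?thesis by (simp add: Q_def mult_ac)
  qed
  have t5: "real nb * (3 * x * S * real h) \<le> Q * (3 / 2)"
    using mult_left_mono[OF S, of "real nb * real h"] by (simp add: Q_def mult_ac)
  have t6: "(2 + log 2 (1 / x)) * tot_avg N \<le> Q * (20 * c * (2 + log 2 (1 / x)))"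
    using mult_left_mono[OF tot, of "2 + log 2 (1 / x)"] lx by (simp add: NQ mult_ac)
  have t7: "2 * (w + 1) * lev_avg N s (2 * h * s) \<le> 2 * (Wb * L) * lev_avg N s (2 * h * s)"
    using W(1) lev0 by (intro mult_right_mono) (auto simp: L_def)
  have eqQ: "real nb * (real h * real s * (L - log 2 (real n))) = Q * (L - log 2 (real n))" by (simp add: Q_def)
  have "real nb * (real h * real s * (L - log 2 (real n)))
    \<le> real nb * (real h * R + 4 * real h * real s + R + (2 * real h * real s + R) * L / lg + 3 * x * S * real h)
     + (2 + log 2 (1 / x)) * tot_avg N + 2 * (w + 1) * lev_avg N s (2 * h * s)"
    unfolding L_def R_def lg_def by (rule level_ineq[OF x h s N U4])
  also have "real nb * (real h * R + 4 * real h * real s + R + (2 * real h * real s + R) * L / lg + 3 * x * S * real h)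
    = real nb * (real h * R) + 4 * Q + real nb * R + real nb * ((2 * real h * real s + R) * L / lg) + real nb * (3 * x * S * real h)"
    by (simp add: Q_def distrib_left mult_ac)
  finally have "Q * (L - log 2 (real n)) \<le> Q * \<alpha> + 4 * Q + Q * \<alpha> + Q * (\<kappa> / 4 * L) + Q * (3 / 2)
     + Q * (20 * c * (2 + log 2 (1 / x))) + 2 * (Wb * L) * lev_avg N s (2 * h * s)"
    using t1 t3 t4 t5 t6 t7 unfolding eqQ by linarith
  also have "\<dots> \<le> Q * (2 * \<alpha> + 6 + 20 * c * (2 + log 2 (1 / x))) + Q * (\<kappa> / 4 * L) + 2 * (Wb * L) * lev_avg N s (2 * h * s)"
    using Q0 by (simp add: algebra_simps)
  also have "\<dots> \<le> Q * (\<kappa> / 4 * L) + Q * (\<kappa> / 4 * L) + 2 * (Wb * L) * lev_avg N s (2 * h * s)"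
    using mult_left_mono[OF add Q0] unfolding L_def by linarith
  finally have "Q * (L - log 2 (real n)) \<le> Q * (\<kappa> / 4 * L) + Q * (\<kappa> / 4 * L) + 2 * (Wb * L) * lev_avg N s (2 * h * s)" .
  moreover have "Q * (\<kappa> * L) \<le> Q * (L - log 2 (real n))" using gap Q0 by (intro mult_left_mono) (auto simp: L_def)
  ultimately have "L * (Q * \<kappa>) \<le> L * (4 * Wb * lev_avg N s (2 * h * s))" by (simp add: algebra_simps)
  then have "Q * \<kappa> \<le> 4 * Wb * lev_avg N s (2 * h * s)" using L0 by (simp only: mult_le_cancel_left_pos)
  then show ?thesis using W(2) by (simp add: NQ field_simps)
qed

end

lemma ilog_0 [simp]: "ilog 0 x = x" by (simp add: ilog_def)

lemma ilog_Suc: "ilog (Suc j) x = log 2 (ilog j x)" by (simp add: ilog_def)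

lemma log2_le: "x > 0 \<Longrightarrow> log 2 x \<le> (x::real)"
proof -
  assume x: "x > 0"
  have "x \<le> 2 powr x"
  proof -
    have "ln x \<le> x * ln 2"
    proof (cases "x \<ge> 1")
      case True
      have "ln (x / 2) \<le> x / 2 - 1" using x by (intro ln_le_minus_one) simp
      then have "ln x \<le> ln 2 + x / 2 - 1" using x by (simp add: ln_div)
      moreover have "x * (2 / 3) \<le> x * ln 2" using x ln2_ge_two_thirds by (intro mult_left_mono) auto
      ultimately show ?thesis using ln_2_less_1 x by linarith
    next
      case False
      then have "ln x \<le> 0" using x by simp
      moreover have "0 \<le> x * ln 2" using x by simp
      ultimately show ?thesis by linarith
    qed
    then have "exp (ln x) \<le> exp (x * ln 2)" by simp
    then show ?thesis using x by (simp add: powr_def)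
  qed
  then show ?thesis using x by (simp add: log_le_iff)
qed

lemma ilog_gt1: "j < k \<Longrightarrow> k \<le> log_star x \<Longrightarrow> ilog j x > 1"
  unfolding log_star_def using not_less_Least[of j "\<lambda>k. ilog k x \<le> 1"] by force

lemma ilog_powr: "j < k \<Longrightarrow> k \<le> log_star x \<Longrightarrow> 2 powr (ilog (Suc j) x) = ilog j x"
  using ilog_gt1[of j k x] by (simp add: ilog_Suc)

lemma ilog_antimono: "i \<le> j \<Longrightarrow> j \<le> k \<Longrightarrow> k \<le> log_star x \<Longrightarrow> ilog j x \<le> ilog i x"
proof (induction j rule: dec_induct)
  case (step j)
  have "ilog j x > 1" using ilog_gt1[of j k x] step by simp
  then have "ilog (Suc j) x \<le> ilog j x" using log2_le[of "ilog j x"] by (simp add: ilog_Suc)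
  then show ?case using step by simp
qed simp

text \<open>Going back from \<open>k\<close>, every step exponentiates, and exponentiation grows by
  at least one. This bounds \<open>ilog\<close> below on all levels used, and at index 2 it bounds
  \<open>k\<close> by \<open>ilog 2 n + 2\<close>.\<close>

lemma ilog_ge:
  assumes "k \<le> log_star x" "j < k"
  shows "ilog j x \<ge> real (k - j)"
proof -
  have "ilog (k - Suc i) x \<ge> real (Suc i)" if "i < k" for i
    using that
  proof (induction i)
    case 0
    then show ?case using ilog_gt1[of "k - 1" k x] assms by simp
  next
    case (Suc i)
    have e: "Suc (k - Suc (Suc i)) = k - Suc i" using Suc.prems by simp
    have "Suc (Suc i) \<le> 2 ^ Suc i" by (intro Suc_leI less_exp)
    then have "real (Suc (Suc i)) \<le> 2 ^ Suc i" by (metis of_nat_le_iff of_nat_numeral of_nat_power)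
    also have "\<dots> = 2 powr real (Suc i)" by (simp add: powr_realpow[symmetric] del: power_Suc)
    also have "\<dots> \<le> 2 powr (ilog (k - Suc i) x)" using Suc by (intro powr_mono) auto
    also have "\<dots> = ilog (k - Suc (Suc i)) x"
      using ilog_powr[of "k - Suc (Suc i)" k x] Suc.prems assms e by simp
    finally show ?case .
  qed
  from this[of "k - Suc j"] assms show ?thesis by simp
qed

text \<open>The source of the thresholds: the losses are quadratic in an iterated logarithm
  \<open>y\<close> and compete with the preceding one, \<open>2 powr y\<close>.\<close>

lemma powr_dominates:
  fixes a b c d :: real
  assumes "d > 0"
  shows "\<exists>Y0\<ge>1. \<forall>y\<ge>Y0. a + b * y + c * y\<^sup>2 \<le> d * 2 powr y"
proof -
  have "((\<lambda>y::real. (a + b * y + c * y\<^sup>2) / 2 powr y) \<longlongrightarrow> 0) at_top"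
  proof -
    have "((\<lambda>y::real. 1 / 2 powr y) \<longlongrightarrow> 0) at_top" "((\<lambda>y::real. y / 2 powr y) \<longlongrightarrow> 0) at_top"
      "((\<lambda>y::real. y\<^sup>2 / 2 powr y) \<longlongrightarrow> 0) at_top" by real_asymp+
    then have "((\<lambda>y::real. a * (1 / 2 powr y) + b * (y / 2 powr y) + c * (y\<^sup>2 / 2 powr y)) \<longlongrightarrow> a * 0 + b * 0 + c * 0) at_top"
      by (intro tendsto_intros)
    then show ?thesis by (simp add: add_divide_distrib)
  qed
  then have "eventually (\<lambda>y::real. (a + b * y + c * y\<^sup>2) / 2 powr y < d) at_top"
    using assms by (rule order_tendstoD)
  then obtain Y where Y: "\<And>y. y \<ge> Y \<Longrightarrow> (a + b * y + c * y\<^sup>2) / 2 powr y < d"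
    unfolding eventually_at_top_linorder by blast
  have "a + b * y + c * y\<^sup>2 \<le> d * 2 powr y" if "y \<ge> max 1 Y" for y
    using Y[of y] that by (simp add: divide_less_eq less_imp_le)
  then show ?thesis by (intro exI[of _ "max 1 Y"]) auto
qed

context det_dict
begin

text \<open>Level \<open>j\<close> has intervals of length \<open>2 ^ E j\<close> and blocks of
  length \<open>2 ^ E (Suc j)\<close>. Starting at \<open>j = 1\<close> keeps the losses per update
  of an interval quadratic in \<open>v\<close>, which \<open>log U\<close> absorbs. The bound on
  \<open>m\<close> ensures \<open>a (2 * Suc j) \<ge> Y\<close> on every level, so that
  \<open>log h\<close> absorbs the losses per update of a block.\<close>

lemma levels_lower:
  fixes C \<kappa> Wb C2 v c Y :: real and m k e :: nat
  defines "a \<equiv> \<lambda>j. ilog j (real n)"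
  assumes U4: "4 * n \<le> U" and e: "2 ^ e \<le> n" "n < 2 ^ (e + 1)"
    and C: "C > 0" and kap: "0 < \<kappa>" and Wb: "Wb > 0" and C2: "C2 \<ge> 1" and Y: "Y \<ge> 1"
    and k: "k \<le> log_star (real n)" "3 \<le> k" and m: "real (2 * m) + Y \<le> real k"
    and Yd: "\<And>y. y \<ge> Y \<Longrightarrow> (2 + 4 * C * y\<^sup>2) + \<kappa> / 4 * (y + 2) \<le> \<kappa> / 4 * 2 powr y"
      "\<And>y. y \<ge> Y \<Longrightarrow> 4 + y \<le> 1 * 2 powr y"
    and v: "v = a 2" and vd: "4 * C * v\<^sup>2 + 6 + 20 * (v + 2) * (2 + 4 * C2 * v) \<le> \<kappa> / 4 * 2 powr v" "v \<ge> 1"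
    and redund: "real (S * w) - log 2 (real (U choose n)) \<le> C * real n * a k"
    and S: "real S \<le> C2 * real n"
    and tot: "tot_avg (2 ^ e) \<le> 10 * real (2 ^ e) * c" and c: "0 \<le> c" "c \<le> real k"
    and gap: "\<kappa> * log 2 (real U) \<le> log 2 (real U) - log 2 (real n)"
    and W: "real (w + 1) \<le> Wb * log 2 (real U)"
  shows "real (m - 1) * (\<kappa> / (8 * Wb)) \<le> 10 * c"
proof -
  let ?N = "2 ^ e :: nat"
  \<comment> \<open>As \<open>2 powr a (2 * j + 1)\<close> equals \<open>a (2 * j)\<close>, this
    makes \<open>2 ^ d j\<close> the power of two just below \<open>a (2 * j)\<close>; lengths that
    are powers of two nest and divide \<open>2 ^ e\<close>.\<close>
  define d where "d j = nat \<lfloor>a (2 * j + 1)\<rfloor>" for j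
  define E where "E j = e - d j" for j
  have n1: "real n > 0" using n0 by simp
  have pw: "2 powr (a (Suc j)) = a j" if "j < k" for j
    using ilog_powr[OF that k(1)] by (simp add: a_def)
  have gt1: "a j > 1" if "j < k" for j using ilog_gt1[OF that k(1)] by (simp add: a_def)
  have anti: "a j \<le> a i" if "i \<le> j" "j \<le> k" for i j
    using ilog_antimono[OF that k(1)] by (simp add: a_def)
  have ge: "a j \<ge> real k - real j" if "j < k" for j
    using ilog_ge[OF k(1) that] that by (simp add: a_def of_nat_diff)
  have m2: "2 * m < k" using m Y by linarith
  \<comment> \<open>So \<open>c \<le> k\<close> is negligible against \<open>log 2 n\<close>, which
    is \<open>2 powr v\<close>.\<close>
  have kv: "real k \<le> v + 2" using ge[of 2] k(2) v by simp
  have a1: "a 1 = log 2 (real n)" "2 powr v = log 2 (real n)"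
    using pw[of 1] k(2) by (simp_all add: a_def ilog_Suc v eval_nat_numeral)
  have dle: "real (d j) \<le> a (2 * j + 1)" "a (2 * j + 1) - 1 \<le> real (d j)" if "j \<le> m" "2 * j + 1 \<le> k - 1" for j
  proof -
    have "a (2 * j + 1) > 1" using that k(2) by (intro gt1) simp
    then show "real (d j) \<le> a (2 * j + 1)" "a (2 * j + 1) - 1 \<le> real (d j)" unfolding d_def by linarith+
  qed
  have m21: "2 * m + 1 \<le> k" using m2 by simp
  have dpow: "2 ^ d j \<le> a (2 * j)" if "1 \<le> j" "j \<le> m" for j
  proof -
    have le: "real (d j) \<le> max 0 (a (2 * j + 1))" unfolding d_def by linarith
    have jk: "2 * j < k" using that m2 by simp
    have "a (2 * j + 1) = log 2 (a (2 * j))" by (simp add: a_def ilog_Suc)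
    then have "a (2 * j + 1) > 0" using gt1[OF jk] by simp
    then have "real (d j) \<le> a (2 * j + 1)" using le by simp
    then have "2 powr (real (d j)) \<le> 2 powr (a (2 * j + 1))" by (intro powr_mono) auto
    then show ?thesis using pw[OF jk] by (simp add: powr_realpow)
  qed
  have Ln: "real e + 1 \<ge> log 2 (real n)"
  proof -
    have "real n \<le> 2 ^ (e + 1)" using e(2) by (metis less_imp_le of_nat_le_iff of_nat_numeral of_nat_power)
    then have "log 2 (real n) \<le> log 2 (2 ^ (e + 1))" using n1 by (subst log_le_cancel_iff) auto
    also have "log 2 (2 ^ (e + 1)) = real (e + 1)" by (rule log_pow_cancel) auto
    finally show ?thesis by simp
  qed
  have de: "d j \<le> e" if "1 \<le> j" "j \<le> m" for j
  proof -
    have "(2::real) ^ d j \<le> v" using dpow[OF that] anti[of 2 "2 * j"] that m2 v by simp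
    moreover have "real (d j) + 1 \<le> 2 ^ d j"
      by (metis Suc_leI add.commute less_exp of_nat_Suc of_nat_le_iff of_nat_numeral of_nat_power)
    ultimately have "real (d j) + 1 \<le> v" by linarith
    also have "v \<le> 2 powr v" using log2_le[of "2 powr v"] by simp
    finally show ?thesis using Ln a1(2) by simp
  qed
  \<comment> \<open>Adjacent exponents differ by nearly \<open>2 powr y\<close>: \<open>d j\<close>
    is the floor of \<open>2 powr y\<close>, whereas \<open>d (Suc j)\<close> is at most
    \<open>y\<close>.\<close>
  have step: "d (Suc j) + 2 \<le> d j \<and> 2 + 2 * (2 * C * (a (2 * Suc j))\<^sup>2) \<le> \<kappa> / 4 * real (d j - d (Suc j) - 1)"
    if "1 \<le> j" "j < m" for j
  proof -
    define y where "y = a (2 * Suc j)"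
    have j2: "2 * Suc j < k" using that m2 by simp
    have yY: "y \<ge> Y" using ge[OF j2] that m unfolding y_def by simp
    have y1: "a (2 * j + 1) = 2 powr y" using pw[of "2 * j + 1"] j2 by (simp add: y_def)
    have y2: "a (2 * Suc j + 1) = log 2 y" by (simp add: a_def ilog_Suc y_def)
    have ly: "log 2 y \<le> y" "log 2 y \<ge> 0" using log2_le[of y] yY Y by auto
    have d1: "real (d j) \<ge> 2 powr y - 1" unfolding d_def y1 by linarith
    have d2: "real (d (Suc j)) \<le> y" unfolding d_def y2 using ly by linarith
    have "real (d (Suc j)) + 2 \<le> real (d j)" using Yd(2)[OF yY] d1 d2 by linarith
    then have dd: "d (Suc j) + 2 \<le> d j" by linarith
    then have "real (d j - d (Suc j) - 1) = real (d j) - real (d (Suc j)) - 1" by (simp add: of_nat_diff)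
    also have "\<dots> \<ge> 2 powr y - (y + 2)" using d1 d2 by linarith
    finally have "\<kappa> / 4 * real (d j - d (Suc j) - 1) \<ge> \<kappa> / 4 * (2 powr y - (y + 2))"
      using kap by (intro mult_left_mono) auto
    also have "\<kappa> / 4 * (2 powr y - (y + 2)) \<ge> 2 + 4 * C * y\<^sup>2" using Yd(1)[OF yY] by (simp add: algebra_simps)
    finally show ?thesis using dd by (simp add: y_def)
  qed
  have Emono: "E j \<le> E (Suc j)" if "1 \<le> j" "j < m" for j
    using step[OF that] unfolding E_def by (intro diff_le_mono2) simp
  have each: "\<kappa> / (8 * Wb) * real ?N \<le> lev_avg ?N (2 ^ E j) (2 ^ E (Suc j))" if j: "1 \<le> j" "j < m" for j
  proof -
    define y where "y = a (2 * Suc j)"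
    \<comment> \<open>The \<open>- 1\<close> makes room for the factor 2 in
      \<open>2 * h * s\<close>.\<close>
    define h where "h = (2::nat) ^ (d j - d (Suc j) - 1)"
    define s where "s = (2::nat) ^ E j"
    \<comment> \<open>With \<open>S \<le> C2 * n\<close> this makes \<open>3 * x * S\<close> at most
      \<open>3 / 2 * s\<close>, while \<open>log (1 / x)\<close> stays at most linear in
      \<open>v\<close>.\<close>
    define x where "x = real s / (2 * C2 * real n)"
    note st = step[OF j]
    have dj: "d j \<le> e" "d (Suc j) \<le> e" using de[of j] de[of "Suc j"] j by auto
    have B: "2 * h * s = 2 ^ E (Suc j)"
    proof -
      have "Suc (d j - d (Suc j) - 1) + E j = E (Suc j)"
        using conjunct1[OF st] dj unfolding E_def by linarith
      then have "(2::nat) ^ E (Suc j) = 2 * 2 ^ (d j - d (Suc j) - 1) * 2 ^ E j" by (metis power_Suc power_add)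
      then show ?thesis by (simp add: h_def s_def)
    qed
    have NB: "?N = 2 ^ d (Suc j) * (2 * h * s)" using dj by (simp add: B E_def power_add[symmetric])
    have Ns: "?N = 2 ^ d j * s" using dj by (simp add: s_def E_def power_add[symmetric])
    have jk: "2 * j < k" "2 * Suc j < k" using j m2 by auto
    have y1: "y \<ge> Y" using ge[OF jk(2)] j m unfolding y_def by simp
    have yv: "y \<le> v" unfolding y_def v using jk j by (intro anti) auto
    have ak: "a k \<le> y" unfolding y_def using jk by (intro anti) auto
    have n2N: "real n \<le> 2 * real ?N"
    proof -
      have "n \<le> 2 * ?N" using e(2) by simp
      then have "real n \<le> real (2 * ?N)" by (simp only: of_nat_le_iff)
      then show ?thesis by simp
    qed
    have ns: "real n \<le> 2 * v * real s"
    proof -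
      have "(2::real) ^ d j \<le> v" using dpow[of j] anti[of 2 "2 * j"] j jk v by simp
      then have "2 ^ d j * real s \<le> v * real s" by (intro mult_right_mono) auto
      moreover have "real ?N = 2 ^ d j * real s" by (subst Ns) simp
      ultimately show ?thesis using n2N by linarith
    qed
    have nB: "real n \<le> 2 * y * real (2 * h * s)"
    proof -
      have "(2::real) ^ d (Suc j) \<le> y" using dpow[of "Suc j"] j by (simp add: y_def)
      then have "2 ^ d (Suc j) * real (2 * h * s) \<le> y * real (2 * h * s)" by (intro mult_right_mono) auto
      moreover have "real ?N = 2 ^ d (Suc j) * real (2 * h * s)" by (subst NB) simp
      ultimately show ?thesis using n2N by linarith
    qed
    have rd: "real (S * w) - log 2 (real (U choose n)) \<le> C * real n * y"

    proof -
      have "C * real n * a k \<le> C * real n * y" using ak C by (intro mult_left_mono) auto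
      then show ?thesis using redund by linarith
    qed
    have s1: "real s \<ge> 1" by (simp add: s_def)
    have sn: "real s \<le> real n"
    proof -
      have "s \<le> ?N" unfolding s_def by (intro power_increasing) (auto simp: E_def)
      then show ?thesis using e(1) by simp
    qed
    have x0: "0 < x" "x \<le> 1 / 2"
    proof -
      show "0 < x" using s1 n1 C2 by (simp add: x_def)
      have "1 * real n \<le> C2 * real n" using C2 by (intro mult_right_mono) auto
      then have "real s \<le> C2 * real n" using sn by linarith
      then show "x \<le> 1 / 2" using n1 C2 by (simp add: x_def field_simps)
    qed
    have lx: "log 2 (1 / x) \<le> 4 * C2 * v"
    proof -
      have "1 / x = 2 * C2 * (real n / real s)" by (simp add: x_def)
      also have "\<dots> \<le> 2 * C2 * (2 * v)" using ns s1 C2 by (intro mult_left_mono) (auto simp: field_simps)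
      finally have "1 / x \<le> 4 * C2 * v" by simp
      moreover have "log 2 (1 / x) \<le> 1 / x" using x0 by (intro log2_le) simp
      ultimately show ?thesis by linarith
    qed
    have lx0: "log 2 (1 / x) \<ge> 0" using x0 by simp
    have nU: "n \<le> U" using U4 by simp
    have "\<kappa> / (8 * Wb) * real ?N \<le> lev_avg ?N s (2 * h * s)"
    proof (rule level_lower[OF x0 _ _ NB e(1) U4])
      show "h \<ge> 2"
      proof -
        have "(2::nat) ^ 1 \<le> h" unfolding h_def using conjunct1[OF st] by (intro power_increasing) auto
        then show ?thesis by simp
      qed
      show "s > 0" by (simp add: s_def)
      show "real (S * w) - log 2 (real (U choose n)) \<le> real s * (2 * C * v\<^sup>2)"
      proof -
        have "C * real n * y \<le> C * (2 * v * real s) * v"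
          using ns yv C y1 Y by (intro mult_mono) auto
        then show ?thesis using rd by (simp add: power2_eq_square mult_ac)
      qed
      show "real (S * w) - log 2 (real (U choose n)) \<le> real (2 * h * s) * (2 * C * y\<^sup>2)"
      proof -
        have "C * real n * y \<le> C * (2 * y * real (2 * h * s)) * y"
          using nB C y1 Y by (intro mult_right_mono mult_left_mono) auto
        then show ?thesis using rd by (simp add: power2_eq_square mult_ac)
      qed
      show "2 + 2 * (2 * C * y\<^sup>2) \<le> \<kappa> / 4 * log 2 (real h)"

      proof -
        have "log 2 (real h) = real (d j - d (Suc j) - 1)" unfolding h_def by (simp add: log_nat_power)
        then show ?thesis using conjunct2[OF st] unfolding y_def by simp
      qed
      show "3 * x * real S \<le> 3 / 2 * real s"
      proof -
        have "3 * x * real S \<le> 3 * x * (C2 * real n)" using S x0 by (intro mult_left_mono) auto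
        also have "\<dots> = 3 / 2 * real s" using n1 C2 by (simp add: x_def)
        finally show ?thesis .
      qed
      show "tot_avg ?N \<le> 10 * real ?N * c" by (rule tot)
      show "0 \<le> c" by (rule c(1))
      show "0 \<le> 2 * C * v\<^sup>2" using C by simp
      have "c * (2 + log 2 (1 / x)) \<le> (v + 2) * (2 + 4 * C2 * v)"
        using c kv lx lx0 vd(2) by (intro mult_mono) auto
      moreover have "\<kappa> / 4 * 2 powr v \<le> \<kappa> / 4 * log 2 (real U)"
      proof -
        have "log 2 (real n) \<le> log 2 (real U)" using n1 nU by (subst log_le_cancel_iff) auto
        then show ?thesis using a1(2) kap by (intro mult_left_mono) auto
      qed
      ultimately show "2 * (2 * C * v\<^sup>2) + 6 + 20 * c * (2 + log 2 (1 / x)) \<le> \<kappa> / 4 * log 2 (real U)"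
        using vd(1) unfolding mult.assoc by linarith
      show "\<kappa> * log 2 (real U) \<le> log 2 (real U) - log 2 (real n)" by (rule gap)
      show "real (w + 1) \<le> Wb * log 2 (real U)" by (rule W)
      show "Wb > 0" by (rule Wb)
    qed
    then show ?thesis unfolding B unfolding s_def .
  qed
  have "real (m - 1) * (\<kappa> / (8 * Wb) * real ?N) = (\<Sum>j\<in>{1..<m}. \<kappa> / (8 * Wb) * real ?N)" by simp
  also have "\<dots> \<le> (\<Sum>j\<in>{1..<m}. lev_avg ?N (2 ^ E j) (2 ^ E (Suc j)))"
    by (rule sum_mono) (use each in auto)
  also have "\<dots> \<le> tot_avg ?N" by (rule sum_levels_le) (use Emono in auto)
  also have "\<dots> \<le> 10 * real ?N * c" by (rule tot)
  finally have "real ?N * (real (m - 1) * (\<kappa> / (8 * Wb))) \<le> real ?N * (10 * c)" by (simp add: mult_ac)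
  moreover have "real ?N > 0" by simp
  ultimately show ?thesis by (simp only: mult_le_cancel_left_pos)
qed

end

theorem theorem1:
  fixes c1 c2 cw1 cw2 C :: real
  assumes "c1 > 0" and "cw1 > 0" and "C > 0"
  shows "\<exists>\<epsilon>>0. \<exists>N::nat. \<forall>(n::nat) (U::nat) (w::nat) (k::nat) (S::nat)
            (init :: (nat \<Rightarrow> bool) \<Rightarrow> mem) (alg :: (nat \<Rightarrow> bool) \<Rightarrow> dop \<Rightarrow> hist \<Rightarrow> action).
     n \<ge> N
     \<and> real n powr (1 + c1) \<le> real U \<and> real U \<le> real n powr c2
     \<and> cw1 * log 2 (real U) \<le> real w \<and> real w \<le> cw2 * log 2 (real U)
     \<and> 1 \<le> k \<and> k \<le> log_star (real n)
     \<and> real S * real w \<le> log 2 (real (U choose n)) + C * real n * ilog k (real n)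
     \<and> cp_wf S w init alg \<and> cp_measurable init alg \<and> cp_correct n U init alg
     \<longrightarrow> (\<exists>qs i. valid_seq n U qs \<and> i < length qs \<and>
            exp_cost init alg qs i \<ge> ennreal (\<epsilon> * real k))"
proof -
  \<comment> \<open>From \<open>log U \<ge> (1 + c1) * log n\<close>: at least this fraction of
    \<open>log U\<close> lies above \<open>log n\<close>.\<close>
  define \<kappa> where "\<kappa> = c1 / (1 + c1)"
  \<comment> \<open>The summand 1 pays for the extra bit in \<open>w + 1\<close>, as
    \<open>log U \<ge> 1\<close>.\<close>
  define Wb where "Wb = max cw2 0 + 1"
  \<comment> \<open>Space is at most \<open>(1 + C) * n * log U\<close> bits and a cell has at least
    \<open>cw1 * log U\<close>, so \<open>S \<le> C2 * n\<close>.\<close>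
  define C2 where "C2 = max 1 ((1 + C) / cw1)"
  have kap: "0 < \<kappa>" using assms(1) by (simp add: \<kappa>_def)
  have Wb: "Wb > 0" by (simp add: Wb_def)
  have C2: "C2 \<ge> 1" by (simp add: C2_def)
  obtain Y1 where Y1: "Y1 \<ge> 1" "\<And>y. y \<ge> Y1 \<Longrightarrow> (2 + \<kappa> / 2) + (\<kappa> / 4) * y + (4 * C) * y\<^sup>2 \<le> \<kappa> / 4 * 2 powr y"
    using powr_dominates[of "\<kappa> / 4" "2 + \<kappa> / 2" "\<kappa> / 4" "4 * C"] kap by auto
  obtain Y2 where Y2: "Y2 \<ge> 1" "\<And>y. y \<ge> Y2 \<Longrightarrow> 4 + 1 * y + 0 * y\<^sup>2 \<le> 1 * 2 powr (y::real)"
    using powr_dominates[of 1 4 1 0] by auto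
  \<comment> \<open>The polynomial is
    \<open>4 * C * v * v + 6 + 20 * (v + 2) * (2 + 4 * C2 * v)\<close>, expanded for the hypothesis
    \<open>vd\<close> of \<open>levels_lower\<close>.\<close>
  obtain V where V: "V \<ge> 1" "\<And>v. v \<ge> V \<Longrightarrow> 86 + (40 + 160 * C2) * v + (4 * C + 80 * C2) * v\<^sup>2 \<le> \<kappa> / 4 * 2 powr v"
    using powr_dominates[of "\<kappa> / 4" 86 "40 + 160 * C2" "4 * C + 80 * C2"] kap by auto
  define Y where "Y = max Y1 Y2"
  \<comment> \<open>Large enough for \<open>8 * (m - 1) \<ge> k\<close> when
    \<open>k \<ge> K0\<close>, where \<open>m\<close> is the number of exponents \<open>d j\<close>
    used below.\<close>
  define K0 where "K0 = 2 * nat \<lceil>Y\<rceil> + 8"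
  \<comment> \<open>For \<open>k < K0\<close> the first bound contradicts
    \<open>1 \<le> 8 * c\<close>. Otherwise the levels give
    \<open>81 * (m - 1) \<le> 10 * k\<close>, whereas
    \<open>10 * k \<le> 80 * (m - 1)\<close>.\<close>
  define \<epsilon> where "\<epsilon> = min (1 / (9 * real K0)) (\<kappa> / (8 * Wb) / 81)"
  have K0: "K0 > 0" by (simp add: K0_def)
  have Y: "Y \<ge> 1" "Y \<le> real (nat \<lceil>Y\<rceil>)" using Y1(1) by (auto simp: Y_def real_nat_ceiling_ge)
  have eps0: "\<epsilon> > 0" using K0 kap Wb by (simp add: \<epsilon>_def)
  have eps1: "\<epsilon> * real K0 \<le> 1 / 9"
  proof -
    have "\<epsilon> * real K0 \<le> 1 / (9 * real K0) * real K0" by (intro mult_right_mono) (auto simp: \<epsilon>_def)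
    then show ?thesis using K0 by simp
  qed
  have eps2: "81 * \<epsilon> \<le> \<kappa> / (8 * Wb)" by (simp add: \<epsilon>_def)
  have eps3: "\<epsilon> \<le> 1"
  proof -
    have "\<epsilon> \<le> \<epsilon> * real K0" using eps0 K0 by simp
    then show ?thesis using eps1 by linarith
  qed
  \<comment> \<open>The three parts ensure \<open>ilog 2 n \<ge> V\<close>,
    \<open>4 * n \<le> U\<close> and \<open>n \<ge> 2\<close>.\<close>
  define N where "N = nat \<lceil>max (2 powr (2 powr V)) (4 powr (1 / c1))\<rceil> + 2"
  have main: "\<exists>qs i. valid_seq n U qs \<and> i < length qs \<and> exp_cost init alg qs i \<ge> ennreal (\<epsilon> * real k)"
    if nN: "n \<ge> N" and U: "real n powr (1 + c1) \<le> real U"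
      and w: "cw1 * log 2 (real U) \<le> real w" "real w \<le> cw2 * log 2 (real U)"
      and k: "1 \<le> k" "k \<le> log_star (real n)"
      and S: "real S * real w \<le> log 2 (real (U choose n)) + C * real n * ilog k (real n)"
      and ds: "cp_wf S w init alg" "cp_measurable init alg" "cp_correct n U init alg"
    for n U w k S :: nat and init :: "(nat \<Rightarrow> bool) \<Rightarrow> mem" and alg :: "(nat \<Rightarrow> bool) \<Rightarrow> dop \<Rightarrow> hist \<Rightarrow> action"
  proof (rule ccontr)
    assume no: "\<not> (\<exists>qs i. valid_seq n U qs \<and> i < length qs \<and> exp_cost init alg qs i \<ge> ennreal (\<epsilon> * real k))"
    define c where "c = \<epsilon> * real k"
    have c0: "c > 0" using eps0 k by (simp add: c_def)
    have cost: "exp_cost init alg qs i \<le> ennreal c" if "valid_seq n U qs" "i < length qs" for qs i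
      using no that unfolding c_def by (meson linear)
    have nb: "real n \<ge> 2 powr (2 powr V)" "real n \<ge> 4 powr (1 / c1)" "n \<ge> 2"
      using nN unfolding N_def by linarith+
    have n0: "n > 0" "real n > 0" using nb by auto
    define L where "L = log 2 (real U)"
    have U4: "4 * n \<le> U"
    proof -
      have "4 = (4 powr (1 / c1)) powr c1" using assms(1) by (simp add: powr_powr)
      also have "\<dots> \<le> real n powr c1" using nb(2) assms(1) by (intro powr_mono2) auto
      finally have "4 * real n \<le> real n powr c1 * real n" using n0 by (intro mult_right_mono) auto
      also have "\<dots> = real n powr (1 + c1)" using n0 by (simp add: powr_add)
      finally have "real (4 * n) \<le> real U" using U by simp
      then show ?thesis by (simp only: of_nat_le_iff)
    qed
    have U0: "real U > 0" using U4 n0 by simp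
    have nU: "(1 + c1) * log 2 (real n) \<le> L"
    proof -
      have "(1 + c1) * log 2 (real n) = log 2 (real n powr (1 + c1))" using n0 by (simp add: log_powr)
      also have "\<dots> \<le> L" unfolding L_def using U n0 U0 by (subst log_le_cancel_iff) auto
      finally show ?thesis .
    qed
    have ln1: "log 2 (real n) \<ge> 1" using nb(3) by simp
    have "1 * log 2 (real n) \<le> (1 + c1) * log 2 (real n)"
      using ln1 assms(1) by (intro mult_right_mono) auto
    then have lnL: "log 2 (real n) \<le> L" and L1: "L \<ge> 1" using nU ln1 by linarith+
    have gap: "\<kappa> * L \<le> L - log 2 (real n)"
    proof -
      have "log 2 (real n) \<le> L / (1 + c1)" using nU assms(1) by (simp add: field_simps)
      moreover have "L - L / (1 + c1) = \<kappa> * L" using assms(1) by (simp add: \<kappa>_def field_simps)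
      ultimately show ?thesis by simp
    qed
    have W: "real (w + 1) \<le> Wb * L"
    proof -
      have "cw2 * L \<le> max cw2 0 * L" using L1 by (intro mult_right_mono) auto
      moreover have "real w \<le> cw2 * L" using w(2) by (simp add: L_def)
      moreover have "Wb * L = max cw2 0 * L + L" by (simp add: Wb_def distrib_right)
      moreover have "real (w + 1) = real w + 1" by simp
      ultimately show ?thesis using L1 by linarith
    qed
    show False
    proof (cases "k < K0")
      \<comment> \<open>For bounded \<open>k\<close> one probed cell per update is enough.\<close>
      case True
      from derandomize[OF ds n0(1) order_refl U4 c0 cost] obtain A m0 where
        D: "det_dict n U S w A m0" "det_dict.tot_avg n U A m0 n \<le> 2 * real (n + 3 * n) * c" by blast
      interpret D: det_dict n U S w A m0 by (rule D(1))
      have "real n \<le> 8 * real n * c" using D.tot_avg_ge[OF order_refl U4] D(2) by simp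
      then have "1 \<le> 8 * c" using n0 by simp
      moreover have "c \<le> \<epsilon> * real K0" unfolding c_def using True eps0 by (intro mult_left_mono) auto
      ultimately show False using eps1 by linarith
    next
      case False
      define m where "m = (k - nat \<lceil>Y\<rceil>) div 2"
      \<comment> \<open>The number of updates is a power of two, so that all block lengths divide
        it. It exceeds n / 2, which turns the factor \<open>2 * (n + 3 * 2 ^ e)\<close> into at most
        \<open>10 * 2 ^ e\<close>.\<close>
      obtain e where e: "2 ^ e \<le> n" "n < 2 ^ (e + 1)" using ex_power_ivl1[of 2 n] n0 by auto
      from derandomize[OF ds n0(1) e(1) U4 c0 cost] obtain A m0 where
        D: "det_dict n U S w A m0" "det_dict.tot_avg n U A m0 (2 ^ e) \<le> 2 * real (n + 3 * 2 ^ e) * c" by blast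
      interpret D: det_dict n U S w A m0 by (rule D(1))
      have kY: "k \<ge> 2 * nat \<lceil>Y\<rceil> + 8" using False by (simp add: K0_def)
      have tot: "D.tot_avg (2 ^ e) \<le> 10 * real (2 ^ e) * c"
      proof -
        have "real n \<le> 2 * 2 ^ e"
          using e(2) by (metis less_imp_le of_nat_le_iff of_nat_numeral of_nat_power power_Suc Suc_eq_plus1)
        then have "2 * real (n + 3 * 2 ^ e) \<le> 10 * real (2 ^ e)" by simp
        then have "2 * real (n + 3 * 2 ^ e) * c \<le> 10 * real (2 ^ e) * c" using c0 by (intro mult_right_mono) auto
        then show ?thesis using D(2) by linarith
      qed
      have redund: "real (S * w) - log 2 (real (U choose n)) \<le> C * real n * ilog k (real n)" using S by simp
      have k3: "3 \<le> k" using kY by simp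
      have SS: "real S \<le> C2 * real n"
      proof -
        have "log 2 (real (U choose n)) \<le> log 2 (real (U ^ n))"
        proof (subst log_le_cancel_iff)
          have "n \<le> U" using U4 by simp
          then show "real (U choose n) \<le> real (U ^ n)" using binomial_le_pow by (simp only: of_nat_le_iff)
          show "0 < real (U choose n)" using U4 by simp
        qed (use U0 in auto)
        also have "\<dots> = real n * L" using U0 by (simp add: log_nat_power L_def)
        finally have b: "log 2 (real (U choose n)) \<le> real n * L" .
        have "ilog k (real n) \<le> ilog 1 (real n)" using k by (intro ilog_antimono) auto
        also have "\<dots> = log 2 (real n)" by (simp add: ilog_def)
        finally have "C * real n * ilog k (real n) \<le> C * real n * L"
          using lnL assms(3) by (intro mult_left_mono) auto
        then have "real S * real w \<le> (1 + C) * real n * L" using S b by (simp add: algebra_simps)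
        moreover have "real S * (cw1 * L) \<le> real S * real w" using w(1) by (intro mult_left_mono) (auto simp: L_def)
        ultimately have "(real S * cw1) * L \<le> ((1 + C) * real n) * L" by simp
        then have "real S * cw1 \<le> (1 + C) * real n" using L1 by simp
        then have "real S \<le> (1 + C) / cw1 * real n" using assms(2) by (simp add: field_simps)
        also have "\<dots> \<le> C2 * real n" by (intro mult_right_mono) (auto simp: C2_def)
        finally show ?thesis .
      qed
      define v where "v = ilog 2 (real n)"
      have vV: "v \<ge> V"
      proof -
        have "2 powr V \<le> log 2 (real n)" using nb(1) n0 by (simp add: le_log_iff)
        moreover have "0 < log 2 (real n)" using ln1 by simp
        ultimately have "V \<le> log 2 (log 2 (real n))" by (simp add: le_log_iff)
        then show ?thesis by (simp add: v_def ilog_def eval_nat_numeral)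
      qed
      have vd: "4 * C * v\<^sup>2 + 6 + 20 * (v + 2) * (2 + 4 * C2 * v) \<le> \<kappa> / 4 * 2 powr v"
        using V(2)[OF vV] by (simp add: algebra_simps power2_eq_square)
      have mk: "real (2 * m) + Y \<le> real k"
      proof -
        have "2 * m + nat \<lceil>Y\<rceil> \<le> k" unfolding m_def using kY by simp
        then have "real (2 * m) + real (nat \<lceil>Y\<rceil>) \<le> real k" by linarith
        then show ?thesis using Y by linarith
      qed
      have Yd1: "(2 + 4 * C * y\<^sup>2) + \<kappa> / 4 * (y + 2) \<le> \<kappa> / 4 * 2 powr y" if "y \<ge> Y" for y

      proof -
        have "\<kappa> / 4 * (y + 2) = \<kappa> / 4 * y + \<kappa> / 2" by (simp add: distrib_left)
        moreover have "y \<ge> Y1" using that by (simp add: Y_def)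
        ultimately show ?thesis using Y1(2)[of y] by linarith
      qed
      have Yd2: "4 + y \<le> 1 * 2 powr y" if "y \<ge> Y" for y
        using Y2(2)[of y] that by (simp add: Y_def)
      have ck: "c \<le> real k" unfolding c_def using eps3 by (simp add: mult_left_le_one_le eps0 less_imp_le)
      have "real (m - 1) * (\<kappa> / (8 * Wb)) \<le> 10 * c"
        by (rule D.levels_lower[OF U4 e assms(3) kap Wb C2 Y(1) k(2) k3 mk Yd1 Yd2 v_def vd _ redund SS tot _ ck _ _])
           (use vV V(1) c0 gap W in \<open>auto simp: L_def\<close>)
      moreover have "real (m - 1) * (81 * \<epsilon>) \<le> real (m - 1) * (\<kappa> / (8 * Wb))"
        using eps2 by (intro mult_left_mono) auto
      ultimately have "81 * real (m - 1) * \<epsilon> \<le> 10 * real k * \<epsilon>" by (simp add: c_def mult_ac)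
      then have "81 * real (m - 1) \<le> 10 * real k" using eps0 by (simp only: mult_le_cancel_right_pos)
      moreover have "8 * (m - 1) \<ge> k"
      proof -
        have "2 * m + 1 \<ge> k - nat \<lceil>Y\<rceil>" unfolding m_def by simp
        then show ?thesis using kY by linarith
      qed
      then have "8 * real (m - 1) \<ge> real k" by linarith
      ultimately show False using kY by linarith
    qed
  qed
  show ?thesis
    by (intro exI[of _ \<epsilon>] conjI eps0 exI[of _ N] allI impI) (rule main; blast)
qed

end
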